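(* Let $\Gamma$ be a locally finite infinite connected graph of rank at least $2$. Then $\mathrm{MCG}(\Gamma)$ is not amenable. Moreover, if $\Gamma$ is of infinite type, then every open subgroup of $\mathrm{MCG}(\Gamma)$ is not amenable.
   Context: The rank of a connected graph $\Gamma$ is the rank (possibly infinite) of the free group $\pi_1(\Gamma)$. The end space of $\Gamma$ is $\partial\Gamma=\varprojlim_{K}\pi_0(\Gamma\setminus K)$, the limit running over compact $K\subset\Gamma$, with the inverse limit topology. $\Gamma$ is of infinite type if $\pi_1(\Gamma)$ is not finitely generated and the end space $\partial\Gamma$ is not finite. A map $f:X\to Y$ is a proper homotopy equivalence if it is proper and there is a proper map $g:Y\to X$ such that $f\circ g$ and $g\circ f$ are properly homotopic to the identity. $\mathrm{MCG}(\Gamma)$ is the group of proper homotopy equivalences $\Gamma\to\Gamma$ up to proper homotopy. Its topology is the quotient, by proper homotopy, of the compact-open topology on inverse pairs of proper homotopy equivalences; it is a Polish group topology. Equivalently, a neighbourhood basis of the identity is given by the open subgroups $U_K$, for $K\subset\Gamma$ a finite subgraph, where $U_K$ is the set of classes $[f]$ having a representative $f$ such that: (1) $f=\mathrm{Id}$ on $K$; (2) $f$ preserves each complementary component of $K$; (3) there is a representative $g$ of $[f]^{-1}$ also satisfying (1) and (2); (4) there are proper homotopies $gf\simeq\mathrm{Id}$ and $fg\simeq\mathrm{Id}$ that are stationary on $K$ (i.e. equal to the identity on $K$ at all times) and preserve the complementary components of $K$. A topological group $G$ is amenable if every continuous action of $G$ on a (non-empty, Hausdorff) compact space admits a $G$-invariant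 Borel (regular) probability measure. Subgroups carry the subspace topology. *)

theory Defs
  imports
    "HOL-Analysis.Analysis"
    "HOL-Algebra.Generated_Groups"
    "HOL-Algebra.Group_Action"
    "HOL-Probability.Probability_Measure"
    "Graph_Theory.Digraph_Component"
begin

section \<open>Graphs as one-dimensional CW complexes\<close>

text \<open>
  A graph (loops and multiple edges allowed) is given by its combinatorial data, where every edge
  is equipped with an arbitrary orientation. A point of the space is either a vertex \<open>Inl v\<close> or a
  point \<open>Inr (e, t)\<close>, \<open>0 < t < 1\<close>, in the interior of the edge \<open>e\<close>.
\<close>

type_synonym ('v, 'e) gpoint = "'v + 'e \<times> real"

definition graph_points :: "('v, 'e) pre_digraph \<Rightarrow> ('v, 'e) gpoint set" where
  "graph_points G = Inl ` verts G \<union> Inr ` (arcs G \<times> {0<..<1})"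

text \<open>The characteristic map of an edge.\<close>

definition edge_map :: "('v, 'e) pre_digraph \<Rightarrow> 'e \<Rightarrow> real \<Rightarrow> ('v, 'e) gpoint" where
  "edge_map G e t =
     (if t \<le> 0 then Inl (tail G e) else if 1 \<le> t then Inl (head G e) else Inr (e, t))"

text \<open>The weak topology: the quotient topology of vertices and closed edges.\<close>

definition graph_space :: "('v, 'e) pre_digraph \<Rightarrow> ('v, 'e) gpoint topology" where
  "graph_space G = topology (\<lambda>U. U \<subseteq> graph_points G \<and>
     (\<forall>e\<in>arcs G. openin (top_of_set {0..1}) ({0..1} \<inter> edge_map G e -` U)))"

lemma openin_graph_space:
  "openin (graph_space G) U \<longleftrightarrow> U \<subseteq> graph_points G \<and>
     (\<forall>e\<in>arcs G. openin (top_of_set {0..1}) ({0..1} \<inter> edge_map G e -` U))"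
proof -
  have *: "{0..1} \<inter> edge_map G e -` (\<Union>\<U>) = (\<Union>U\<in>\<U>. {0..1} \<inter> edge_map G e -` U)" for e \<U>
    by auto
  have **: "{0..1} \<inter> edge_map G e -` (S \<inter> T) =
      ({0..1} \<inter> edge_map G e -` S) \<inter> ({0..1} \<inter> edge_map G e -` T)" for e S T
    by auto
  have "istopology (\<lambda>U. U \<subseteq> graph_points G \<and>
     (\<forall>e\<in>arcs G. openin (top_of_set {0..1}) ({0..1} \<inter> edge_map G e -` U)))"
    unfolding istopology_def * ** by (blast intro: openin_Int openin_Union)
  then show ?thesis
    unfolding graph_space_def by (simp add: topology_inverse')
qed

lemma topspace_graph_space:
  assumes "wf_digraph G"
  shows "topspace (graph_space G) = graph_points G"
proof -
  have "{0..1} \<inter> edge_map G e -` graph_points G = {0..1}" if "e \<in> arcs G" for e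
    using that wf_digraph.tail_in_verts[OF assms that] wf_digraph.head_in_verts[OF assms that]
    by (auto simp: edge_map_def graph_points_def)
  then have "openin (graph_space G) (graph_points G)"
    by (simp add: openin_graph_space)
  then show ?thesis
    by (metis openin_graph_space openin_subset openin_topspace subset_antisym)
qed

definition locally_finite_graph :: "('v, 'e) pre_digraph \<Rightarrow> bool" where
  "locally_finite_graph G \<longleftrightarrow> (\<forall>v\<in>verts G. finite (in_arcs G v) \<and> finite (out_arcs G v))"

definition infinite_graph :: "('v, 'e) pre_digraph \<Rightarrow> bool" where
  "infinite_graph G \<longleftrightarrow> infinite (verts G) \<or> infinite (arcs G)"

definition finite_subgraph :: "('v, 'e) pre_digraph \<Rightarrow> ('v, 'e) pre_digraph \<Rightarrow> bool" where
  "finite_subgraph H G \<longleftrightarrow> subgraph H G \<and> finite (verts H) \<and> finite (arcs H)"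


section \<open>Fundamental group, rank, ends\<close>

definition loops_at :: "'a topology \<Rightarrow> 'a \<Rightarrow> (real \<Rightarrow> 'a) set" where
  "loops_at X x0 = {p. pathin X p \<and> p 0 = x0 \<and> p 1 = x0}"

definition loop_htpy :: "'a topology \<Rightarrow> 'a \<Rightarrow> (real \<Rightarrow> 'a) \<Rightarrow> (real \<Rightarrow> 'a) \<Rightarrow> bool" where
  "loop_htpy X x0 = homotopic_with (\<lambda>h. h 0 = x0 \<and> h 1 = x0) (top_of_set {0..1}) X"

definition loop_concat :: "(real \<Rightarrow> 'a) \<Rightarrow> (real \<Rightarrow> 'a) \<Rightarrow> real \<Rightarrow> 'a" where
  "loop_concat p q = (\<lambda>t. if t \<le> 1/2 then p (2 * t) else q (2 * t - 1))"

definition fundamental_group :: "'a topology \<Rightarrow> 'a \<Rightarrow> (real \<Rightarrow> 'a) set monoid" where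
  "fundamental_group X x0 =
     \<lparr>carrier = loops_at X x0 // {(p, q). p \<in> loops_at X x0 \<and> q \<in> loops_at X x0 \<and> loop_htpy X x0 p q},
      monoid.mult = (\<lambda>A B. {r \<in> loops_at X x0. \<exists>p\<in>A. \<exists>q\<in>B. loop_htpy X x0 (loop_concat p q) r}),
      monoid.one = {r \<in> loops_at X x0. loop_htpy X x0 (\<lambda>_. x0) r}\<rparr>"

text \<open>Words in letters \<open>a\<close> (encoded as \<open>(a, True)\<close>) and \<open>a\<^sup>-\<^sup>1\<close> (encoded as \<open>(a, False)\<close>).\<close>

definition reduced_word :: "('a \<times> bool) list \<Rightarrow> bool" where
  "reduced_word = successively (\<lambda>(a, s) (b, t). \<not> (a = b \<and> s \<noteq> t))"

definition eval_word :: "('a, 'm) monoid_scheme \<Rightarrow> ('a \<times> bool) list \<Rightarrow> 'a" where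
  "eval_word G w =
     foldr (\<lambda>(a, s) x. (if s then a else inv\<^bsub>G\<^esub> a) \<otimes>\<^bsub>G\<^esub> x) w \<one>\<^bsub>G\<^esub>"

definition free_basis :: "('a, 'm) monoid_scheme \<Rightarrow> 'a set \<Rightarrow> bool" where
  "free_basis G S \<longleftrightarrow> S \<subseteq> carrier G \<and> generate G S = carrier G \<and>
     (\<forall>w. w \<noteq> [] \<and> set w \<subseteq> S \<times> UNIV \<and> reduced_word w \<longrightarrow> eval_word G w \<noteq> \<one>\<^bsub>G\<^esub>)"

definition finitely_generated_group :: "('a, 'm) monoid_scheme \<Rightarrow> bool" where
  "finitely_generated_group G \<longleftrightarrow> (\<exists>S. finite S \<and> S \<subseteq> carrier G \<and> generate G S = carrier G)"

text \<open>
  The fundamental group of a graph is free, and the cardinality of a free basis is its rank. For a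
  connected space the choice of the base point is irrelevant.
\<close>

definition rank_at_least :: "nat \<Rightarrow> 'a topology \<Rightarrow> bool" where
  "rank_at_least n X \<longleftrightarrow>
     (\<exists>x0\<in>topspace X. \<exists>S. free_basis (fundamental_group X x0) S \<and> (infinite S \<or> n \<le> card S))"

text \<open>
  The set underlying the inverse limit of \<open>\<pi>\<^sub>0 (X - K)\<close> over the compact sets \<open>K\<close>; the
  bonding maps send a path component to the one containing it.
\<close>

definition ends_of :: "'a topology \<Rightarrow> ('a set \<Rightarrow> 'a set) set" where
  "ends_of X =
     {\<epsilon> \<in> (\<Pi>\<^sub>E K\<in>{K. compactin X K}. path_components_of (subtopology X (topspace X - K))).
        \<forall>K L. compactin X K \<and> compactin X L \<and> K \<subseteq> L \<longrightarrow> \<epsilon> L \<subseteq> \<epsilon> K}"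

definition infinite_type :: "'a topology \<Rightarrow> bool" where
  "infinite_type X \<longleftrightarrow>
     (\<exists>x0\<in>topspace X. \<not> finitely_generated_group (fundamental_group X x0)) \<and> infinite (ends_of X)"


section \<open>The mapping class group of a locally finite graph\<close>

text \<open>
  The library predicate \<^const>\<open>proper_map\<close> does not include continuity. A map is an
  arbitrary function on the underlying type; its values outside \<open>topspace X\<close> are ignored.
\<close>

definition proper_cmap :: "'a topology \<Rightarrow> 'b topology \<Rightarrow> ('a \<Rightarrow> 'b) \<Rightarrow> bool" where
  "proper_cmap X Y f \<longleftrightarrow> continuous_map X Y f \<and> proper_map X Y f"

text \<open>
  Proper homotopy through maps satisfying \<open>P\<close>. As usual, it is the map on the product that is
  required to be proper, not just each time slice.
\<close>

definition proper_homotopic_with ::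
    "(('a \<Rightarrow> 'b) \<Rightarrow> bool) \<Rightarrow> 'a topology \<Rightarrow> 'b topology \<Rightarrow> ('a \<Rightarrow> 'b) \<Rightarrow> ('a \<Rightarrow> 'b) \<Rightarrow> bool" where
  "proper_homotopic_with P X Y f g \<longleftrightarrow>
     (\<exists>h. proper_cmap (prod_topology (top_of_set {0..1::real}) X) Y h \<and>
          (\<forall>x\<in>topspace X. h (0, x) = f x) \<and>
          (\<forall>x\<in>topspace X. h (1, x) = g x) \<and>
          (\<forall>t\<in>{0..1}. P (\<lambda>x. h (t, x))))"

abbreviation proper_homotopic ::
    "'a topology \<Rightarrow> 'b topology \<Rightarrow> ('a \<Rightarrow> 'b) \<Rightarrow> ('a \<Rightarrow> 'b) \<Rightarrow> bool" where
  "proper_homotopic \<equiv> proper_homotopic_with (\<lambda>_. True)"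

definition proper_htpy_equiv :: "'a topology \<Rightarrow> 'b topology \<Rightarrow> ('a \<Rightarrow> 'b) \<Rightarrow> bool" where
  "proper_htpy_equiv X Y f \<longleftrightarrow> proper_cmap X Y f \<and>
     (\<exists>g. proper_cmap Y X g \<and> proper_homotopic Y Y (f \<circ> g) id \<and> proper_homotopic X X (g \<circ> f) id)"

definition mapping_class_group :: "'a topology \<Rightarrow> ('a \<Rightarrow> 'a) set monoid" where
  "mapping_class_group X =
     \<lparr>carrier = {f. proper_htpy_equiv X X f} //
        {(f, g). proper_htpy_equiv X X f \<and> proper_htpy_equiv X X g \<and> proper_homotopic X X f g},
      monoid.mult = (\<lambda>A B. {h. \<exists>f\<in>A. \<exists>g\<in>B. proper_homotopic X X (f \<circ> g) h}),
      monoid.one = {h. proper_homotopic X X id h}\<rparr>"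

definition fixes_and_preserves :: "'a topology \<Rightarrow> 'a set \<Rightarrow> ('a \<Rightarrow> 'a) \<Rightarrow> bool" where
  "fixes_and_preserves X K f \<longleftrightarrow> (\<forall>x\<in>K. f x = x) \<and>
     (\<forall>C\<in>connected_components_of (subtopology X (topspace X - K)). f ` C \<subseteq> C)"

definition mcg_nbhd :: "'a topology \<Rightarrow> 'a set \<Rightarrow> ('a \<Rightarrow> 'a) set set" where
  "mcg_nbhd X K = {A \<in> carrier (mapping_class_group X).
     \<exists>f\<in>A. \<exists>g\<in>inv\<^bsub>mapping_class_group X\<^esub> A.
       fixes_and_preserves X K f \<and> fixes_and_preserves X K g \<and>
       proper_homotopic_with (fixes_and_preserves X K) X X (g \<circ> f) id \<and>
       proper_homotopic_with (fixes_and_preserves X K) X X (f \<circ> g) id}"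

text \<open>
  The group topology with the sets \<^const>\<open>mcg_nbhd\<close>, for \<open>K\<close> a finite subgraph, as a
  neighbourhood basis of the identity. Beware that the compact-open topology on pairs of inverse
  proper homotopy equivalences, taken on the graph itself rather than on its end compactification,
  would not induce this topology: its quotient need not be Hausdorff, because maps that agree with
  the identity on larger and larger compact sets can still interchange two ends.
\<close>

definition mcg_topology :: "('v, 'e) pre_digraph \<Rightarrow> (('v, 'e) gpoint \<Rightarrow> ('v, 'e) gpoint) set topology" where
  "mcg_topology G = topology (\<lambda>U. U \<subseteq> carrier (mapping_class_group (graph_space G)) \<and>
     (\<forall>A\<in>U. \<exists>H. finite_subgraph H G \<and>
        A <#\<^bsub>mapping_class_group (graph_space G)\<^esub> mcg_nbhd (graph_space G) (graph_points H) \<subseteq> U))"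

lemma fixes_and_preserves_mono:
  assumes "fixes_and_preserves X L f" "K \<subseteq> L"
  shows "fixes_and_preserves X K f"
proof -
  have "f x \<in> C" if C: "C \<in> connected_components_of (subtopology X (topspace X - K))" and x: "x \<in> C" for C x
  proof (cases "x \<in> L")
    case True
    then show ?thesis using assms x by (simp add: fixes_and_preserves_def)
  next
    case False
    have "C \<subseteq> topspace X - K"
      using connected_components_of_subset[OF C] by auto
    then have xt: "x \<in> topspace X - L"
      using x False by auto
    define D where "D = connected_component_of_set (subtopology X (topspace X - L)) x"
    have D: "D \<in> connected_components_of (subtopology X (topspace X - L))"
      unfolding D_def connected_components_of_def using xt by auto
    have xD: "x \<in> D"
      unfolding D_def using xt by (simp add: connected_component_of_refl)
    have "connectedin (subtopology X (topspace X - L)) D"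
      using D by (rule connectedin_connected_components_of)
    then have "connectedin (subtopology X (topspace X - K)) D"
      using assms(2) by (auto simp: connectedin_subtopology)
    then have "D \<subseteq> C"
      using connected_components_of_maximal[OF C] x xD unfolding disjnt_def by blast
    moreover have "f x \<in> D"
      using assms(1) D xD by (auto simp: fixes_and_preserves_def)
    ultimately show ?thesis by blast
  qed
  with assms show ?thesis
    by (auto simp: fixes_and_preserves_def)
qed

lemma proper_homotopic_with_mono:
  "proper_homotopic_with P X Y f g \<Longrightarrow> (\<And>h. P h \<Longrightarrow> Q h) \<Longrightarrow> proper_homotopic_with Q X Y f g"
  unfolding proper_homotopic_with_def by blast

lemma mcg_nbhd_antimono: "K \<subseteq> L \<Longrightarrow> mcg_nbhd X L \<subseteq> mcg_nbhd X K"
  unfolding mcg_nbhd_def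
  by (blast intro: fixes_and_preserves_mono proper_homotopic_with_mono)

lemma openin_mcg_topology:
  "openin (mcg_topology G) U \<longleftrightarrow> U \<subseteq> carrier (mapping_class_group (graph_space G)) \<and>
     (\<forall>A\<in>U. \<exists>H. finite_subgraph H G \<and>
        A <#\<^bsub>mapping_class_group (graph_space G)\<^esub> mcg_nbhd (graph_space G) (graph_points H) \<subseteq> U)"
proof -
  let ?N = "\<lambda>A H. A <#\<^bsub>mapping_class_group (graph_space G)\<^esub> mcg_nbhd (graph_space G) (graph_points H)"
  let ?P = "\<lambda>U. U \<subseteq> carrier (mapping_class_group (graph_space G)) \<and>
     (\<forall>A\<in>U. \<exists>H. finite_subgraph H G \<and> ?N A H \<subseteq> U)"
  have mono: "?N A H \<subseteq> ?N A H'" if "graph_points H' \<subseteq> graph_points H" for A H H'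
    using mcg_nbhd_antimono[OF that, of "graph_space G"] unfolding l_coset_def by blast
  have "?P (S \<inter> T)" if S: "?P S" and T: "?P T" for S T
  proof (intro conjI ballI)
    show "S \<inter> T \<subseteq> carrier (mapping_class_group (graph_space G))" using S by blast
    fix A assume A: "A \<in> S \<inter> T"
    obtain H1 where H1: "finite_subgraph H1 G" "?N A H1 \<subseteq> S" using S A by blast
    obtain H2 where H2: "finite_subgraph H2 G" "?N A H2 \<subseteq> T" using T A by blast
    have "finite_subgraph (union H1 H2) G"
      using H1(1) H2(1) unfolding finite_subgraph_def
      by (auto simp: subgraph_def compatible_def intro!: wellformed_union)
    moreover have "graph_points H1 \<subseteq> graph_points (union H1 H2)"
      "graph_points H2 \<subseteq> graph_points (union H1 H2)"
      by (auto simp: graph_points_def)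
    ultimately show "\<exists>H. finite_subgraph H G \<and> ?N A H \<subseteq> S \<inter> T"
      using mono H1(2) H2(2) by (meson Int_greatest order_trans)
  qed
  moreover have "?P (\<Union>\<U>)" if "\<forall>U\<in>\<U>. ?P U" for \<U>
  proof (intro conjI ballI)
    show "\<Union>\<U> \<subseteq> carrier (mapping_class_group (graph_space G))" using that by blast
    fix A assume "A \<in> \<Union>\<U>"
    then obtain U where "U \<in> \<U>" "A \<in> U" by blast
    with that obtain H where "finite_subgraph H G" "?N A H \<subseteq> U" by blast
    with \<open>U \<in> \<U>\<close> show "\<exists>H. finite_subgraph H G \<and> ?N A H \<subseteq> \<Union>\<U>" by blast
  qed
  ultimately have "istopology ?P"
    unfolding istopology_def by simp
  then show ?thesis
    unfolding mcg_topology_def by (simp add: topology_inverse')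
qed


section \<open>Amenability\<close>

definition borel_of :: "'a topology \<Rightarrow> 'a measure" where
  "borel_of X = sigma (topspace X) {U. openin X U}"

definition continuous_group_action ::
    "('g, 'm) monoid_scheme \<Rightarrow> 'g topology \<Rightarrow> 'x topology \<Rightarrow> ('g \<Rightarrow> 'x \<Rightarrow> 'x) \<Rightarrow> bool" where
  "continuous_group_action G T X \<phi> \<longleftrightarrow> group_action G (topspace X) \<phi> \<and>
     continuous_map (prod_topology T X) X (\<lambda>(g, x). \<phi> g x)"

definition regular_borel_probability :: "'a topology \<Rightarrow> 'a measure \<Rightarrow> bool" where
  "regular_borel_probability X M \<longleftrightarrow> prob_space M \<and> sets M = sets (borel_of X) \<and>
     (\<forall>A\<in>sets M. emeasure M A = (SUP K\<in>{K. compactin X K \<and> K \<subseteq> A}. emeasure M K) \<and>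
                 emeasure M A = (INF U\<in>{U. openin X U \<and> A \<subseteq> U}. emeasure M U))"

definition has_invariant_probability ::
    "('g, 'm) monoid_scheme \<Rightarrow> 'x topology \<Rightarrow> ('g \<Rightarrow> 'x \<Rightarrow> 'x) \<Rightarrow> bool" where
  "has_invariant_probability G X \<phi> \<longleftrightarrow>
     (\<exists>M. regular_borel_probability X M \<and> (\<forall>g\<in>carrier G. distr M M (\<phi> g) = M))"

text \<open>
  A definition cannot quantify over all types, so the compact spaces are taken on the type
  \<^typ>\<open>'g set set\<close>. This is no restriction: an orbit closure in a compact Hausdorff \<open>G\<close>-space
  has at most \<open>2\<close>-to-the-\<open>2\<close>-to-the-\<open>|G|\<close> points, hence is isomorphic to a compact \<open>G\<close>-space on
  this type. The lemma \<open>amenable_compact_action\<close> below states that amenability in this sense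
  implies the existence of invariant measures on compact Hausdorff spaces over an arbitrary type.
\<close>

definition amenable :: "('g, 'm) monoid_scheme \<Rightarrow> 'g topology \<Rightarrow> bool" where
  "amenable G T \<longleftrightarrow>
     (\<forall>(X :: 'g set set topology) \<phi>.
        compact_space X \<and> Hausdorff_space X \<and> topspace X \<noteq> {} \<and> continuous_group_action G T X \<phi> \<longrightarrow>
        has_invariant_probability G X \<phi>)"

lemma sets_borel_of: "sets (borel_of X) = sigma_sets (topspace X) {U. openin X U}"
  unfolding borel_of_def by (rule sets_measure_of) (auto dest: openin_subset)

lemma space_borel_of [simp]: "space (borel_of X) = topspace X"
  unfolding borel_of_def by (rule space_measure_of) (auto dest: openin_subset)

lemma openin_sets_borel_of: "openin X U \<Longrightarrow> U \<in> sets (borel_of X)"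
  by (simp add: sets_borel_of)

lemma continuous_map_measurable_borel_of:
  assumes "continuous_map X Y f"
  shows "f \<in> measurable (borel_of X) (borel_of Y)"
  unfolding borel_of_def[of Y]
proof (rule measurable_measure_of)
  show "{U. openin Y U} \<subseteq> Pow (topspace Y)" by (auto dest: openin_subset)
  show "f \<in> space (borel_of X) \<rightarrow> topspace Y"
    using assms by (auto simp: continuous_map_def)
  fix U assume "U \<in> {U. openin Y U}"
  then have "openin X {x \<in> topspace X. f x \<in> U}"
    using assms by (auto simp: continuous_map_def)
  moreover have "{x \<in> topspace X. f x \<in> U} = f -` U \<inter> space (borel_of X)" by auto
  ultimately show "f -` U \<inter> space (borel_of X) \<in> sets (borel_of X)"
    by (metis openin_sets_borel_of)
qed

lemma compactin_sets_borel_of: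
  assumes "Hausdorff_space X" "compactin X K"
  shows "K \<in> sets (borel_of X)"
proof -
  have "closedin X K" using assms compactin_imp_closedin by blast
  then have "openin X (topspace X - K)" "K = topspace X - (topspace X - K)"
    by (auto simp: closedin_def)
  then show ?thesis
    by (metis openin_sets_borel_of sets.compl_sets space_borel_of)
qed

lemma regular_borel_probability_distr:
  assumes M: "regular_borel_probability Z M" and j: "continuous_map Z X j"
    and Z: "compact_space Z" and X: "Hausdorff_space X"
  shows "regular_borel_probability X (distr M (borel_of X) j)"
proof -
  let ?N = "distr M (borel_of X) j"
  have pM: "prob_space M" and sM: "sets M = sets (borel_of Z)"
    using M by (simp_all only: regular_borel_probability_def)
  have reg': "\<forall>A\<in>sets M. emeasure M A = (SUP K\<in>{K. compactin Z K \<and> K \<subseteq> A}. emeasure M K) \<and>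
      emeasure M A = (INF U\<in>{U. openin Z U \<and> A \<subseteq> U}. emeasure M U)"
    using M[unfolded regular_borel_probability_def, THEN conjunct2, THEN conjunct2] .
  have reg: "emeasure M A = (SUP K\<in>{K. compactin Z K \<and> K \<subseteq> A}. emeasure M K)"
      "emeasure M A = (INF U\<in>{U. openin Z U \<and> A \<subseteq> U}. emeasure M U)" if "A \<in> sets M" for A
    by (fact reg'[THEN bspec, OF that, THEN conjunct1], fact reg'[THEN bspec, OF that, THEN conjunct2])
  have spM: "space M = topspace Z"
    using sets_eq_imp_space_eq[OF sM] by simp
  have jm: "j \<in> measurable M (borel_of X)"
    using continuous_map_measurable_borel_of[OF j] measurable_cong_sets[OF sM refl] by blast
  have Ne: "emeasure ?N A = emeasure M (j -` A \<inter> topspace Z)" if "A \<in> sets (borel_of X)" for A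
    using emeasure_distr[OF jm that] spM by simp
  have jZ: "j ` topspace Z \<subseteq> topspace X" using j by (auto simp: continuous_map_def)
  have inner: "emeasure ?N A = (SUP K\<in>{K. compactin X K \<and> K \<subseteq> A}. emeasure ?N K)"
    if A: "A \<in> sets (borel_of X)" for A
  proof (rule antisym)
    have A': "j -` A \<inter> topspace Z \<in> sets M"
      using measurable_sets[OF jm A] spM by simp
    have e: "emeasure ?N A = (SUP K\<in>{K. compactin Z K \<and> K \<subseteq> j -` A \<inter> topspace Z}. emeasure M K)"
      using Ne[OF A] reg(1)[OF A'] by (rule trans)
    have le: "emeasure M K \<le> (SUP K\<in>{K. compactin X K \<and> K \<subseteq> A}. emeasure ?N K)"
      if K: "compactin Z K" "K \<subseteq> j -` A \<inter> topspace Z" for K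
    proof -
      have cK: "compactin X (j ` K)" using image_compactin[OF K(1) j] .
      have "emeasure M K \<le> emeasure M (j -` (j ` K) \<inter> topspace Z)"
        using K measurable_sets[OF jm compactin_sets_borel_of[OF X cK]] spM
        by (intro emeasure_mono) auto
      also have "\<dots> = emeasure ?N (j ` K)"
        using Ne[OF compactin_sets_borel_of[OF X cK]] by simp
      also have "\<dots> \<le> (SUP K\<in>{K. compactin X K \<and> K \<subseteq> A}. emeasure ?N K)"
        using K cK by (intro SUP_upper) auto
      finally show ?thesis .
    qed
    show "emeasure ?N A \<le> (SUP K\<in>{K. compactin X K \<and> K \<subseteq> A}. emeasure ?N K)"
      unfolding e by (rule SUP_least, rule le) simp_all
    show "(SUP K\<in>{K. compactin X K \<and> K \<subseteq> A}. emeasure ?N K) \<le> emeasure ?N A"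
      using A by (intro SUP_least emeasure_mono) auto
  qed
  have outer: "emeasure ?N A = (INF U\<in>{U. openin X U \<and> A \<subseteq> U}. emeasure ?N U)"
    if A: "A \<in> sets (borel_of X)" for A
  proof (rule antisym)
    have AX: "A \<subseteq> topspace X" using sets.sets_into_space[OF A] by simp
    have A': "j -` A \<inter> topspace Z \<in> sets M"
      using measurable_sets[OF jm A] spM by simp
    have e: "emeasure ?N A = (INF V\<in>{V. openin Z V \<and> j -` A \<inter> topspace Z \<subseteq> V}. emeasure M V)"
      using Ne[OF A] reg(2)[OF A'] by (rule trans)
    have le: "(INF U\<in>{U. openin X U \<and> A \<subseteq> U}. emeasure ?N U) \<le> emeasure M V"
      if V: "openin Z V" "j -` A \<inter> topspace Z \<subseteq> V" for V
    proof -
      have "compactin Z (topspace Z - V)"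
        by (rule closedin_compact_space[OF Z]) (simp add: closedin_diff V(1))
      then have cj: "closedin X (j ` (topspace Z - V))"
        by (intro compactin_imp_closedin[OF X] image_compactin[OF _ j])
      define U where "U = topspace X - j ` (topspace Z - V)"
      have oU: "openin X U" unfolding U_def by (simp add: openin_diff cj)
      have AU: "A \<subseteq> U" using AX V(2) by (auto simp: U_def)
      have "emeasure ?N U = emeasure M (j -` U \<inter> topspace Z)"
        using Ne[OF openin_sets_borel_of[OF oU]] .
      also have "\<dots> \<le> emeasure M V"
        using V(1) by (intro emeasure_mono) (auto simp: U_def sM intro: openin_sets_borel_of)
      finally show ?thesis using oU AU by (intro INF_lower2[of U]) simp_all
    qed
    show "(INF U\<in>{U. openin X U \<and> A \<subseteq> U}. emeasure ?N U) \<le> emeasure ?N A"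
      unfolding e by (rule INF_greatest, rule le) simp_all
    show "emeasure ?N A \<le> (INF U\<in>{U. openin X U \<and> A \<subseteq> U}. emeasure ?N U)"
      using A by (intro INF_greatest emeasure_mono) (auto intro: openin_sets_borel_of)
  qed
  have "prob_space ?N" using pM jm by (rule prob_space.prob_space_distr)
  then show ?thesis
    unfolding regular_borel_probability_def sets_distr using inner outer by blast
qed

lemma amenable_compact_action:
  fixes G :: "('g, 'm) monoid_scheme" and X :: "'x topology"
  assumes am: "amenable G T" and T: "topspace T = carrier G"
    and X: "compact_space X" "Hausdorff_space X" "topspace X \<noteq> {}"
    and act: "continuous_group_action G T X \<phi>"
  shows "has_invariant_probability G X \<phi>"
proof -
  interpret ga: group_action G "topspace X" \<phi>
    using act by (simp add: continuous_group_action_def)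
  interpret G: group G
    using ga.group_hom by (simp add: group_hom_def)
  have cont2: "continuous_map (prod_topology T X) X (\<lambda>(g, x). \<phi> g x)"
    using act by (simp add: continuous_group_action_def)
  have cont: "continuous_map X X (\<phi> g)" if "g \<in> carrier G" for g
  proof -
    have "continuous_map X (prod_topology T X) (\<lambda>x. (g, x))"
      using that T by (simp add: continuous_map_pairedI)
    from continuous_map_compose[OF this cont2] show ?thesis by (simp add: o_def)
  qed
  have clos: "\<phi> g x \<in> topspace X" if "g \<in> carrier G" "x \<in> topspace X" for g x
    using ga.element_image that by blast
  have mult: "\<phi> (g \<otimes>\<^bsub>G\<^esub> h) x = \<phi> g (\<phi> h x)"
    if "g \<in> carrier G" "h \<in> carrier G" "x \<in> topspace X" for g h x
    using ga.composition_rule that by blast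
  have one: "\<phi> \<one>\<^bsub>G\<^esub> x = x" if "x \<in> topspace X" for x
    using ga.id_eq_one that by (metis restrict_apply')
  obtain x0 where x0: "x0 \<in> topspace X" using X(3) by blast
  define orb where "orb = (\<lambda>g. \<phi> g x0)"
  define Y where "Y = X closure_of (orb ` carrier G)"
  have orbX: "orb ` A \<subseteq> topspace X" if "A \<subseteq> carrier G" for A
    using clos x0 that by (auto simp: orb_def)
  have YX: "Y \<subseteq> topspace X" by (simp add: Y_def closure_of_subset_topspace)
  have Yc: "closedin X Y" by (simp add: Y_def)
  have Y0: "x0 \<in> Y"
  proof -
    have "x0 \<in> orb ` carrier G"
      using one[OF x0] G.one_closed by (metis image_eqI orb_def)
    then show ?thesis
      unfolding Y_def using orbX[OF order_refl] closure_of_subset by blast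
  qed
  have inv: "\<phi> g y \<in> Y" if g: "g \<in> carrier G" and y: "y \<in> Y" for g y
  proof -
    have "\<phi> g ` orb ` carrier G \<subseteq> orb ` carrier G"
    proof
      fix x assume "x \<in> \<phi> g ` orb ` carrier G"
      then obtain h where h: "h \<in> carrier G" "x = \<phi> g (\<phi> h x0)" by (auto simp: orb_def)
      then have "x = orb (g \<otimes>\<^bsub>G\<^esub> h)" using mult[OF g h(1) x0] by (simp add: orb_def)
      then show "x \<in> orb ` carrier G" using g h(1) by blast
    qed
    then have "X closure_of (\<phi> g ` orb ` carrier G) \<subseteq> Y"
      unfolding Y_def by (rule closure_of_mono)
    moreover have "\<phi> g ` Y \<subseteq> X closure_of (\<phi> g ` orb ` carrier G)"
      unfolding Y_def by (rule continuous_map_image_closure_subset[OF cont[OF g]])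
    ultimately show ?thesis using y by blast
  qed
  define E :: "'x \<Rightarrow> 'g set set" where
    "E = (\<lambda>y. {A. A \<subseteq> carrier G \<and> y \<in> X closure_of (orb ` A)})"
  have "inj_on E Y"
  proof (rule inj_onI, rule ccontr)
    fix y z assume y: "y \<in> Y" and z: "z \<in> Y" and eq: "E y = E z" and ne: "y \<noteq> z"
    obtain U V where U: "openin X U" "y \<in> U" and V: "openin X V" "z \<in> V" and d: "disjnt U V"
      using X(2)[unfolded Hausdorff_space_def, rule_format, of y z] subsetD[OF YX y] subsetD[OF YX z] ne
      by metis
    define A where "A = {g \<in> carrier G. orb g \<in> U}"
    have "y \<in> X closure_of (orb ` A)"
      unfolding in_closure_of
    proof (intro conjI allI impI)
      show "y \<in> topspace X" using y YX by blast
      fix W assume W: "y \<in> W \<and> openin X W"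
      then have "openin X (W \<inter> U)" "y \<in> W \<inter> U" using U by auto
      then obtain p where "p \<in> orb ` carrier G" "p \<in> W \<inter> U"
        using y[unfolded Y_def in_closure_of, THEN conjunct2, rule_format, of "W \<inter> U"] by metis
      then show "\<exists>p. p \<in> orb ` A \<and> p \<in> W" by (auto simp: A_def)
    qed
    then have "A \<in> E z" using eq by (auto simp: E_def A_def)
    then have "z \<in> X closure_of (orb ` A)" by (simp add: E_def)
    then obtain p where "p \<in> orb ` A" "p \<in> V"
      using V unfolding in_closure_of by metis
    then show False using d by (auto simp: A_def disjnt_def)
  qed
  define Z where "Z = E ` Y"
  define j where "j = inv_into Y E"
  have jE: "j (E y) = y" if "y \<in> Y" for y
    using that \<open>inj_on E Y\<close> by (simp add: j_def)
  have Ej: "E (j z) = z" and jY: "j z \<in> Y" if "z \<in> Z" for z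
    using that by (auto simp: j_def Z_def f_inv_into_f inv_into_into)
  have EZ: "E y \<in> Z" if "y \<in> Y" for y using that by (simp add: Z_def)
  define X' where "X' = pullback_topology Z j X"
  have tX': "topspace X' = Z"
    using jY YX by (auto simp: X'_def topspace_pullback_topology)
  have jc: "continuous_map X' X j"
    using continuous_map_pullback[OF continuous_map_id, of Z j X] by (simp add: X'_def)
  have Ec: "continuous_map (subtopology X Y) X' E"
    unfolding X'_def
  proof (rule continuous_map_pullback')
    have "continuous_map (subtopology X Y) X id" by (simp add: continuous_map_from_subtopology)
    then show "continuous_map (subtopology X Y) X (j \<circ> E)"
      by (rule continuous_map_eq) (auto simp: jE)
    show "topspace (subtopology X Y) \<subseteq> E -` Z" by (auto simp: Z_def)
  qed
  have X': "compact_space X'"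
  proof -
    have "compactin X Y" using X(1) Yc closedin_compact_space by blast
    then have "compactin (subtopology X Y) Y" by (simp add: compactin_subtopology)
    then have "compactin X' (E ` Y)" using Ec by (rule image_compactin)
    then show ?thesis by (simp add: compact_space_def tX' Z_def)
  qed
  have H': "Hausdorff_space X'"
  proof (rule Hausdorff_space_injective_preimage[OF X(2) jc])
    show "inj_on j (topspace X')" unfolding tX' by (rule inj_on_inverseI[of _ E]) (rule Ej)
  qed
  define \<psi> where "\<psi> = (\<lambda>g. \<lambda>z\<in>Z. E (\<phi> g (j z)))"
  have j\<psi>: "j (\<psi> g z) = \<phi> g (j z)" if "g \<in> carrier G" "z \<in> Z" for g z
    using that by (simp add: \<psi>_def jE inv jY)
  have \<psi>Z: "\<psi> g z \<in> Z" if "g \<in> carrier G" "z \<in> Z" for g z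
    using that by (simp add: \<psi>_def EZ inv jY)
  have \<psi>mult: "\<psi> (g \<otimes>\<^bsub>G\<^esub> h) z = \<psi> g (\<psi> h z)"
    if "g \<in> carrier G" "h \<in> carrier G" "z \<in> Z" for g h z
  proof -
    have "j (\<psi> (g \<otimes>\<^bsub>G\<^esub> h) z) = j (\<psi> g (\<psi> h z))"
      using that mult[of g h "j z"] jY YX by (auto simp: j\<psi> \<psi>Z)
    then show ?thesis using that Ej \<psi>Z by (metis G.m_closed)
  qed
  have \<psi>one: "\<psi> \<one>\<^bsub>G\<^esub> z = z" if "z \<in> Z" for z
    using that one[OF subsetD[OF YX jY[OF that]]] Ej[OF that] by (simp add: \<psi>_def)
  have Bij: "\<psi> g \<in> Bij Z" if g: "g \<in> carrier G" for g
  proof -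
    have "bij_betw (\<psi> g) Z Z"
    proof (rule bij_betwI[where g = "\<psi> (inv\<^bsub>G\<^esub> g)"])
      show "\<psi> g \<in> Z \<rightarrow> Z" "\<psi> (inv\<^bsub>G\<^esub> g) \<in> Z \<rightarrow> Z" using \<psi>Z g by auto
      show "\<psi> (inv\<^bsub>G\<^esub> g) (\<psi> g z) = z" if "z \<in> Z" for z
        using \<psi>mult[of "inv\<^bsub>G\<^esub> g" g z] that g \<psi>one by simp
      show "\<psi> g (\<psi> (inv\<^bsub>G\<^esub> g) z) = z" if "z \<in> Z" for z
        using \<psi>mult[of g "inv\<^bsub>G\<^esub> g" z] that g \<psi>one by simp
    qed
    then show ?thesis by (simp add: Bij_def \<psi>_def)
  qed
  have "\<psi> \<in> hom G (BijGroup Z)"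
  proof (rule homI)
    show "\<psi> g \<in> carrier (BijGroup Z)" if "g \<in> carrier G" for g
      using Bij[OF that] by (simp add: BijGroup_def)
    show "\<psi> (g \<otimes>\<^bsub>G\<^esub> h) = \<psi> g \<otimes>\<^bsub>BijGroup Z\<^esub> \<psi> h" if gh: "g \<in> carrier G" "h \<in> carrier G" for g h
    proof
      fix z
      show "\<psi> (g \<otimes>\<^bsub>G\<^esub> h) z = (\<psi> g \<otimes>\<^bsub>BijGroup Z\<^esub> \<psi> h) z"
      proof (cases "z \<in> Z")
        case True
        then show ?thesis
          using gh by (simp add: BijGroup_def compose_def Bij \<psi>mult)
      next
        case False
        then have "\<psi> k z = undefined" for k by (simp add: \<psi>_def)
        with False show ?thesis
          using gh by (simp add: BijGroup_def compose_def Bij)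
      qed
    qed
  qed
  then have "group_action G (topspace X') \<psi>"
    unfolding group_action_def tX'
    by (simp add: group_hom_def group_hom_axioms_def group_BijGroup G.is_group)
  moreover have "continuous_map (prod_topology T X') X' (\<lambda>(g, z). \<psi> g z)"
  proof -
    have "continuous_map (prod_topology T X') (prod_topology T X) (\<lambda>p. (fst p, j (snd p)))"
      by (intro continuous_map_pairedI continuous_map_fst continuous_map_compose[OF continuous_map_snd jc, unfolded o_def])
    from continuous_map_compose[OF this cont2]
    have "continuous_map (prod_topology T X') X (\<lambda>p. \<phi> (fst p) (j (snd p)))"
      by (simp add: o_def case_prod_unfold)
    then have "continuous_map (prod_topology T X') X (j \<circ> (\<lambda>(g, z). \<psi> g z))"
      by (rule continuous_map_eq) (auto simp: T tX' j\<psi>)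
    then show ?thesis
      unfolding X'_def
      by (rule continuous_map_pullback') (use \<psi>Z T tX' in \<open>auto simp: X'_def\<close>)
  qed
  ultimately have act': "continuous_group_action G T X' \<psi>"
    by (simp add: continuous_group_action_def)
  have "topspace X' \<noteq> {}" using Y0 EZ tX' by blast
  with am X' H' act' have "has_invariant_probability G X' \<psi>"
    unfolding amenable_def by blast
  then obtain M where M: "regular_borel_probability X' M"
    and Minv: "\<And>g. g \<in> carrier G \<Longrightarrow> distr M M (\<psi> g) = M"
    unfolding has_invariant_probability_def by blast
  have sM: "sets M = sets (borel_of X')" using M by (simp add: regular_borel_probability_def)
  have spM: "space M = Z" using sets_eq_imp_space_eq[OF sM] by (simp add: tX')
  have jm: "j \<in> measurable M (borel_of X)"
    using continuous_map_measurable_borel_of[OF jc] measurable_cong_sets[OF sM refl] by blast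
  let ?N = "distr M (borel_of X) j"
  have "distr ?N ?N (\<phi> g) = ?N" if g: "g \<in> carrier G" for g
  proof -
    have \<phi>m: "\<phi> g \<in> measurable (borel_of X) (borel_of X)"
      by (rule continuous_map_measurable_borel_of[OF cont[OF g]])
    have "continuous_map X' (prod_topology T X') (\<lambda>x. (g, x))"
      using g T by (simp add: continuous_map_pairedI)
    from continuous_map_compose[OF this] act' have "continuous_map X' X' (\<psi> g)"
      by (fastforce simp: o_def continuous_group_action_def)
    then have \<psi>m: "\<psi> g \<in> measurable M M"
      using continuous_map_measurable_borel_of measurable_cong_sets[OF sM sM] by blast
    have "distr ?N ?N (\<phi> g) = distr ?N (borel_of X) (\<phi> g)"
      by (rule distr_cong) auto
    also have "\<dots> = distr M (borel_of X) (\<phi> g \<circ> j)"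
      by (rule distr_distr[OF \<phi>m jm])
    also have "\<dots> = distr M (borel_of X) (j \<circ> \<psi> g)"
      by (rule distr_cong) (auto simp: spM j\<psi> g)
    also have "\<dots> = distr (distr M M (\<psi> g)) (borel_of X) j"
      by (rule distr_distr[OF jm \<psi>m, symmetric])
    finally show ?thesis by (simp add: Minv[OF g])
  qed
  moreover have "regular_borel_probability X ?N"
    by (rule regular_borel_probability_distr[OF M jc X' X(2)])
  ultimately show ?thesis
    unfolding has_invariant_probability_def by blast
qed

end

theory Submission
  imports Defs "HOL-Library.Function_Algebras" "HOL-Complex_Analysis.Winding_Numbers"
begin

text \<open>
  The mapping class group acts on the first homology group \<open>A\<close> of the graph, a free abelian group,
  and hence on the compact space of total orders of \<open>A\<close>: an order is a point of \<open>{+,-}\<^sup>A\<close>, and the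
  axioms of an order are closed conditions. The action is continuous, because a homology class is
  carried by a finite subgraph \<open>K\<close> and is therefore fixed by every mapping class that is represented
  by a map fixing \<open>K\<close>. An invariant probability measure on the space of orders is ruled out by a
  single pair of opposite shears. If \<open>f\<close> maps \<open>a\<close> to \<open>a + b\<close> and fixes \<open>b\<close>, while \<open>h\<close> maps \<open>b\<close>
  to \<open>b + a\<close> and fixes \<open>a\<close>, then invariance forces \<open>a\<close> and \<open>b\<close> to have the same sign almost
  surely; transporting this statement by the inverses of \<open>f\<close> and \<open>h\<close>, also \<open>a - b\<close> has the sign
  of \<open>b\<close> and \<open>b - a\<close> has the sign of \<open>a\<close>, which is absurd. This is \<open>shear_pair_not_amenable\<close>.

  Homology is represented without chains: the class of a loop \<open>p\<close> is the functional that sends a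
  map \<open>\<phi>\<close> from the graph to the punctured plane to the winding number of \<open>\<phi> \<circ> p\<close>
  (\<open>winding_class\<close>). It is visibly functorial and invariant under homotopies, and orders of these
  functionals exist since functions into the reals can be ordered lexicographically.

  The shears are realised by edge slides. If \<open>c\<close> is a loop at the head of an edge \<open>e\<close> that avoids
  the interior of \<open>e\<close>, the slide replaces \<open>e\<close> by \<open>e\<close> followed by \<open>c\<close>. The slide along the
  reversed loop is its proper homotopy inverse, and all maps and homotopies are supported on \<open>e\<close>
  (\<open>slide_reverse_slide\<close>). Two distinct edges \<open>e\<close>, \<open>e'\<close> whose ends lie in a path connected set \<open>D\<close>
  disjoint from their interiors give two loops, each running through one of the edges and returning
  within \<open>D\<close>, and two slides that shear the classes of these loops (\<open>linked_edges_shear\<close>). If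
  \<open>D\<close> and the two edges avoid a finite subgraph \<open>K\<close>, the slides lie in the basic neighbourhood of
  the identity that belongs to \<open>K\<close>, hence in every subgroup containing that neighbourhood
  (\<open>not_amenable_if_linked_edges\<close>).

  It remains to find linked edges. Choose a breadth first spanning tree. The fundamental group is
  generated by one loop for each edge outside the tree
  (\<open>fundamental_group_generated_by_cotree\<close>). If the rank is at least two, the group is not cyclic,
  so there are two such edges; they are linked by the tree. If the fundamental group is not finitely
  generated, there are infinitely many such edges, and only finitely many of them touch a given
  finite ball around the root. The vertices outside the ball are divided into finitely many
  branches of the tree, so by the pigeonhole principle infinitely many edges outside the tree join the
  same two branches. One of them connects these two branches, and two others are linked by the
  resulting set (\<open>linked_edges_outside_finite_subgraph\<close>). Since an open subgroup contains the
  neighbourhood belonging to some finite subgraph, this proves both claims.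
\<close>
section \<open>Orders on abelian groups and shears\<close>

text \<open>
  The total orders of an abelian group that contains \<open>A\<close>, as seen by \<open>A\<close>: the value at \<open>x\<close> tells
  whether \<open>x\<close> is positive. The set \<open>A\<close> need not be closed under addition, so additivity of the
  positive cone is only required for those sums that lie in \<open>A\<close>; the value at \<open>0\<close> is arbitrary.
\<close>

definition sign_orders :: "'a::ab_group_add set \<Rightarrow> ('a \<Rightarrow> bool) topology" where
  "sign_orders A = subtopology (product_topology (\<lambda>_. discrete_topology UNIV) A)
     {\<sigma>. (\<forall>a\<in>A. \<forall>b\<in>A. a + b \<in> A \<and> \<sigma> a \<and> \<sigma> b \<longrightarrow> \<sigma> (a + b)) \<and>
         (\<forall>a\<in>A. a \<noteq> 0 \<and> - a \<in> A \<longrightarrow> \<sigma> (- a) = (\<not> \<sigma> a))}"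

lemma topspace_sign_orders:
  "topspace (sign_orders A) = {\<sigma> \<in> extensional A.
     (\<forall>a\<in>A. \<forall>b\<in>A. a + b \<in> A \<and> \<sigma> a \<and> \<sigma> b \<longrightarrow> \<sigma> (a + b)) \<and>
     (\<forall>a\<in>A. a \<noteq> 0 \<and> - a \<in> A \<longrightarrow> \<sigma> (- a) = (\<not> \<sigma> a))}"
  by (auto simp: sign_orders_def PiE_UNIV_domain PiE_def)

lemma continuous_map_sign_orders_eval:
  assumes "a \<in> A"
  shows "continuous_map (sign_orders A) (discrete_topology UNIV) (\<lambda>\<sigma>. \<sigma> a)"
  unfolding sign_orders_def
  by (rule continuous_map_from_subtopology) (rule continuous_map_product_projection[OF assms])

lemma Hausdorff_sign_orders: "Hausdorff_space (sign_orders A)"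
  unfolding sign_orders_def
  by (intro Hausdorff_space_subtopology) (simp add: Hausdorff_space_product_topology)

text \<open>
  Every axiom involves at most three coordinates and so defines a closed subset of the Cantor cube.
\<close>

lemma compact_sign_orders: "compact_space (sign_orders A)"
proof -
  define PP where "PP = product_topology (\<lambda>_::'a. discrete_topology (UNIV::bool set)) A"
  have coord: "closedin PP {\<sigma> \<in> topspace PP. Q (\<sigma> a)}" if "a \<in> A" for a and Q :: "bool \<Rightarrow> bool"
  proof -
    have "closedin PP {\<sigma> \<in> topspace PP. \<sigma> a \<in> {x. Q x}}"
      unfolding PP_def
      by (rule closedin_continuous_map_preimage[OF continuous_map_product_projection[OF that]]) simp
    then show ?thesis by simp
  qed
  have disj: "closedin PP {\<sigma> \<in> topspace PP. Q \<sigma> \<or> R \<sigma>}"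
    if "closedin PP {\<sigma> \<in> topspace PP. Q \<sigma>}" "closedin PP {\<sigma> \<in> topspace PP. R \<sigma>}" for Q R
    using closedin_Un[OF that] by (simp add: Collect_disj_eq[symmetric] conj_disj_distribL)
  have conj: "closedin PP {\<sigma> \<in> topspace PP. Q \<sigma> \<and> R \<sigma>}"
    if "closedin PP {\<sigma> \<in> topspace PP. Q \<sigma>}" "closedin PP {\<sigma> \<in> topspace PP. R \<sigma>}" for Q R
    using closedin_Int[OF that] by (rule back_subst[where P="closedin PP"]) auto
  have all: "closedin PP {\<sigma> \<in> topspace PP. \<forall>i\<in>I. Q i \<sigma>}"
    if "\<And>i. i \<in> I \<Longrightarrow> closedin PP {\<sigma> \<in> topspace PP. Q i \<sigma>}" for I :: "'i set" and Q
  proof (cases "I = {}")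
    case False
    have "closedin PP (\<Inter>i\<in>I. {\<sigma> \<in> topspace PP. Q i \<sigma>})"
      using False that by (intro closedin_Inter) auto
    then show ?thesis
      by (rule back_subst[where P="closedin PP"]) (use False in auto)
  qed simp
  have triv: "closedin PP {\<sigma> \<in> topspace PP. b}" for b
    by (cases b) auto
  define R where "R = {\<sigma> \<in> topspace PP.
     (\<forall>a\<in>A. \<forall>b\<in>A. a + b \<in> A \<and> \<sigma> a \<and> \<sigma> b \<longrightarrow> \<sigma> (a + b)) \<and>
     (\<forall>a\<in>A. a \<noteq> 0 \<and> - a \<in> A \<longrightarrow> \<sigma> (- a) = (\<not> \<sigma> a))}"
  have "closedin PP R"
    unfolding R_def
  proof (intro conj all)
    fix a b assume a: "a \<in> A" and b: "b \<in> A"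
    show "closedin PP {\<sigma> \<in> topspace PP. a + b \<in> A \<and> \<sigma> a \<and> \<sigma> b \<longrightarrow> \<sigma> (a + b)}"
    proof (cases "a + b \<in> A")
      case True
      have "closedin PP {\<sigma> \<in> topspace PP. \<not> \<sigma> a \<or> \<not> \<sigma> b \<or> \<sigma> (a + b)}"
        by (intro disj coord[of a Not] coord[of b Not] coord[of "a+b" "\<lambda>x. x"] a b True)
      then show ?thesis by (rule back_subst[where P="closedin PP"]) (use True in auto)
    qed simp
    fix a assume a: "a \<in> A"
    show "closedin PP {\<sigma> \<in> topspace PP. a \<noteq> 0 \<and> - a \<in> A \<longrightarrow> \<sigma> (- a) = (\<not> \<sigma> a)}"
    proof (cases "a \<noteq> 0 \<and> - a \<in> A")
      case True
      have "closedin PP {\<sigma> \<in> topspace PP. (\<sigma> (-a) \<and> \<not> \<sigma> a) \<or> (\<not> \<sigma> (-a) \<and> \<sigma> a)}"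
        using True
        by (intro disj conj coord[of a Not] coord[of a "\<lambda>x. x"] coord[of "-a" Not] coord[of "-a" "\<lambda>x. x"] a) auto
      then show ?thesis by (rule back_subst[where P="closedin PP"]) (use True in auto)
    qed (simp only: simp_thms, simp)
  qed
  moreover have "compact_space PP"
    by (simp add: PP_def compact_space_product_topology compact_space_discrete_topology)
  ultimately have "compact_space (subtopology PP R)"
    by (simp add: closedin_compact_space compact_space_subtopology)
  moreover have "sign_orders A = subtopology PP R"
  proof -
    have "R = topspace PP \<inter> {\<sigma>. (\<forall>a\<in>A. \<forall>b\<in>A. a + b \<in> A \<and> \<sigma> a \<and> \<sigma> b \<longrightarrow> \<sigma> (a + b)) \<and>
         (\<forall>a\<in>A. a \<noteq> 0 \<and> - a \<in> A \<longrightarrow> \<sigma> (- a) = (\<not> \<sigma> a))}"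
      by (auto simp: R_def)
    then show ?thesis
      unfolding sign_orders_def PP_def[symmetric] by (simp only: subtopology_restrict)
  qed
  ultimately show ?thesis by simp
qed

text \<open>
  A group is not amenable if it acts additively, with open stabilisers, on a set of elements of
  an orderable abelian group and if it contains two opposite shears. The set \<open>C\<close> is the positive
  cone of some order; it only serves to show that the space of orders is not empty.
\<close>

lemma shear_pair_not_amenable:
  fixes G :: "('g, 'm) monoid_scheme" and A C :: "'a::ab_group_add set" and \<alpha> :: "'g \<Rightarrow> 'a \<Rightarrow> 'a"
  assumes G: "group G" and T: "topspace T = carrier G"
    and A_neg: "\<And>x. x \<in> A \<Longrightarrow> - x \<in> A"
    and act_closed: "\<And>g x. g \<in> carrier G \<Longrightarrow> x \<in> A \<Longrightarrow> \<alpha> g x \<in> A"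
    and act_mult: "\<And>g h x. g \<in> carrier G \<Longrightarrow> h \<in> carrier G \<Longrightarrow> x \<in> A \<Longrightarrow>
          \<alpha> (g \<otimes>\<^bsub>G\<^esub> h) x = \<alpha> g (\<alpha> h x)"
    and act_one: "\<And>x. x \<in> A \<Longrightarrow> \<alpha> \<one>\<^bsub>G\<^esub> x = x"
    and act_add: "\<And>g x y. g \<in> carrier G \<Longrightarrow> x \<in> A \<Longrightarrow> y \<in> A \<Longrightarrow> x + y \<in> A \<Longrightarrow>
          \<alpha> g (x + y) = \<alpha> g x + \<alpha> g y"
    and act_neg: "\<And>g x. g \<in> carrier G \<Longrightarrow> x \<in> A \<Longrightarrow> \<alpha> g (- x) = - \<alpha> g x"
    and stab: "\<And>x y. x \<in> A \<Longrightarrow> y \<in> A \<Longrightarrow> openin T {g \<in> carrier G. \<alpha> g x = y}"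
    and C_add: "\<And>x y. x \<in> C \<Longrightarrow> y \<in> C \<Longrightarrow> x + y \<in> C"
    and C_neg: "\<And>x. x \<noteq> 0 \<Longrightarrow> - x \<in> C \<longleftrightarrow> x \<notin> C"
    and ab: "a \<in> A" "b \<in> A" "a \<noteq> 0" "b \<noteq> 0"
    and f: "f \<in> carrier G" "\<alpha> f a = a + b" "\<alpha> f b = b"
    and h: "h \<in> carrier G" "\<alpha> h b = b + a" "\<alpha> h a = a"
  shows "\<not> amenable G T"
proof
  assume am: "amenable G T"
  interpret G: group G by (rule G)
  let ?X = "sign_orders A"
  have X: "\<sigma> \<in> topspace ?X \<longleftrightarrow> \<sigma> \<in> extensional A \<and>
     (\<forall>x\<in>A. \<forall>y\<in>A. x + y \<in> A \<and> \<sigma> x \<and> \<sigma> y \<longrightarrow> \<sigma> (x + y)) \<and>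
     (\<forall>x\<in>A. x \<noteq> 0 \<longrightarrow> \<sigma> (- x) = (\<not> \<sigma> x))" for \<sigma>
    using A_neg by (auto simp: topspace_sign_orders)
  have act_inv: "\<alpha> (inv\<^bsub>G\<^esub> g) (\<alpha> g x) = x" "\<alpha> g (\<alpha> (inv\<^bsub>G\<^esub> g) x) = x"
    if "g \<in> carrier G" "x \<in> A" for g x
    using that act_mult[of "inv\<^bsub>G\<^esub> g" g x] act_mult[of g "inv\<^bsub>G\<^esub> g" x] by (simp_all add: act_one)
  have act_nz: "\<alpha> g x \<noteq> 0" if g: "g \<in> carrier G" and x: "x \<in> A" "x \<noteq> 0" for g x
  proof
    assume 0: "\<alpha> g x = 0"
    then have "0 \<in> A" using act_closed[OF g x(1)] by simp
    then have "\<alpha> (inv\<^bsub>G\<^esub> g) 0 = 0"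
      using act_add[of "inv\<^bsub>G\<^esub> g" 0 0] g by simp
    then show False using act_inv(1)[OF g x(1)] 0 x(2) by simp
  qed
  define tr where "tr = (\<lambda>g. \<lambda>\<sigma>\<in>topspace ?X. \<lambda>x\<in>A. \<sigma> (\<alpha> (inv\<^bsub>G\<^esub> g) x) :: bool)"
  have tr_ap: "tr g \<sigma> x = \<sigma> (\<alpha> (inv\<^bsub>G\<^esub> g) x)" if "\<sigma> \<in> topspace ?X" "x \<in> A" for g \<sigma> x
    using that by (simp add: tr_def)
  have trX: "tr g \<sigma> \<in> topspace ?X" if g: "g \<in> carrier G" and \<sigma>: "\<sigma> \<in> topspace ?X" for g \<sigma>
  proof -
    have "tr g \<sigma> \<in> extensional A" using \<sigma> by (simp add: tr_def)
    moreover have "tr g \<sigma> (x + y)" if "x \<in> A" "y \<in> A" "x + y \<in> A" "tr g \<sigma> x" "tr g \<sigma> y" for x y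
      using that g \<sigma> act_closed[of "inv\<^bsub>G\<^esub> g"] act_add[of "inv\<^bsub>G\<^esub> g" x y]
      by (simp add: tr_ap) (metis G.inv_closed X)
    moreover have "tr g \<sigma> (- x) = (\<not> tr g \<sigma> x)" if "x \<in> A" "x \<noteq> 0" for x
      using that g \<sigma> act_closed[of "inv\<^bsub>G\<^esub> g"] act_neg[of "inv\<^bsub>G\<^esub> g" x] act_nz[of "inv\<^bsub>G\<^esub> g" x]
      by (simp add: tr_ap A_neg X)
    ultimately show ?thesis by (simp add: X)
  qed
  have tr_mult: "tr (g \<otimes>\<^bsub>G\<^esub> k) \<sigma> = tr g (tr k \<sigma>)"
    if "g \<in> carrier G" "k \<in> carrier G" "\<sigma> \<in> topspace ?X" for g k \<sigma>
  proof (rule extensionalityI[of _ A])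
    show "tr (g \<otimes>\<^bsub>G\<^esub> k) \<sigma> \<in> extensional A" "tr g (tr k \<sigma>) \<in> extensional A"
      using that trX X by (blast intro: G.m_closed)+
    fix x assume "x \<in> A"
    then show "tr (g \<otimes>\<^bsub>G\<^esub> k) \<sigma> x = tr g (tr k \<sigma>) x"
      using that by (simp add: tr_ap trX act_closed act_mult G.inv_mult_group)
  qed
  have tr_one: "tr \<one>\<^bsub>G\<^esub> \<sigma> = \<sigma>" if "\<sigma> \<in> topspace ?X" for \<sigma>
  proof (rule extensionalityI[of _ A])
    show "tr \<one>\<^bsub>G\<^esub> \<sigma> \<in> extensional A" "\<sigma> \<in> extensional A"
      using that trX X by blast+
    fix x assume "x \<in> A"
    then show "tr \<one>\<^bsub>G\<^esub> \<sigma> x = \<sigma> x" using that by (simp add: tr_ap act_one)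
  qed
  have Bij: "tr g \<in> Bij (topspace ?X)" if g: "g \<in> carrier G" for g
  proof -
    have "bij_betw (tr g) (topspace ?X) (topspace ?X)"
    proof (rule bij_betwI[where g = "tr (inv\<^bsub>G\<^esub> g)"])
      show "tr g \<in> topspace ?X \<rightarrow> topspace ?X" "tr (inv\<^bsub>G\<^esub> g) \<in> topspace ?X \<rightarrow> topspace ?X"
        using trX g by auto
      show "tr (inv\<^bsub>G\<^esub> g) (tr g \<sigma>) = \<sigma>" if "\<sigma> \<in> topspace ?X" for \<sigma>
        using tr_mult[of "inv\<^bsub>G\<^esub> g" g \<sigma>] that g tr_one by simp
      show "tr g (tr (inv\<^bsub>G\<^esub> g) \<sigma>) = \<sigma>" if "\<sigma> \<in> topspace ?X" for \<sigma>
        using tr_mult[of g "inv\<^bsub>G\<^esub> g" \<sigma>] that g tr_one by simp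
    qed
    then show ?thesis by (simp add: Bij_def tr_def)
  qed
  have "tr \<in> hom G (BijGroup (topspace ?X))"
  proof (rule homI)
    show "tr g \<in> carrier (BijGroup (topspace ?X))" if "g \<in> carrier G" for g
      using Bij[OF that] by (simp add: BijGroup_def)
    show "tr (g \<otimes>\<^bsub>G\<^esub> k) = tr g \<otimes>\<^bsub>BijGroup (topspace ?X)\<^esub> tr k"
      if gk: "g \<in> carrier G" "k \<in> carrier G" for g k
    proof
      fix \<sigma>
      show "tr (g \<otimes>\<^bsub>G\<^esub> k) \<sigma> = (tr g \<otimes>\<^bsub>BijGroup (topspace ?X)\<^esub> tr k) \<sigma>"
        using gk by (cases "\<sigma> \<in> topspace ?X")
          (simp_all add: BijGroup_def compose_def Bij tr_mult, simp add: tr_def)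
    qed
  qed
  then have "group_action G (topspace ?X) tr"
    unfolding group_action_def by (simp add: group_hom_def group_hom_axioms_def group_BijGroup G)
  moreover have tr_cont: "continuous_map (prod_topology T ?X) ?X (\<lambda>(g, \<sigma>). tr g \<sigma>)"
  proof -
    have coord: "continuous_map (prod_topology T ?X) (discrete_topology UNIV) (\<lambda>p. tr (fst p) (snd p) x)"
      if x: "x \<in> A" for x
      unfolding continuous_map_def
    proof (intro conjI allI impI)
      fix W :: "bool set"
      have eq: "{p \<in> topspace (prod_topology T ?X). tr (fst p) (snd p) x \<in> W} =
          (\<Union>y\<in>A. {g \<in> carrier G. \<alpha> g y = x} \<times> {\<sigma> \<in> topspace ?X. \<sigma> y \<in> W})" (is "?L = ?R")
      proof (rule Set.set_eqI)
        fix p :: "'g \<times> ('a \<Rightarrow> bool)"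
        obtain g \<sigma> where p: "p = (g, \<sigma>)" by (cases p)
        have "(g, \<sigma>) \<in> ?L \<longleftrightarrow> g \<in> carrier G \<and> \<sigma> \<in> topspace ?X \<and> \<sigma> (\<alpha> (inv\<^bsub>G\<^esub> g) x) \<in> W"
          using x by (auto simp: T tr_ap)
        also have "\<dots> \<longleftrightarrow> g \<in> carrier G \<and> \<sigma> \<in> topspace ?X \<and> (\<exists>y\<in>A. \<alpha> g y = x \<and> \<sigma> y \<in> W)"
          using x act_inv act_closed G.inv_closed by metis
        also have "\<dots> \<longleftrightarrow> (g, \<sigma>) \<in> ?R" by auto
        finally show "p \<in> ?L \<longleftrightarrow> p \<in> ?R" unfolding p .
      qed
      have "openin (prod_topology T ?X) ?R"
      proof (intro openin_Union ballI; clarify)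
        fix y assume y: "y \<in> A"
        have "openin ?X {\<sigma> \<in> topspace ?X. \<sigma> y \<in> W}"
          by (rule openin_continuous_map_preimage[OF continuous_map_sign_orders_eval[OF y]]) simp
        then show "openin (prod_topology T ?X) ({g \<in> carrier G. \<alpha> g y = x} \<times> {\<sigma> \<in> topspace ?X. \<sigma> y \<in> W})"
          using stab[OF y x] by (simp add: openin_prod_Times_iff)
      qed
      then show "openin (prod_topology T ?X) {p \<in> topspace (prod_topology T ?X). tr (fst p) (snd p) x \<in> W}"
        unfolding eq .
    qed simp
    have "continuous_map (prod_topology T ?X) (product_topology (\<lambda>_. discrete_topology UNIV) A) (\<lambda>p. tr (fst p) (snd p))"
      unfolding continuous_map_componentwise
      using coord trX X by (auto simp: T image_subset_iff)
    then have "continuous_map (prod_topology T ?X) ?X (\<lambda>p. tr (fst p) (snd p))"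
      unfolding sign_orders_def[of A] continuous_map_in_subtopology
      using trX unfolding sign_orders_def[of A, symmetric]
      by (auto simp: T topspace_sign_orders)
    then show ?thesis by (simp add: case_prod_unfold)
  qed
  ultimately have "continuous_group_action G T ?X tr"
    by (simp add: continuous_group_action_def)
  moreover have "topspace ?X \<noteq> {}"
  proof -
    have "(\<lambda>x\<in>A. x \<in> C) \<in> topspace ?X"
      using C_add C_neg A_neg by (auto simp: X)
    then show ?thesis by blast
  qed
  ultimately have "has_invariant_probability G ?X tr"
    using amenable_compact_action[OF am T compact_sign_orders Hausdorff_sign_orders] by blast
  then obtain M where M: "regular_borel_probability ?X M"
    and inv: "\<And>g. g \<in> carrier G \<Longrightarrow> distr M M (tr g) = M"
    unfolding has_invariant_probability_def by blast
  interpret M: prob_space M using M by (simp add: regular_borel_probability_def)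
  have sM: "sets M = sets (borel_of ?X)" using M by (simp add: regular_borel_probability_def)
  have spM: "space M = topspace ?X" using sets_eq_imp_space_eq[OF sM] by simp
  have pos_meas: "{\<sigma> \<in> space M. \<sigma> x} \<in> sets M" if x: "x \<in> A" for x
  proof -
    have "openin ?X {\<sigma> \<in> topspace ?X. \<sigma> x \<in> {True}}"
      by (rule openin_continuous_map_preimage[OF continuous_map_sign_orders_eval[OF x]]) simp
    then show ?thesis using openin_sets_borel_of sM spM by simp
  qed
  have pos_pred: "Measurable.pred M (\<lambda>\<sigma>. \<sigma> x)" if "x \<in> A" for x
    using pos_meas[OF that] by (simp add: pred_def)
  have tr_meas: "tr g \<in> measurable M M" if g: "g \<in> carrier G" for g
  proof -
    have "continuous_map ?X (prod_topology T ?X) (\<lambda>x. (g, x))"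
      using g T by (simp add: continuous_map_pairedI)
    from continuous_map_compose[OF this tr_cont] have "continuous_map ?X ?X (tr g)"
      by (simp add: o_def)
    then show ?thesis
      using continuous_map_measurable_borel_of measurable_cong_sets[OF sM sM] by blast
  qed
  have AE_act: "AE \<sigma> in M. P (\<sigma> (\<alpha> g x)) (\<sigma> (\<alpha> g y))"
    if ae: "AE \<sigma> in M. P (\<sigma> x) (\<sigma> y)" and g: "g \<in> carrier G" and xy: "x \<in> A" "y \<in> A" for P g x y
  proof -
    have ig: "inv\<^bsub>G\<^esub> g \<in> carrier G" using g by simp
    have "AE \<sigma> in distr M M (tr (inv\<^bsub>G\<^esub> g)). P (\<sigma> x) (\<sigma> y)"
      unfolding inv[OF ig] by (rule ae)
    then have "AE \<sigma> in M. P (tr (inv\<^bsub>G\<^esub> g) \<sigma> x) (tr (inv\<^bsub>G\<^esub> g) \<sigma> y)"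
      by (rule AE_distrD[OF tr_meas[OF ig]])
    moreover have "AE \<sigma> in M. \<sigma> \<in> topspace ?X"
      using AE_space[of M] by (simp add: spM)
    ultimately show ?thesis
      by eventually_elim (use g xy in \<open>simp add: tr_ap\<close>)
  qed
  \<comment> \<open>if \<open>x\<close> and \<open>y\<close> are positive, so are \<open>x + y\<close> and \<open>y\<close>; the shear maps the first event to the
    second, so both have the same measure and their difference is null\<close>
  have null: "AE \<sigma> in M. \<not> (\<sigma> (x + y) \<and> \<sigma> y \<and> \<not> \<sigma> x)"
    if g: "g \<in> carrier G" and xy: "x \<in> A" "y \<in> A" "x + y \<in> A" and gx: "\<alpha> g x = x + y" and gy: "\<alpha> g y = y"
    for g x y
  proof -
    define Q where "Q = (\<lambda>x y. {\<sigma> \<in> space M. \<sigma> x \<and> \<sigma> y})"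
    have Qm: "Q x y \<in> sets M" if "x \<in> A" "y \<in> A" for x y
    proof -
      have "Q x y = {\<sigma> \<in> space M. \<sigma> x} \<inter> {\<sigma> \<in> space M. \<sigma> y}" by (auto simp: Q_def)
      then show ?thesis using pos_meas that by simp
    qed
    have "emeasure M (Q (x + y) y) = emeasure (distr M M (tr g)) (Q (x + y) y)"
      by (simp add: inv[OF g])
    also have "\<dots> = emeasure M (tr g -` Q (x + y) y \<inter> space M)"
      by (rule emeasure_distr[OF tr_meas[OF g] Qm[OF xy(3) xy(2)]])
    also have "tr g -` Q (x + y) y \<inter> space M = Q x y"
      using act_inv(1)[OF g xy(1)] act_inv(1)[OF g xy(2)] xy trX[OF g]
      by (auto simp: Q_def spM tr_ap gx gy)
    finally have eq: "emeasure M (Q (x + y) y) = emeasure M (Q x y)" .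
    have sub: "Q x y \<subseteq> Q (x + y) y"
      using xy by (auto simp: Q_def spM X)
    have "emeasure M (Q (x + y) y - Q x y) = emeasure M (Q (x + y) y) - emeasure M (Q x y)"
      using Qm xy sub by (intro emeasure_Diff) auto
    then have "emeasure M (Q (x + y) y - Q x y) = 0" by (simp add: eq)
    then have "Q (x + y) y - Q x y \<in> null_sets M"
      using Qm xy by (auto intro: null_setsI)
    then have "AE \<sigma> in M. \<sigma> \<notin> Q (x + y) y - Q x y" by (rule AE_not_in)
    then show ?thesis
      using AE_space[of M] by eventually_elim (auto simp: Q_def)
  qed
  have sum: "a + b \<in> A" and sum_nz: "a + b \<noteq> 0"
    using act_closed[OF f(1) ab(1)] act_nz[OF f(1) ab(1,3)] f(2) by auto
  have msum: "- a + - b = - (a + b)" "- b + - a = - (a + b)" by simp_all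
  have neg: "AE \<sigma> in M. \<sigma> (- x) = (\<not> \<sigma> x)" if "x \<in> A" "x \<noteq> 0" for x
    using AE_space[of M] by eventually_elim (use that in \<open>simp add: spM X\<close>)
  \<comment> \<open>the previous step for \<open>(a, b)\<close>, \<open>(-a, -b)\<close>, \<open>(b, a)\<close> and \<open>(-b, -a)\<close>: whatever the sign
    of \<open>a + b\<close>, it cannot occur together with opposite signs of \<open>a\<close> and \<open>b\<close>\<close>
  have same: "AE \<sigma> in M. \<sigma> a = \<sigma> b"
  proof -
    have 1: "AE \<sigma> in M. \<not> (\<sigma> (a + b) \<and> \<sigma> b \<and> \<not> \<sigma> a)"
      by (rule null[OF f(1)]) (use ab sum f in auto)
    have 2: "AE \<sigma> in M. \<not> (\<sigma> (- a + - b) \<and> \<sigma> (- b) \<and> \<not> \<sigma> (- a))"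
      by (rule null[OF f(1)]) (use ab sum f A_neg[OF sum] in \<open>auto simp: A_neg act_neg\<close>)
    have 3: "AE \<sigma> in M. \<not> (\<sigma> (b + a) \<and> \<sigma> a \<and> \<not> \<sigma> b)"
      by (rule null[OF h(1)]) (use ab sum h in \<open>auto simp: add.commute\<close>)
    have 4: "AE \<sigma> in M. \<not> (\<sigma> (- b + - a) \<and> \<sigma> (- a) \<and> \<not> \<sigma> (- b))"
      by (rule null[OF h(1)]) (use ab sum h A_neg[OF sum] in \<open>auto simp: A_neg act_neg add.commute\<close>)
    show ?thesis
      using 1 2 3 4 neg[OF ab(1,3)] neg[OF ab(2,4)] neg[OF sum sum_nz]
      unfolding msum add.commute[of b a] by eventually_elim blast
  qed
  have inv_f: "\<alpha> (inv\<^bsub>G\<^esub> f) b = b" "\<alpha> (inv\<^bsub>G\<^esub> f) a = a - b"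
    and inv_h: "\<alpha> (inv\<^bsub>G\<^esub> h) a = a" "\<alpha> (inv\<^bsub>G\<^esub> h) b = b - a"
  proof -
    show 1: "\<alpha> (inv\<^bsub>G\<^esub> f) b = b" using act_inv(1)[OF f(1) ab(2)] f(3) by simp
    show 2: "\<alpha> (inv\<^bsub>G\<^esub> h) a = a" using act_inv(1)[OF h(1) ab(1)] h(3) by simp
    have "\<alpha> (inv\<^bsub>G\<^esub> f) ((a + b) + - b) = a + - b"
      using act_add[of "inv\<^bsub>G\<^esub> f" "a + b" "- b"] act_inv(1)[OF f(1) ab(1)] 1 f(1,2) ab(1,2) sum
      by (simp add: A_neg act_neg)
    then show "\<alpha> (inv\<^bsub>G\<^esub> f) a = a - b" by simp
    have "\<alpha> (inv\<^bsub>G\<^esub> h) ((a + b) + - a) = b + - a"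
      using act_add[of "inv\<^bsub>G\<^esub> h" "a + b" "- a"] act_inv(1)[OF h(1) ab(2)] 2 h(1,2) ab(1,2) sum
      by (simp add: A_neg act_neg add.commute)
    then show "\<alpha> (inv\<^bsub>G\<^esub> h) b = b - a" by simp
  qed
  have "AE \<sigma> in M. \<sigma> (a - b) = \<sigma> b"
    using AE_act[of "(=)" a b "inv\<^bsub>G\<^esub> f", OF same] f(1) ab by (simp add: inv_f)
  moreover have "AE \<sigma> in M. \<sigma> a = \<sigma> (b - a)"
    using AE_act[of "(=)" a b "inv\<^bsub>G\<^esub> h", OF same] h(1) ab by (simp add: inv_h)
  moreover have "AE \<sigma> in M. \<sigma> (- (a - b)) = (\<not> \<sigma> (a - b))"
    using act_closed[of "inv\<^bsub>G\<^esub> f" a] act_nz[of "inv\<^bsub>G\<^esub> f" a] f(1) ab by (intro neg) (auto simp: inv_f)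
  ultimately have "AE \<sigma> in M. False"
    using same by eventually_elim simp
  then show False by simp
qed

section \<open>The topology of a graph\<close>

abbreviation I01 :: "real topology" where "I01 \<equiv> top_of_set {0..1}"

lemma edge_map_simps [simp]:
  "edge_map G e 0 = Inl (tail G e)" "edge_map G e 1 = Inl (head G e)"
  "0 < t \<Longrightarrow> t < 1 \<Longrightarrow> edge_map G e t = Inr (e, t)"
  by (auto simp: edge_map_def)

lemma graph_point_cases:
  assumes "x \<in> graph_points G"
  obtains (vertex) v where "v \<in> verts G" "x = Inl v"
  | (edge) e t where "e \<in> arcs G" "0 < t" "t < 1" "x = Inr (e, t)"
  using assms by (auto simp: graph_points_def)

context
  fixes G :: "('v, 'e) pre_digraph"
  assumes wf: "wf_digraph G"
begin

lemmas topspace_graph [simp] = topspace_graph_space[OF wf]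

lemma edge_map_in_graph_points: "e \<in> arcs G \<Longrightarrow> edge_map G e t \<in> graph_points G"
  using wf_digraph.tail_in_verts[OF wf] wf_digraph.head_in_verts[OF wf]
  by (auto simp: edge_map_def graph_points_def)

lemma continuous_map_edge_map:
  assumes "e \<in> arcs G"
  shows "continuous_map I01 (graph_space G) (edge_map G e)"
  unfolding continuous_map_def
proof (intro conjI allI impI)
  show "edge_map G e \<in> topspace I01 \<rightarrow> topspace (graph_space G)"
    using edge_map_in_graph_points[OF assms] by simp
  fix U assume "openin (graph_space G) U"
  then have "openin I01 ({0..1} \<inter> edge_map G e -` U)"
    using assms by (simp add: openin_graph_space)
  then show "openin I01 {x \<in> topspace I01. edge_map G e x \<in> U}"
    by (rule back_subst[where P="openin I01"]) auto
qed

lemma pathin_edge_map: "e \<in> arcs G \<Longrightarrow> pathin (graph_space G) (edge_map G e)"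
  unfolding pathin_def by (rule continuous_map_edge_map)

lemma closedin_graph_space:
  "closedin (graph_space G) C \<longleftrightarrow> C \<subseteq> graph_points G \<and>
     (\<forall>e\<in>arcs G. closedin I01 ({0..1} \<inter> edge_map G e -` C))"
proof -
  have "{0..1} \<inter> edge_map G e -` (graph_points G - C) = {0..1} - ({0..1} \<inter> edge_map G e -` C)"
    if "e \<in> arcs G" for e
    using edge_map_in_graph_points[OF that] by auto
  then show ?thesis
    by (auto simp: closedin_def[of "graph_space G"] openin_graph_space closedin_def[of I01])
qed

lemma continuous_map_graph_space:
  assumes "\<And>x. x \<in> graph_points G \<Longrightarrow> f x \<in> topspace Y"
    and "\<And>e. e \<in> arcs G \<Longrightarrow> continuous_map I01 Y (\<lambda>t. f (edge_map G e t))"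
  shows "continuous_map (graph_space G) Y f"
  unfolding continuous_map_def
proof (intro conjI allI impI)
  show "f \<in> topspace (graph_space G) \<rightarrow> topspace Y" using assms(1) by simp
  fix V assume V: "openin Y V"
  show "openin (graph_space G) {x \<in> topspace (graph_space G). f x \<in> V}"
    unfolding openin_graph_space
  proof (intro conjI ballI)
    show "{x \<in> topspace (graph_space G). f x \<in> V} \<subseteq> graph_points G" by simp
    fix e assume e: "e \<in> arcs G"
    have "openin I01 {t \<in> topspace I01. f (edge_map G e t) \<in> V}"
      by (rule openin_continuous_map_preimage[OF assms(2)[OF e] V])
    then show "openin I01 ({0..1} \<inter> edge_map G e -` {x \<in> topspace (graph_space G). f x \<in> V})"
      by (rule back_subst[where P="openin I01"]) (use edge_map_in_graph_points[OF e] in auto)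
  qed
qed

text \<open>
  The product of the quotient map defining the graph with the unit interval is again a quotient
  map, because the interval is locally compact. This is Whitehead's argument: around a point of the
  preimage of an open set, a compact neighbourhood in the interval is chosen once, and the tube
  lemma is applied on each edge separately.
\<close>

lemma continuous_map_prod_graph_space:
  assumes vert: "\<And>v. v \<in> verts G \<Longrightarrow> continuous_map I01 Y (\<lambda>s. H (s, Inl v))"
    and edge: "\<And>e. e \<in> arcs G \<Longrightarrow>
      continuous_map (prod_topology I01 I01) Y (\<lambda>p. H (fst p, edge_map G e (snd p)))"
  shows "continuous_map (prod_topology I01 (graph_space G)) Y H"
proof -
  let ?X = "graph_space G"
  have slice: "continuous_map I01 Y (\<lambda>s. H (s, x))" if x: "x \<in> graph_points G" for x
    using x
  proof (cases rule: graph_point_cases)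
    case (vertex v)
    then show ?thesis using vert by simp
  next
    case (edge e t)
    have "continuous_map I01 (prod_topology I01 I01) (\<lambda>s. (s, t))"
      using edge by (intro continuous_map_pairedI) auto
    from continuous_map_compose[OF this assms(2)[OF edge(1)]] edge show ?thesis by (simp add: o_def)
  qed
  have into: "H (s, x) \<in> topspace Y" if "s \<in> {0..1}" "x \<in> graph_points G" for s x
    using slice[OF that(2)] that(1) by (auto simp: continuous_map_def)
  have "openin (prod_topology I01 ?X) {p \<in> topspace (prod_topology I01 ?X). H p \<in> V}" if V: "openin Y V" for V
    unfolding openin_prod_topology_alt
  proof (intro allI impI)
    let ?O = "{p \<in> topspace (prod_topology I01 ?X). H p \<in> V}"
    fix s x assume "(s, x) \<in> ?O"
    then have s: "s \<in> {0..1}" and x: "x \<in> graph_points G" and V_sx: "H (s, x) \<in> V" by auto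
    have "openin I01 {r \<in> topspace I01. H (r, x) \<in> V}"
      by (rule openin_continuous_map_preimage[OF slice[OF x] V])
    then obtain W where W: "open W" "{r \<in> {0..1}. H (r, x) \<in> V} = {0..1} \<inter> W"
      by (auto simp: openin_open)
    then have "s \<in> W" using s V_sx by blast
    then obtain \<delta> where \<delta>: "\<delta> > 0" "cball s \<delta> \<subseteq> W"
      using \<open>open W\<close> open_contains_cball by blast
    define N where "N = cball s \<delta> \<inter> {0..1}"
    have N: "compact N" "N \<subseteq> {0..1}" "ball s \<delta> \<inter> {0..1} \<subseteq> N"
      by (auto simp: N_def intro!: compact_Int)
    have Nc: "compactin I01 N" using N by (simp add: compactin_subtopology)
    define U where "U = {y \<in> graph_points G. \<forall>r\<in>N. H (r, y) \<in> V}"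
    have "openin ?X U"
      unfolding openin_graph_space
    proof (intro conjI ballI)
      show "U \<subseteq> graph_points G" by (auto simp: U_def)
      fix e assume e: "e \<in> arcs G"
      let ?P = "{p \<in> topspace (prod_topology I01 I01). H (fst p, edge_map G e (snd p)) \<in> V}"
      have P: "openin (prod_topology I01 I01) ?P"
        by (rule openin_continuous_map_preimage[OF edge[OF e] V])
      show "openin I01 ({0..1} \<inter> edge_map G e -` U)"
      proof (subst openin_subopen, intro ballI)
        fix t assume t: "t \<in> {0..1} \<inter> edge_map G e -` U"
        then have "N \<times> {t} \<subseteq> ?P" using N by (auto simp: U_def)
        then obtain A B where AB: "openin I01 A" "openin I01 B" "N \<subseteq> A" "t \<in> B" "A \<times> B \<subseteq> ?P"
          using tube_lemma_left[OF P Nc, of t] t by auto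
        have "B \<subseteq> {0..1} \<inter> edge_map G e -` U"
        proof
          fix r assume r: "r \<in> B"
          then have "r \<in> {0..1}" using openin_subset[OF AB(2)] by auto
          moreover have "H (q, edge_map G e r) \<in> V" if "q \<in> N" for q
            using AB r that by fastforce
          ultimately show "r \<in> {0..1} \<inter> edge_map G e -` U"
            using edge_map_in_graph_points[OF e] by (auto simp: U_def)
        qed
        then show "\<exists>T. openin I01 T \<and> t \<in> T \<and> T \<subseteq> {0..1} \<inter> edge_map G e -` U"
          using AB by blast
      qed
    qed
    moreover have "openin I01 (ball s \<delta> \<inter> {0..1})"
      using openin_open_Int[OF open_ball[of s \<delta>], of "{0..1}"] by (simp add: Int_commute)
    moreover have "x \<in> U"
      using x W(2) \<delta>(2) by (auto simp: U_def N_def)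
    moreover have "s \<in> ball s \<delta> \<inter> {0..1}" using s \<delta>(1) by simp
    moreover have "(ball s \<delta> \<inter> {0..1}) \<times> U \<subseteq> ?O"
      using N by (auto simp: U_def)
    ultimately show "\<exists>A B. openin I01 A \<and> openin ?X B \<and> s \<in> A \<and> x \<in> B \<and> A \<times> B \<subseteq> ?O"
      by blast
  qed
  then show ?thesis
    using into unfolding continuous_map_def by fastforce
qed

text \<open>
  Any two points are separated by a continuous complex function: vertices by their tent functions,
  and a point inside an edge \<open>e\<close> from all other points by a function that vanishes outside \<open>e\<close> and
  is injective on its interior.
\<close>

lemma Hausdorff_graph_space: "Hausdorff_space (graph_space G)"
proof -
  have sep: "\<exists>U V. openin (graph_space G) U \<and> openin (graph_space G) V \<and> x \<in> U \<and> y \<in> V \<and> disjnt U V"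
    if f: "continuous_map (graph_space G) euclidean f" and ne: "f x \<noteq> f y"
      and x: "x \<in> graph_points G" and y: "y \<in> graph_points G"
    for f :: "_ \<Rightarrow> complex" and x y
  proof -
    obtain U V where UV: "open U" "open V" "f x \<in> U" "f y \<in> V" "U \<inter> V = {}"
      using hausdorff[OF ne] by blast
    then have "openin (graph_space G) {x \<in> topspace (graph_space G). f x \<in> U}"
      "openin (graph_space G) {x \<in> topspace (graph_space G). f x \<in> V}"
      using openin_continuous_map_preimage[OF f] by auto
    then show ?thesis using UV x y
      by (intro exI[of _ "{x \<in> topspace (graph_space G). f x \<in> U}"] exI[of _ "{x \<in> topspace (graph_space G). f x \<in> V}"])
        (auto simp: disjnt_def)
  qed
  \<comment> \<open>the real part is a tent and determines the parameter up to \<open>t \<mapsto> 1 - t\<close>; the imaginary part is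
    odd under this reflection and vanishes on the open interval only at the midpoint\<close>
  define height :: "'e \<Rightarrow> ('v, 'e) gpoint \<Rightarrow> complex" where "height = (\<lambda>e x. case x of Inl v \<Rightarrow> 0
      | Inr (e', t) \<Rightarrow> if e' = e then Complex (min t (1 - t)) (t * (1 - t) * (1 - 2 * t)) else 0)"
  have hem: "height e (edge_map G e' t) = (if e' = e then Complex (min t (1 - t)) (t * (1 - t) * (1 - 2 * t)) else 0)"
    if "t \<in> {0..1}" for e e' t
    using that by (auto simp: height_def edge_map_def complex_eq_iff)
  have height_cont: "continuous_map (graph_space G) euclidean (height e)" for e
  proof (rule continuous_map_graph_space)
    fix e' assume "e' \<in> arcs G"
    have "continuous_on {0..1} (\<lambda>t. Complex (min t (1 - t)) (t * (1 - t) * (1 - 2 * t)))"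
      by (intro continuous_on_Complex continuous_intros)
    then have "continuous_on {0..1} (\<lambda>t. if e' = e then Complex (min t (1 - t)) (t * (1 - t) * (1 - 2 * t)) else 0)"
      by (cases "e' = e") simp_all
    then have "continuous_on {0..1} (\<lambda>t. height e (edge_map G e' t))"
      by (rule continuous_on_eq) (simp add: hem)
    then show "continuous_map I01 euclidean (\<lambda>t. height e (edge_map G e' t))" by simp
  qed simp
  define bump :: "'v \<Rightarrow> ('v, 'e) gpoint \<Rightarrow> complex" where "bump = (\<lambda>v x. case x of Inl w \<Rightarrow> of_bool (w = v)
      | Inr (e, t) \<Rightarrow> of_real (1 - t) * of_bool (tail G e = v) + of_real t * of_bool (head G e = v))"
  have bem: "bump v (edge_map G e t) = of_real (1 - t) * of_bool (tail G e = v) + of_real t * of_bool (head G e = v)"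
    if "t \<in> {0..1}" for v e t
    using that by (auto simp: bump_def edge_map_def)
  have bump_cont: "continuous_map (graph_space G) euclidean (bump v)" for v
  proof (rule continuous_map_graph_space)
    fix e assume "e \<in> arcs G"
    have "continuous_on {0..1} (\<lambda>t. of_real (1 - t) * of_bool (tail G e = v) + of_real t * of_bool (head G e = v) :: complex)"
      by (intro continuous_intros)
    then have "continuous_on {0..1} (\<lambda>t. bump v (edge_map G e t))"
      by (rule continuous_on_eq) (simp add: bem)
    then show "continuous_map I01 euclidean (\<lambda>t. bump v (edge_map G e t))" by simp
  qed simp
  have height_inj: "height e x \<noteq> height e y"
    if e: "e \<in> arcs G" "0 < t" "t < 1" "x = Inr (e, t)" and "x \<noteq> y" "y \<in> graph_points G" for e t x y
    using that(6)
  proof (cases rule: graph_point_cases)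
    case (vertex v)
    then show ?thesis using that by (auto simp: height_def complex_eq_iff)
  next
    case (edge e' s)
    show ?thesis
    proof (cases "e' = e")
      case False
      then show ?thesis using that edge by (auto simp: height_def complex_eq_iff)
    next
      case True
      then have st: "s \<noteq> t" using that edge by auto
      show ?thesis
      proof
        assume "height e x = height e y"
        then have m: "min t (1 - t) = min s (1 - s)"
          and c: "t * (1 - t) * (1 - 2 * t) = s * (1 - s) * (1 - 2 * s)"
          using that edge True by (simp_all add: height_def complex_eq_iff)
        from m st have s: "s = 1 - t" by (auto simp: min_def split: if_splits)
        have "2 * (t * (1 - t) * (1 - 2 * t)) = 0" using c unfolding s by (simp add: algebra_simps)
        then have "t = 1/2" using e by auto
        then show False using s st by simp
      qed
    qed
  qed
  have "\<exists>f :: _ \<Rightarrow> complex. continuous_map (graph_space G) euclidean f \<and> f x \<noteq> f y"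
    if x: "x \<in> graph_points G" and y: "y \<in> graph_points G" and ne: "x \<noteq> y" for x y
    using x
  proof (cases rule: graph_point_cases)
    case (edge e t)
    then show ?thesis using height_inj[OF edge ne y] height_cont by blast
  next
    case v: (vertex v)
    show ?thesis using y
    proof (cases rule: graph_point_cases)
      case (edge e t)
      then show ?thesis using height_inj[OF edge ne[symmetric] x] height_cont by metis
    next
      case w: (vertex w)
      then have "bump v x \<noteq> bump v y" using v ne by (simp add: bump_def)
      then show ?thesis using bump_cont by blast
    qed
  qed
  then show ?thesis
    unfolding Hausdorff_space_def using sep by (metis topspace_graph)
qed

lemma finite_if_all_subsets_closed:
  assumes C: "compactin X C" and S: "S \<subseteq> C" and clo: "\<And>T. T \<subseteq> S \<Longrightarrow> closedin X T"
  shows "finite S"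
proof -
  have "compactin X S" using closed_compactin[OF C S] clo by blast
  then have "compact_space (subtopology X S)" by (rule compactin_subspace[THEN iffD1, THEN conjunct2])
  moreover have "subtopology X S = discrete_topology S"
  proof (subst eq_commute, subst discrete_topology_unique, intro conjI ballI)
    show "topspace (subtopology X S) = S" using closedin_subset[OF clo[OF order_refl]] by auto
    fix x assume x: "x \<in> S"
    have "openin (subtopology X S) (S - (S - {x}))"
      using closedin_subset[OF clo[OF order_refl]] clo[of "S - {x}"]
      by (metis Diff_subset closedin_subset_topspace openin_diff openin_topspace topspace_subtopology_subset)
    then show "openin (subtopology X S) {x}" using x by (simp add: double_diff)
  qed
  ultimately show "finite S" by (simp add: compact_space_discrete_topology)
qed

text \<open>
  In each closed edge such a set has at most three points. All of its subsets have the same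
  property, so it is also discrete.
\<close>

lemma closedin_if_one_point_per_edge:
  assumes S: "S \<subseteq> graph_points G"
    and one: "\<And>e s t. Inr (e, s) \<in> S \<Longrightarrow> Inr (e, t) \<in> S \<Longrightarrow> s = t"
  shows "closedin (graph_space G) S"
  unfolding closedin_graph_space
proof (intro conjI ballI S)
  fix e assume "e \<in> arcs G"
  have "finite ({0..1} \<inter> edge_map G e -` S)"
  proof (cases "\<exists>t. Inr (e, t) \<in> S")
    case True
    then obtain t where t: "Inr (e, t) \<in> S" by blast
    then have "{0..1} \<inter> edge_map G e -` S \<subseteq> {0, 1, t}"
      by (auto simp: edge_map_def split: if_splits dest: one[OF _ t])
    then show ?thesis by (rule finite_subset) simp
  next
    case False
    then have "{0..1} \<inter> edge_map G e -` S \<subseteq> {0, 1}"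
      by (auto simp: edge_map_def split: if_splits)
    then show ?thesis by (rule finite_subset) simp
  qed
  then show "closedin I01 ({0..1} \<inter> edge_map G e -` S)"
    by (intro closed_subset finite_imp_closed) auto
qed

text \<open>
  The vertices in \<open>C\<close> on the one hand, and a choice of one point of \<open>C\<close> in every open edge that
  meets \<open>C\<close> on the other hand, form closed discrete subsets of a compact set.
\<close>

lemma compact_in_finite_subgraph:
  assumes C: "compactin (graph_space G) C"
  obtains H where "finite_subgraph H G" "C \<subseteq> graph_points H"
proof -
  have Csub: "C \<subseteq> graph_points G" using compactin_subset_topspace[OF C] by simp
  define V where "V = {v. Inl v \<in> C}"
  define E where "E = {e. \<exists>t. Inr (e, t) \<in> C}"
  have "\<forall>e\<in>E. \<exists>t. Inr (e, t) \<in> C" by (simp add: E_def)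
  then obtain \<tau> where \<tau>: "\<And>e. e \<in> E \<Longrightarrow> Inr (e, \<tau> e) \<in> C" by metis
  have "finite ((\<lambda>e. Inr (e, \<tau> e)) ` E :: ('v, 'e) gpoint set)"
    by (rule finite_if_all_subsets_closed[OF C])
      (use \<tau> Csub in \<open>auto intro!: closedin_if_one_point_per_edge\<close>)
  then have E: "finite E" by (rule finite_imageD) (auto simp: inj_on_def)
  have "finite (Inl ` V :: ('v, 'e) gpoint set)"
    by (rule finite_if_all_subsets_closed[OF C])
      (use Csub in \<open>auto simp: V_def intro!: closedin_if_one_point_per_edge\<close>)
  then have V: "finite V" by (rule finite_imageD) (auto simp: inj_on_def)
  have VG: "V \<subseteq> verts G" and EG: "E \<subseteq> arcs G"
    using Csub by (auto simp: V_def E_def graph_points_def)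
  define H where "H = \<lparr>verts = V \<union> tail G ` E \<union> head G ` E, arcs = E, tail = tail G, head = head G\<rparr>"
  have "wf_digraph H" by unfold_locales (auto simp: H_def)
  then have "finite_subgraph H G"
    using V E VG EG wf wf_digraph.tail_in_verts[OF wf] wf_digraph.head_in_verts[OF wf]
    by (auto simp: finite_subgraph_def subgraph_def compatible_def H_def)
  moreover have "C \<subseteq> graph_points H"
  proof
    fix x assume x: "x \<in> C"
    show "x \<in> graph_points H"
      using subsetD[OF Csub x]
      by (cases rule: graph_point_cases) (use x in \<open>auto simp: graph_points_def H_def V_def E_def\<close>)
  qed
  ultimately show thesis by (rule that)
qed

end

section \<open>Proper homotopies and the mapping class group\<close>

lemma proper_cmap_cong:
  assumes "proper_cmap X Y f" "\<And>x. x \<in> topspace X \<Longrightarrow> f x = g x"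
  shows "proper_cmap X Y g"
proof -
  have im: "g ` C = f ` C" if "closedin X C" for C
    using closedin_subset[OF that] assms(2) by force
  have pre: "{x \<in> topspace X. g x = y} = {x \<in> topspace X. f x = y}" for y
    using assms(2) by auto
  show ?thesis
    using assms unfolding proper_cmap_def proper_map_def closed_map_def
    by (auto simp: im pre intro: continuous_map_eq)
qed

lemma proper_cmap_id: "proper_cmap X X id"
  by (simp add: proper_cmap_def)

lemma proper_cmap_compose:
  "proper_cmap X Y f \<Longrightarrow> proper_cmap Y Z g \<Longrightarrow> proper_cmap X Z (g \<circ> f)"
  by (auto simp: proper_cmap_def intro: continuous_map_compose proper_map_compose)

lemma proper_cmap_inclusion:
  assumes "closedin X A"
  shows "proper_cmap (subtopology X A) X id"
  using assms closedin_subset[OF assms] unfolding proper_cmap_def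
  by (simp add: proper_map_inclusion closed_Int_compactin continuous_map_from_subtopology)

lemma proper_cmap_from_closed:
  assumes "proper_cmap X Y f" "closedin X A"
  shows "proper_cmap (subtopology X A) Y f"
  using proper_cmap_compose[OF proper_cmap_inclusion[OF assms(2)] assms(1)] by simp

lemma proper_cmap_from_compact:
  assumes "compact_space X" "Hausdorff_space Y" "continuous_map X Y f"
  shows "proper_cmap X Y f"
  using assms by (simp add: proper_cmap_def continuous_imp_proper_map Hausdorff_imp_kc_space)

text \<open>
  Properness and continuity can be checked on the two pieces of a closed cover. This is used both
  to concatenate homotopies and to treat maps that are modified on a single edge.
\<close>

lemma proper_cmap_closed_cover:
  assumes A: "closedin X A" and B: "closedin X B" and cover: "A \<union> B = topspace X"
    and fA: "proper_cmap (subtopology X A) Y f" and fB: "proper_cmap (subtopology X B) Y f"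
  shows "proper_cmap X Y f"
proof -
  have "continuous_map X Y f"
  proof (rule pasting_lemma_closed[where I = "UNIV::bool set" and T = "\<lambda>b. if b then A else B" and f = "\<lambda>_. f"])
    show "closedin X (if b then A else B)" for b using A B by simp
    show "continuous_map (subtopology X (if b then A else B)) Y f" for b
      using fA fB by (simp add: proper_cmap_def)
    show "\<exists>j. j \<in> UNIV \<and> x \<in> (if j then A else B) \<and> f x = f x" if "x \<in> topspace X" for x
      using that cover by (metis UNIV_I UnE)
  qed simp_all
  moreover have "closed_map X Y f"
    unfolding closed_map_def
  proof (intro allI impI)
    fix C assume C: "closedin X C"
    have "closedin Y (f ` (C \<inter> D))" if "closedin X D" "proper_cmap (subtopology X D) Y f" for D
    proof -
      have "closedin (subtopology X D) (C \<inter> D)"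
        using C by (auto simp: closedin_subtopology)
      then show ?thesis
        using that(2) by (auto simp: proper_cmap_def proper_map_def closed_map_def)
    qed
    then have "closedin Y (f ` (C \<inter> A) \<union> f ` (C \<inter> B))"
      using A B fA fB by (intro closedin_Un) auto
    moreover have "f ` C = f ` (C \<inter> A) \<union> f ` (C \<inter> B)"
      using closedin_subset[OF C] cover by blast
    ultimately show "closedin Y (f ` C)" by simp
  qed
  moreover have "compactin X {x \<in> topspace X. f x = y}" if y: "y \<in> topspace Y" for y
  proof -
    have "compactin X {x \<in> D. f x = y}" if "closedin X D" "proper_cmap (subtopology X D) Y f" for D
    proof -
      have "compactin (subtopology X D) {x \<in> topspace (subtopology X D). f x = y}"
        using that(2) y by (auto simp: proper_cmap_def proper_map_def)
      then have "compactin X {x \<in> topspace (subtopology X D). f x = y}"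
        by (simp add: compactin_subtopology)
      moreover have "topspace (subtopology X D) = D" using closedin_subset[OF that(1)] by auto
      ultimately show ?thesis by (simp only:)
    qed
    then have "compactin X ({x \<in> A. f x = y} \<union> {x \<in> B. f x = y})"
      using A B fA fB by (intro compactin_Un) auto
    then show ?thesis
      by (rule back_subst[where P="compactin X"]) (use cover in auto)
  qed
  ultimately show ?thesis by (simp add: proper_cmap_def proper_map_def)
qed

lemma proper_cmap_prod:
  assumes "proper_cmap Z Z' u" "proper_cmap X X' f"
  shows "proper_cmap (prod_topology Z X) (prod_topology Z' X') (\<lambda>p. (u (fst p), f (snd p)))"
proof -
  have "continuous_map (prod_topology Z X) Z' (u \<circ> fst)" "continuous_map (prod_topology Z X) X' (f \<circ> snd)"
    using assms by (auto simp: proper_cmap_def intro: continuous_map_compose continuous_map_fst continuous_map_snd)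
  then have "continuous_map (prod_topology Z X) (prod_topology Z' X') (\<lambda>p. (u (fst p), f (snd p)))"
    by (simp add: continuous_map_pairedI o_def)
  moreover have "proper_map (prod_topology Z X) (prod_topology Z' X') (\<lambda>(z, x). (u z, f x))"
    using assms by (simp add: proper_map_prod proper_cmap_def)
  ultimately show ?thesis by (simp add: proper_cmap_def case_prod_unfold)
qed

lemma proper_cmap_snd:
  assumes "compact_space Z"
  shows "proper_cmap (prod_topology Z X) X snd"
proof -
  have "compactin (prod_topology Z X) {p \<in> topspace (prod_topology Z X). snd p = y}" if "y \<in> topspace X" for y
  proof -
    have "compactin (prod_topology Z X) (topspace Z \<times> {y})"
      using assms that by (simp add: compactin_Times compact_space_def)
    then show ?thesis
      by (rule back_subst[where P="compactin (prod_topology Z X)"]) (use that in auto)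
  qed
  then show ?thesis
    using assms by (simp add: proper_cmap_def proper_map_def closed_map_snd continuous_map_snd)
qed

lemma proper_cmap_slice:
  assumes h: "proper_cmap (prod_topology Z X) Y h" and t: "t \<in> topspace Z" and Z: "Hausdorff_space Z"
  shows "proper_cmap X Y (\<lambda>x. h (t, x))"
proof -
  have "continuous_map X (prod_topology Z X) (Pair t)"
    using t by (intro continuous_map_pairedI) auto
  moreover have "proper_map X (prod_topology Z X) (Pair t)"
  proof (rule closed_injective_imp_proper_map)
    have "closedin Z {t}" using t Z by (simp add: closedin_Hausdorff_singleton)
    moreover have "Pair t ` C = {t} \<times> C" for C :: "'b set" by auto
    ultimately show "closed_map X (prod_topology Z X) (Pair t)"
      by (simp add: closed_map_def closedin_prod_Times_iff)
  qed (simp add: inj_on_def)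
  ultimately have "proper_cmap X (prod_topology Z X) (Pair t)"
    by (simp add: proper_cmap_def)
  from proper_cmap_compose[OF this h] show ?thesis by (simp add: o_def)
qed

text \<open>
  The end maps of a proper homotopy are proper, since they are its restrictions to closed slices.
\<close>

lemma proper_homotopic_imp_proper_cmap:
  assumes "proper_homotopic_with P X Y f g"
  shows "proper_cmap X Y f" "proper_cmap X Y g"
proof -
  obtain h where h: "proper_cmap (prod_topology (top_of_set {0..1::real}) X) Y h"
    and 0: "\<forall>x\<in>topspace X. h (0, x) = f x" and 1: "\<forall>x\<in>topspace X. h (1, x) = g x"
    using assms unfolding proper_homotopic_with_def by blast
  have H: "Hausdorff_space (top_of_set {0..1::real})" by (simp add: Hausdorff_space_subtopology)
  show "proper_cmap X Y f"
    by (rule proper_cmap_cong[OF proper_cmap_slice[OF h _ H, of 0]]) (use 0 in auto)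
  show "proper_cmap X Y g"
    by (rule proper_cmap_cong[OF proper_cmap_slice[OF h _ H, of 1]]) (use 1 in auto)
qed

lemma proper_homotopic_refl:
  assumes "proper_cmap X Y f"
  shows "proper_homotopic X Y f f"
proof -
  have "proper_cmap (prod_topology (top_of_set {0..1::real}) X) Y (f \<circ> snd)"
    by (intro proper_cmap_compose[OF proper_cmap_snd assms]) (simp add: compact_space_subtopology)
  then show ?thesis
    unfolding proper_homotopic_with_def by (intro exI[of _ "f \<circ> snd"]) auto
qed

lemma proper_cmap_reparam:
  assumes h: "proper_cmap (prod_topology (top_of_set {0..1::real}) X) Y h"
    and S: "compact S" and u: "continuous_on S u" "u ` S \<subseteq> {0..1::real}"
  shows "proper_cmap (prod_topology (top_of_set S) X) Y (\<lambda>p. h (u (fst p), snd p))"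
proof -
  have "proper_cmap (top_of_set S) (top_of_set {0..1::real}) u"
    using S u by (intro proper_cmap_from_compact)
      (auto simp: compact_space_subtopology Hausdorff_space_subtopology image_subset_iff_funcset)
  from proper_cmap_compose[OF proper_cmap_prod[OF this proper_cmap_id] h]
  show ?thesis by (simp add: o_def)
qed

lemma proper_homotopic_sym:
  assumes "proper_homotopic X Y f g"
  shows "proper_homotopic X Y g f"
proof -
  obtain h where h: "proper_cmap (prod_topology (top_of_set {0..1::real}) X) Y h"
    and "\<forall>x\<in>topspace X. h (0, x) = f x" and "\<forall>x\<in>topspace X. h (1, x) = g x"
    using assms unfolding proper_homotopic_with_def by blast
  moreover have "proper_cmap (prod_topology (top_of_set {0..1}) X) Y (\<lambda>p. h (1 - fst p, snd p))"
    by (rule proper_cmap_reparam[OF h]) (auto intro!: continuous_intros)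
  ultimately show ?thesis
    unfolding proper_homotopic_with_def
    by (intro exI[of _ "\<lambda>p. h (1 - fst p, snd p)"]) auto
qed

lemma proper_homotopic_trans:
  assumes "proper_homotopic X Y f g" "proper_homotopic X Y g k"
  shows "proper_homotopic X Y f k"
proof -
  let ?I = "top_of_set {0..1::real}"
  obtain h1 where h1: "proper_cmap (prod_topology ?I X) Y h1"
    "\<forall>x\<in>topspace X. h1 (0, x) = f x" "\<forall>x\<in>topspace X. h1 (1, x) = g x"
    using assms(1) unfolding proper_homotopic_with_def by blast
  obtain h2 where h2: "proper_cmap (prod_topology ?I X) Y h2"
    "\<forall>x\<in>topspace X. h2 (0, x) = g x" "\<forall>x\<in>topspace X. h2 (1, x) = k x"
    using assms(2) unfolding proper_homotopic_with_def by blast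
  define h where "h = (\<lambda>p. if fst p \<le> 1/2 then h1 (2 * fst p, snd p) else h2 (2 * fst p - 1, snd p))"
  have sub: "subtopology (prod_topology ?I X) (S \<times> topspace X) = prod_topology (top_of_set S) X"
    if "S \<subseteq> {0..1}" for S
  proof -
    have "subtopology (prod_topology ?I X) (S \<times> topspace X) = prod_topology (subtopology ?I S) (subtopology X (topspace X))"
      by (simp add: prod_topology_subtopology(1)[symmetric] subtopology_Times)
    then show ?thesis using that by (simp add: subtopology_subtopology inf_absorb2)
  qed
  have "proper_cmap (prod_topology ?I X) Y h"
  proof (rule proper_cmap_closed_cover)
    show "closedin (prod_topology ?I X) ({0..1/2} \<times> topspace X)" "closedin (prod_topology ?I X) ({1/2..1} \<times> topspace X)"
      by (auto simp: closedin_prod_Times_iff intro!: closed_subset)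
    show "{0..1/2} \<times> topspace X \<union> {1/2..1} \<times> topspace X = topspace (prod_topology ?I X)" by auto
    have "proper_cmap (prod_topology (top_of_set {0..1/2}) X) Y h"
      by (rule proper_cmap_cong[OF proper_cmap_reparam[OF h1(1), of "{0..1/2}" "\<lambda>t. 2 * t"]])
        (auto intro!: continuous_intros simp: h_def)
    then show "proper_cmap (subtopology (prod_topology ?I X) ({0..1/2} \<times> topspace X)) Y h"
      by (simp add: sub)
    have "h1 (2 * t, x) = h2 (2 * t - 1, x)" if "t = 1/2" "x \<in> topspace X" for t x
      unfolding that(1) using that(2) h1 h2 by simp
    then have "proper_cmap (prod_topology (top_of_set {1/2..1}) X) Y h"
      by (intro proper_cmap_cong[OF proper_cmap_reparam[OF h2(1), of "{1/2..1}" "\<lambda>t. 2 * t - 1"]])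
        (auto intro!: continuous_intros simp: h_def)
    then show "proper_cmap (subtopology (prod_topology ?I X) ({1/2..1} \<times> topspace X)) Y h"
      by (simp add: sub)
  qed
  then show ?thesis
    unfolding proper_homotopic_with_def
    using h1 h2 by (intro exI[of _ h]) (auto simp: h_def)
qed

lemma proper_homotopic_compose_left:
  assumes "proper_homotopic X Y f f'" "proper_cmap Y Z g"
  shows "proper_homotopic X Z (g \<circ> f) (g \<circ> f')"
proof -
  obtain h where h: "proper_cmap (prod_topology (top_of_set {0..1::real}) X) Y h"
    "\<forall>x\<in>topspace X. h (0, x) = f x" "\<forall>x\<in>topspace X. h (1, x) = f' x"
    using assms unfolding proper_homotopic_with_def by blast
  show ?thesis
    unfolding proper_homotopic_with_def
    by (intro exI[of _ "g \<circ> h"]) (use h proper_cmap_compose[OF h(1) assms(2)] in auto)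
qed

lemma proper_homotopic_compose_right:
  assumes "proper_homotopic Y Z g g'" "proper_cmap X Y f"
  shows "proper_homotopic X Z (g \<circ> f) (g' \<circ> f)"
proof -
  obtain h where h: "proper_cmap (prod_topology (top_of_set {0..1::real}) Y) Z h"
    "\<forall>x\<in>topspace Y. h (0, x) = g x" "\<forall>x\<in>topspace Y. h (1, x) = g' x"
    using assms unfolding proper_homotopic_with_def by blast
  have "f x \<in> topspace Y" if "x \<in> topspace X" for x
    using assms(2) that by (auto simp: proper_cmap_def continuous_map_def)
  moreover have "proper_cmap (prod_topology (top_of_set {0..1::real}) X) Z (\<lambda>p. h (fst p, f (snd p)))"
    using proper_cmap_compose[OF proper_cmap_prod[OF proper_cmap_id assms(2)] h(1)] by (simp add: o_def)
  ultimately show ?thesis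
    unfolding proper_homotopic_with_def
    by (intro exI[of _ "\<lambda>p. h (fst p, f (snd p))"]) (use h in auto)
qed

lemma proper_homotopic_compose:
  assumes "proper_homotopic X Y f f'" "proper_homotopic Y Z g g'"
  shows "proper_homotopic X Z (g \<circ> f) (g' \<circ> f')"
  using assms
  by (blast intro: proper_homotopic_trans proper_homotopic_compose_left proper_homotopic_compose_right
      proper_homotopic_imp_proper_cmap)

lemma proper_htpy_equiv_id: "proper_htpy_equiv X X id"
  unfolding proper_htpy_equiv_def
  by (intro conjI exI[of _ id]) (simp_all add: proper_cmap_id proper_homotopic_refl)

lemma proper_htpy_equiv_homotopic:
  assumes f: "proper_htpy_equiv X Y f" and fg: "proper_homotopic X Y f g"
  shows "proper_htpy_equiv X Y g"
proof -
  obtain k where k: "proper_cmap Y X k" "proper_homotopic Y Y (f \<circ> k) id" "proper_homotopic X X (k \<circ> f) id"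
    using f unfolding proper_htpy_equiv_def by blast
  have "proper_homotopic Y Y (g \<circ> k) id"
    by (rule proper_homotopic_trans[OF proper_homotopic_sym[OF proper_homotopic_compose_right[OF fg k(1)]] k(2)])
  moreover have "proper_homotopic X X (k \<circ> g) id"
    by (rule proper_homotopic_trans[OF proper_homotopic_sym[OF proper_homotopic_compose_left[OF fg k(1)]] k(3)])
  ultimately show ?thesis
    unfolding proper_htpy_equiv_def using k(1) proper_homotopic_imp_proper_cmap[OF fg] by blast
qed

lemma proper_htpy_equiv_compose:
  assumes f: "proper_htpy_equiv X Y f" and g: "proper_htpy_equiv Y Z g"
  shows "proper_htpy_equiv X Z (g \<circ> f)"
proof -
  obtain f' where f': "proper_cmap X Y f" "proper_cmap Y X f'" "proper_homotopic Y Y (f \<circ> f') id"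
      "proper_homotopic X X (f' \<circ> f) id"
    using f unfolding proper_htpy_equiv_def by blast
  obtain g' where g': "proper_cmap Y Z g" "proper_cmap Z Y g'" "proper_homotopic Z Z (g \<circ> g') id"
      "proper_homotopic Y Y (g' \<circ> g) id"
    using g unfolding proper_htpy_equiv_def by blast
  have "proper_homotopic Z Z (g \<circ> ((f \<circ> f') \<circ> g')) (g \<circ> (id \<circ> g'))"
    by (intro proper_homotopic_compose_left[OF _ g'(1)] proper_homotopic_compose_right[OF _ g'(2)] f')
  from proper_homotopic_trans[OF this] have 1: "proper_homotopic Z Z ((g \<circ> f) \<circ> (f' \<circ> g')) id"
    using g'(3) by (simp add: o_assoc)
  have "proper_homotopic X X (f' \<circ> ((g' \<circ> g) \<circ> f)) (f' \<circ> (id \<circ> f))"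
    by (intro proper_homotopic_compose_left[OF _ f'(2)] proper_homotopic_compose_right[OF _ f'(1)] g')
  from proper_homotopic_trans[OF this] have 2: "proper_homotopic X X ((f' \<circ> g') \<circ> (g \<circ> f)) id"
    using f'(4) by (simp add: o_assoc)
  show ?thesis
    unfolding proper_htpy_equiv_def
    using 1 2 proper_cmap_compose[OF f'(1) g'(1)] proper_cmap_compose[OF g'(2) f'(2)] by blast
qed

lemma proper_htpy_equiv_imp_proper_cmap: "proper_htpy_equiv X Y f \<Longrightarrow> proper_cmap X Y f"
  by (simp add: proper_htpy_equiv_def)

definition mapping_class :: "'a topology \<Rightarrow> ('a \<Rightarrow> 'a) \<Rightarrow> ('a \<Rightarrow> 'a) set" where
  "mapping_class X f = {g. proper_homotopic X X f g}"

lemma mapping_class_eq_iff: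
  assumes "proper_htpy_equiv X X f" "proper_htpy_equiv X X g"
  shows "mapping_class X f = mapping_class X g \<longleftrightarrow> proper_homotopic X X f g"
  unfolding mapping_class_def
  using assms proper_homotopic_refl proper_homotopic_sym proper_homotopic_trans proper_htpy_equiv_imp_proper_cmap
  by blast

lemma self_in_mapping_class: "proper_htpy_equiv X X f \<Longrightarrow> f \<in> mapping_class X f"
  by (simp add: mapping_class_def proper_homotopic_refl proper_htpy_equiv_imp_proper_cmap)

lemma carrier_mapping_class_group:
  "carrier (mapping_class_group X) = mapping_class X ` {f. proper_htpy_equiv X X f}"
proof -
  let ?R = "{(f, g). proper_htpy_equiv X X f \<and> proper_htpy_equiv X X g \<and> proper_homotopic X X f g}"
  have "?R `` {f} = mapping_class X f" if "proper_htpy_equiv X X f" for f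
    using that proper_htpy_equiv_homotopic[OF that] by (auto simp: mapping_class_def)
  then show ?thesis
    unfolding mapping_class_group_def quotient_def by auto
qed

lemma one_mapping_class_group: "\<one>\<^bsub>mapping_class_group X\<^esub> = mapping_class X id"
  by (simp add: mapping_class_group_def mapping_class_def)

lemma mult_mapping_class_group:
  assumes f: "proper_htpy_equiv X X f" and g: "proper_htpy_equiv X X g"
  shows "mapping_class X f \<otimes>\<^bsub>mapping_class_group X\<^esub> mapping_class X g = mapping_class X (f \<circ> g)"
proof -
  have "(\<exists>f'\<in>mapping_class X f. \<exists>g'\<in>mapping_class X g. proper_homotopic X X (f' \<circ> g') h) \<longleftrightarrow>
      proper_homotopic X X (f \<circ> g) h" (is "?L \<longleftrightarrow> ?R") for h
  proof
    assume ?L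
    then obtain f' g' where "proper_homotopic X X f f'" "proper_homotopic X X g g'" "proper_homotopic X X (f' \<circ> g') h"
      by (auto simp: mapping_class_def)
    then show ?R by (blast intro: proper_homotopic_trans proper_homotopic_compose)
  next
    assume ?R
    then show ?L using self_in_mapping_class[OF f] self_in_mapping_class[OF g] by blast
  qed
  then show ?thesis
    by (simp add: mapping_class_group_def mapping_class_def)
qed

lemma group_mapping_class_group: "group (mapping_class_group X)"
proof (rule groupI)
  let ?G = "mapping_class_group X"
  show "\<one>\<^bsub>?G\<^esub> \<in> carrier ?G"
    by (simp add: carrier_mapping_class_group one_mapping_class_group proper_htpy_equiv_id)
  fix A assume "A \<in> carrier ?G"
  then obtain f where f: "proper_htpy_equiv X X f" "A = mapping_class X f"
    by (auto simp: carrier_mapping_class_group)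
  show "\<one>\<^bsub>?G\<^esub> \<otimes>\<^bsub>?G\<^esub> A = A"
    by (simp add: f one_mapping_class_group mult_mapping_class_group proper_htpy_equiv_id)
  obtain g where g: "proper_cmap X X f" "proper_cmap X X g" "proper_homotopic X X (f \<circ> g) id" "proper_homotopic X X (g \<circ> f) id"
    using f unfolding proper_htpy_equiv_def by blast
  then have g': "proper_htpy_equiv X X g" unfolding proper_htpy_equiv_def by blast
  then have "mapping_class X g \<otimes>\<^bsub>?G\<^esub> A = \<one>\<^bsub>?G\<^esub>"
    using g f by (simp add: one_mapping_class_group mult_mapping_class_group mapping_class_eq_iff
        proper_htpy_equiv_compose proper_htpy_equiv_id)
  then show "\<exists>B\<in>carrier ?G. B \<otimes>\<^bsub>?G\<^esub> A = \<one>\<^bsub>?G\<^esub>"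
    using g' by (auto simp: carrier_mapping_class_group)
  fix B assume "B \<in> carrier ?G"
  then obtain k where k: "proper_htpy_equiv X X k" "B = mapping_class X k"
    by (auto simp: carrier_mapping_class_group)
  show "A \<otimes>\<^bsub>?G\<^esub> B \<in> carrier ?G"
    using f k by (simp add: mult_mapping_class_group carrier_mapping_class_group proper_htpy_equiv_compose)
  fix C assume "C \<in> carrier ?G"
  then obtain l where l: "proper_htpy_equiv X X l" "C = mapping_class X l"
    by (auto simp: carrier_mapping_class_group)
  show "A \<otimes>\<^bsub>?G\<^esub> B \<otimes>\<^bsub>?G\<^esub> C = A \<otimes>\<^bsub>?G\<^esub> (B \<otimes>\<^bsub>?G\<^esub> C)"
    using f k l by (simp add: mult_mapping_class_group proper_htpy_equiv_compose o_assoc)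
qed

lemma inv_mapping_class_group:
  assumes "proper_htpy_equiv X X f" "proper_htpy_equiv X X g" "proper_homotopic X X (g \<circ> f) id"
  shows "inv\<^bsub>mapping_class_group X\<^esub> mapping_class X f = mapping_class X g"
proof (rule group.inv_equality[OF group_mapping_class_group])
  show "mapping_class X g \<otimes>\<^bsub>mapping_class_group X\<^esub> mapping_class X f = \<one>\<^bsub>mapping_class_group X\<^esub>"
    using assms by (simp add: one_mapping_class_group mult_mapping_class_group mapping_class_eq_iff
        proper_htpy_equiv_compose proper_htpy_equiv_id)
qed (use assms in \<open>auto simp: carrier_mapping_class_group\<close>)

section \<open>Paths\<close>

lemma pathin_loop_concat:
  assumes "pathin X p" "pathin X q" "p 1 = q 0"
  shows "pathin X (loop_concat p q)"
proof -
  have half: "continuous_map (top_of_set S) X (\<lambda>t. r (u t))"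
    if "pathin X r" "continuous_on S u" "u ` S \<subseteq> {0..1}" for r S and u :: "real \<Rightarrow> real"
  proof -
    have "continuous_map (top_of_set S) (top_of_set {0..1}) u" using that by auto
    from continuous_map_compose[OF this that(1)[unfolded pathin_def]] show ?thesis by (simp add: o_def)
  qed
  show ?thesis
    unfolding pathin_def
  proof (rule pasting_lemma_closed[where I = "UNIV::bool set" and T = "\<lambda>b. if b then {0..1/2} else {1/2..1}"
        and f = "\<lambda>b. if b then (\<lambda>t. p (2 * t)) else (\<lambda>t. q (2 * t - 1))"])
    show "closedin (top_of_set {0..1}) (if b then {0..1/2} else {1/2..1::real})" for b
      by (auto intro!: closed_subset)
    show "continuous_map (subtopology (top_of_set {0..1}) (if b then {0..1/2} else {1/2..1})) X
       (if b then \<lambda>t. p (2 * t) else (\<lambda>t. q (2 * t - 1)))" for b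
    proof (cases b)
      case True
      have "continuous_map (top_of_set {0..1/2}) X (\<lambda>t. p (2 * t))"
        by (rule half[OF assms(1)]) (auto intro!: continuous_intros)
      then show ?thesis using True by (simp add: subtopology_subtopology Int_absorb1)
    next
      case False
      have "continuous_map (top_of_set {1/2..1}) X (\<lambda>t. q (2 * t - 1))"
        by (rule half[OF assms(2)]) (auto intro!: continuous_intros)
      then show ?thesis using False by (simp add: subtopology_subtopology Int_absorb1)
    qed
    show "(if i then \<lambda>t. p (2 * t) else (\<lambda>t. q (2 * t - 1))) x = (if j then \<lambda>t. p (2 * t) else (\<lambda>t. q (2 * t - 1))) x"
      if "x \<in> topspace (top_of_set {0..1}) \<inter> (if i then {0..1/2} else {1/2..1}) \<inter> (if j then {0..1/2} else {1/2..1})"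
      for i j x
    proof (cases "i = j")
      case False
      then have x: "x = 1/2" using that by (cases i; cases j) auto
      show ?thesis unfolding x using assms(3) by simp
    qed simp
    show "\<exists>j. j \<in> UNIV \<and> x \<in> (if j then {0..1/2} else {1/2..1}) \<and>
        loop_concat p q x = (if j then \<lambda>t. p (2 * t) else (\<lambda>t. q (2 * t - 1))) x"
      if "x \<in> topspace (top_of_set {0..1})" for x
      using that by (intro exI[of _ "x \<le> 1/2"]) (auto simp: loop_concat_def)
  qed simp
qed

lemma loop_concat_ends [simp]: "loop_concat p q 0 = p 0" "loop_concat p q 1 = q 1"
  by (simp_all add: loop_concat_def)

lemma range_loop_concat:
  assumes "p ` {0..1} \<subseteq> R" "q ` {0..1} \<subseteq> R"
  shows "loop_concat p q ` {0..1} \<subseteq> R"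
  using assms by (auto simp: loop_concat_def image_subset_iff)

lemma pathin_reverse:
  assumes "pathin X p"
  shows "pathin X (\<lambda>t. p (1 - t))"
proof -
  have "continuous_map (top_of_set {0..1}) (top_of_set {0..1}) (\<lambda>t::real. 1 - t)"
    by (auto intro!: continuous_intros)
  from continuous_map_compose[OF this assms[unfolded pathin_def]] show ?thesis
    by (simp add: pathin_def o_def)
qed

section \<open>Winding classes of loops\<close>

definition loop_in :: "'a topology \<Rightarrow> (real \<Rightarrow> 'a) \<Rightarrow> bool" where
  "loop_in X p \<longleftrightarrow> pathin X p \<and> p 0 = p 1"

definition winding :: "('a \<Rightarrow> complex) \<Rightarrow> (real \<Rightarrow> 'a) \<Rightarrow> real" where
  "winding \<phi> p = Re (winding_number (\<phi> \<circ> p) 0)"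

abbreviation nonzero_map :: "'a topology \<Rightarrow> ('a \<Rightarrow> complex) \<Rightarrow> bool" where
  "nonzero_map X \<phi> \<equiv> continuous_map X (top_of_set (- {0})) \<phi>"

text \<open>
  The homology class of the loop \<open>p\<close>, encoded as the functional on maps to the punctured plane that
  it induces. Taking the real part changes nothing for a loop, whose winding number is an integer; for
  paths that are not closed it leaves a real quantity that is additive under concatenation.
\<close>

definition winding_class :: "'a topology \<Rightarrow> (real \<Rightarrow> 'a) \<Rightarrow> ('a \<Rightarrow> complex) \<Rightarrow> real" where
  "winding_class X p = (\<lambda>\<phi>. if nonzero_map X \<phi> then winding \<phi> p else 0)"

lemma winding_cong: "(\<And>t. t \<in> {0..1} \<Longrightarrow> p t = q t) \<Longrightarrow> winding \<phi> p = winding \<phi> q"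
  unfolding winding_def by (rule arg_cong[where f=Re], rule winding_number_cong) simp

lemma winding_class_cong:
  "(\<And>t. t \<in> {0..1} \<Longrightarrow> p t = q t) \<Longrightarrow> winding_class X p = winding_class X q"
  unfolding winding_class_def using winding_cong[of p q] by auto

lemma nonzero_map_path:
  assumes "pathin X p" "nonzero_map X \<phi>"
  shows "path (\<phi> \<circ> p)" "0 \<notin> path_image (\<phi> \<circ> p)"
proof -
  have "pathin (top_of_set (- {0})) (\<phi> \<circ> p)" by (rule pathin_compose[OF assms])
  then show "path (\<phi> \<circ> p)" "0 \<notin> path_image (\<phi> \<circ> p)"
    by (auto simp: pathin_subtopology path_image_def pathin_def path_def)
qed

lemma winding_concat:
  assumes "pathin X p" "pathin X q" "p 1 = q 0" "nonzero_map X \<phi>"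
  shows "winding \<phi> (loop_concat p q) = winding \<phi> p + winding \<phi> q"
proof -
  have "\<phi> \<circ> loop_concat p q = (\<phi> \<circ> p) +++ (\<phi> \<circ> q)"
    by (auto simp: loop_concat_def joinpaths_def)
  then show ?thesis
    using nonzero_map_path[OF assms(1,4)] nonzero_map_path[OF assms(2,4)] assms(3)
    by (simp add: winding_def winding_number_join pathfinish_def pathstart_def)
qed

lemma winding_reverse:
  assumes "pathin X p" "nonzero_map X \<phi>"
  shows "winding \<phi> (\<lambda>t. p (1 - t)) = - winding \<phi> p"
proof -
  have "\<phi> \<circ> (\<lambda>t. p (1 - t)) = reversepath (\<phi> \<circ> p)"
    by (auto simp: reversepath_def)
  then show ?thesis
    using nonzero_map_path[OF assms] by (simp add: winding_def winding_number_reversepath)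
qed

lemma winding_class_reverse:
  assumes "pathin X p"
  shows "winding_class X (\<lambda>t. p (1 - t)) = - winding_class X p"
  using winding_reverse[OF assms] by (auto simp: winding_class_def fun_eq_iff)

lemma loop_in_reverse: "loop_in X p \<Longrightarrow> loop_in X (\<lambda>t. p (1 - t))"
  by (simp add: loop_in_def pathin_reverse)

lemma loop_in_compose: "loop_in X p \<Longrightarrow> continuous_map X Y f \<Longrightarrow> loop_in Y (f \<circ> p)"
  unfolding loop_in_def using pathin_compose[of X p Y f] by simp

lemma winding_class_homotopic:
  assumes p: "loop_in X p" and ff': "proper_homotopic X Y f f'"
  shows "winding_class Y (f \<circ> p) = winding_class Y (f' \<circ> p)"
proof
  fix \<phi>
  show "winding_class Y (f \<circ> p) \<phi> = winding_class Y (f' \<circ> p) \<phi>"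
  proof (cases "nonzero_map Y \<phi>")
    case \<phi>: True
    obtain h where h: "continuous_map (prod_topology (top_of_set {0..1::real}) X) Y h"
      "\<forall>x\<in>topspace X. h (0, x) = f x" "\<forall>x\<in>topspace X. h (1, x) = f' x"
      using ff' unfolding proper_homotopic_with_def proper_cmap_def by blast
    have pX: "p t \<in> topspace X" if "t \<in> {0..1}" for t
      using p that by (auto simp: loop_in_def pathin_def continuous_map_def)
    have "continuous_map (prod_topology (top_of_set {0..1}) (top_of_set {0..1}))
        (prod_topology (top_of_set {0..1}) X) (\<lambda>z. (fst z, (p \<circ> snd) z))"
      using p by (intro continuous_map_pairedI continuous_map_fst
          continuous_map_compose[OF continuous_map_snd]) (auto simp: loop_in_def pathin_def)
    from continuous_map_compose[OF continuous_map_compose[OF this h(1)] \<phi>]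
    have "continuous_on ({0..1} \<times> {0..1}) (\<lambda>z. \<phi> (h (fst z, p (snd z))))"
      and "(\<lambda>z. \<phi> (h (fst z, p (snd z)))) \<in> {0..1} \<times> {0..1} \<rightarrow> - {0}"
      by (auto simp: o_def)
    then have "homotopic_loops (- {0}) (\<phi> \<circ> (f \<circ> p)) (\<phi> \<circ> (f' \<circ> p))"
      unfolding homotopic_loops
      by (intro exI[of _ "\<lambda>z. \<phi> (h (fst z, p (snd z)))"])
        (use p h pX in \<open>auto simp: loop_in_def pathstart_def pathfinish_def\<close>)
    then show ?thesis
      by (simp add: winding_class_def winding_def winding_number_homotopic_loops o_assoc)
  qed (simp add: winding_class_def)
qed

text \<open>
  The action on homology classes. It is defined for arbitrary functionals, but it is independent of
  the chosen representative only for classes of loops.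
\<close>

definition mcg_push :: "'a topology \<Rightarrow> ('a \<Rightarrow> 'a) set \<Rightarrow> (('a \<Rightarrow> complex) \<Rightarrow> real) \<Rightarrow> ('a \<Rightarrow> complex) \<Rightarrow> real" where
  "mcg_push X A a = (\<lambda>\<phi>. if nonzero_map X \<phi> then a (\<phi> \<circ> (SOME f. f \<in> A)) else 0)"

lemma mcg_push_winding_class:
  assumes f: "proper_htpy_equiv X X f" and p: "loop_in X p"
  shows "mcg_push X (mapping_class X f) (winding_class X p) = winding_class X (f \<circ> p)"
proof -
  define k where "k = (SOME f'. f' \<in> mapping_class X f)"
  have "k \<in> mapping_class X f"
    unfolding k_def by (rule someI[of "\<lambda>f'. f' \<in> mapping_class X f", OF self_in_mapping_class[OF f]])
  then have fk: "proper_homotopic X X f k" by (simp add: mapping_class_def)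
  then have kc: "continuous_map X X k"
    using proper_homotopic_imp_proper_cmap(2)[OF fk] by (simp add: proper_cmap_def)
  have "mcg_push X (mapping_class X f) (winding_class X p) = winding_class X (k \<circ> p)"
    using continuous_map_compose[OF kc]
    by (auto simp: mcg_push_def k_def[symmetric] winding_class_def winding_def o_assoc fun_eq_iff)
  then show ?thesis using winding_class_homotopic[OF p fk] by simp
qed

text \<open>
  Real functions on any set are ordered lexicographically, by the sign of the value at the first
  point where they do not vanish, with respect to a well-ordering of the set.
\<close>

lemma exists_linear_order_cone:
  "\<exists>C :: ('i \<Rightarrow> real) set. (\<forall>x\<in>C. \<forall>y\<in>C. x + y \<in> C) \<and> (\<forall>x. x \<noteq> 0 \<longrightarrow> (- x \<in> C \<longleftrightarrow> x \<notin> C))"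
proof -
  obtain r :: "'i rel" where r: "Well_order r" "Field r = UNIV"
    using well_ordering[where 'a = 'i] by blast
  define lt where "lt = (\<lambda>i j. (i, j) \<in> r - Id)"
  have wf: "wf (r - Id)" using r(1) unfolding well_order_on_def by blast
  have tot: "lt i j \<or> i = j \<or> lt j i" for i j
  proof -
    have "total_on UNIV r" using r by (simp add: well_order_on_def linear_order_on_def)
    then show ?thesis by (auto simp: lt_def total_on_def)
  qed
  have tr: "lt i k" if "lt i j" "lt j k" for i j k
  proof -
    have "trans r" "antisym r"
      using r by (simp_all add: well_order_on_def linear_order_on_def partial_order_on_def preorder_on_def)
    then show ?thesis using that unfolding lt_def by (blast dest: transD antisymD)
  qed
  define lead where "lead = (\<lambda>(x :: 'i \<Rightarrow> real) i. x i \<noteq> 0 \<and> (\<forall>j. lt j i \<longrightarrow> x j = 0))"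
  have ex: "\<exists>i. lead x i" if "x \<noteq> 0" for x
  proof -
    have "\<exists>i. x i \<noteq> 0"
    proof (rule ccontr)
      assume "\<nexists>i. x i \<noteq> 0"
      then have "x = 0" by (auto simp: fun_eq_iff)
      then show False using that by simp
    qed
    then obtain i0 where "x i0 \<noteq> 0" by blast
    then obtain i where "x i \<noteq> 0" "\<And>j. (j, i) \<in> r - Id \<Longrightarrow> j \<notin> {i. x i \<noteq> 0}"
      using wfE_min[OF wf, of i0 "{i. x i \<noteq> 0}"] by auto
    then show ?thesis by (auto simp: lead_def lt_def)
  qed
  have uniq: "i = j" if "lead x i" "lead x j" for x i j
    using that tot[of i j] by (auto simp: lead_def)
  define C where "C = {x. \<exists>i. lead x i \<and> x i > 0}"
  have "x + y \<in> C" if x: "x \<in> C" and y: "y \<in> C" for x y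
  proof -
    obtain i j where i: "lead x i" "x i > 0" and j: "lead y j" "y j > 0"
      using x y by (auto simp: C_def)
    consider "lt i j" | "i = j" | "lt j i" using tot by blast
    then show ?thesis
    proof cases
      case 1
      then have "lead (x + y) i \<and> (x + y) i > 0" using i j tr by (auto simp: lead_def)
      then show ?thesis by (auto simp: C_def)
    next
      case 2
      then have "lead (x + y) i \<and> (x + y) i > 0" using i j by (auto simp: lead_def)
      then show ?thesis by (auto simp: C_def)
    next
      case 3
      then have "lead (x + y) j \<and> (x + y) j > 0" using i j tr by (auto simp: lead_def)
      then show ?thesis by (auto simp: C_def)
    qed
  qed
  moreover have "- x \<in> C \<longleftrightarrow> x \<notin> C" if nz: "x \<noteq> 0" for x
  proof -
    obtain i where i: "lead x i" using ex[OF nz] by blast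
    then have mi: "lead (- x) i" by (auto simp: lead_def)
    have "x \<in> C \<longleftrightarrow> x i > 0" using i uniq by (auto simp: C_def)
    moreover have "- x \<in> C \<longleftrightarrow> x i < 0" using mi uniq by (auto simp: C_def)
    moreover have "x i \<noteq> 0" using i by (simp add: lead_def)
    ultimately show ?thesis by linarith
  qed
  ultimately show ?thesis by blast
qed

lemma topspace_mcg_topology:
  assumes wf: "wf_digraph G"
  shows "topspace (mcg_topology G) = carrier (mapping_class_group (graph_space G))"
proof -
  let ?M = "mapping_class_group (graph_space G)"
  interpret M: group ?M by (rule group_mapping_class_group)
  let ?E = "\<lparr>verts = {}, arcs = {}, tail = tail G, head = head G\<rparr> :: ('a, 'b) pre_digraph"
  have "openin (mcg_topology G) (carrier ?M)"
    unfolding openin_mcg_topology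
  proof (intro conjI ballI exI[of _ ?E])
    fix A assume "A \<in> carrier ?M"
    then show "A <#\<^bsub>?M\<^esub> mcg_nbhd (graph_space G) (graph_points ?E) \<subseteq> carrier ?M"
      by (auto simp: l_coset_def mcg_nbhd_def)
    show "finite_subgraph ?E G"
      using wf by (auto simp: finite_subgraph_def subgraph_def compatible_def wf_digraph_def)
  qed simp
  moreover have "topspace (mcg_topology G) \<subseteq> carrier ?M"
    using openin_topspace openin_mcg_topology by blast
  ultimately show ?thesis using openin_subset by blast
qed

text \<open>
  The action on winding classes has open stabilisers: a loop has compact image, so it lies in a
  finite subgraph, and maps that fix this subgraph do not move its class.
\<close>

lemma not_amenable_if_shearing:
  fixes G :: "('v, 'e) pre_digraph"
  defines "X \<equiv> graph_space G"
  defines "M \<equiv> mapping_class_group X"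
  assumes wf: "wf_digraph G"
    and U: "subgroup U M" "openin (mcg_topology G) U"
    and p: "loop_in X p" "winding_class X p \<noteq> 0"
    and q: "loop_in X q" "winding_class X q \<noteq> 0"
    and f: "proper_htpy_equiv X X f" "mapping_class X f \<in> U"
      "winding_class X (f \<circ> p) = winding_class X p + winding_class X q"
      "winding_class X (f \<circ> q) = winding_class X q"
    and h: "proper_htpy_equiv X X h" "mapping_class X h \<in> U"
      "winding_class X (h \<circ> q) = winding_class X q + winding_class X p"
      "winding_class X (h \<circ> p) = winding_class X p"
  shows "\<not> amenable (M\<lparr>carrier := U\<rparr>) (subtopology (mcg_topology G) U)"
proof -
  interpret M: group M unfolding M_def by (rule group_mapping_class_group)
  define A where "A = winding_class X ` {r. loop_in X r}"
  have UM: "U \<subseteq> carrier M" using U(1) by (rule subgroup.subset)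
  have rep: "\<exists>f. proper_htpy_equiv X X f \<and> g = mapping_class X f" if "g \<in> carrier M" for g
    using that by (auto simp: M_def carrier_mapping_class_group)
  have cont: "continuous_map X X f" if "proper_htpy_equiv X X f" for f
    using proper_htpy_equiv_imp_proper_cmap[OF that] by (simp add: proper_cmap_def)
  have push_mult: "mcg_push X (g \<otimes>\<^bsub>M\<^esub> k) a = mcg_push X g (mcg_push X k a)"
    if gk: "g \<in> carrier M" "k \<in> carrier M" and a: "a \<in> A" for g k a
  proof -
    obtain f1 where f1: "proper_htpy_equiv X X f1" "g = mapping_class X f1" using rep gk by blast
    obtain f2 where f2: "proper_htpy_equiv X X f2" "k = mapping_class X f2" using rep gk by blast
    obtain r where r: "loop_in X r" "a = winding_class X r" using a by (auto simp: A_def)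
    have "g \<otimes>\<^bsub>M\<^esub> k = mapping_class X (f1 \<circ> f2)"
      using f1 f2 by (simp add: M_def mult_mapping_class_group)
    then show ?thesis
      using f1 f2 r
      by (simp add: mcg_push_winding_class proper_htpy_equiv_compose loop_in_compose[OF _ cont] o_assoc)
  qed
  obtain C :: "((('v, 'e) gpoint \<Rightarrow> complex) \<Rightarrow> real) set" where
    "(\<forall>x\<in>C. \<forall>y\<in>C. x + y \<in> C) \<and> (\<forall>x. x \<noteq> 0 \<longrightarrow> (- x \<in> C \<longleftrightarrow> x \<notin> C))"
    using exists_linear_order_cone[where 'i = "('v, 'e) gpoint \<Rightarrow> complex"] ..
  then have C: "\<And>x y. x \<in> C \<Longrightarrow> y \<in> C \<Longrightarrow> x + y \<in> C" "\<And>x. x \<noteq> 0 \<Longrightarrow> - x \<in> C \<longleftrightarrow> x \<notin> C"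
    by simp_all
  \<comment> \<open>the right translates of a coset \<open>g\<close> by the neighbourhood of a finite subgraph that carries the
    loop all act on its class in the same way\<close>
  have stab: "openin (mcg_topology G) {g \<in> carrier M. mcg_push X g a = b}" if a: "a \<in> A" for a b
    unfolding openin_mcg_topology X_def[symmetric] M_def[symmetric]
  proof (intro conjI ballI)
    fix g assume g: "g \<in> {g \<in> carrier M. mcg_push X g a = b}"
    obtain r where r: "loop_in X r" "a = winding_class X r" using a by (auto simp: A_def)
    have "compactin X (r ` {0..1})"
      using r(1) by (intro image_compactin[of "top_of_set {0..1}"])
        (auto simp: loop_in_def pathin_def compactin_subtopology)
    then obtain H where H: "finite_subgraph H G" "r ` {0..1} \<subseteq> graph_points H"
      unfolding X_def by (rule compact_in_finite_subgraph[OF wf])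
    have "mcg_push X (g \<otimes>\<^bsub>M\<^esub> k) a = b" "g \<otimes>\<^bsub>M\<^esub> k \<in> carrier M"
      if k: "k \<in> mcg_nbhd X (graph_points H)" for k
    proof -
      have kM: "k \<in> carrier M" using k by (simp add: mcg_nbhd_def M_def)
      obtain f0 where f0: "f0 \<in> k" "fixes_and_preserves X (graph_points H) f0"
        using k by (auto simp: mcg_nbhd_def)
      obtain f1 where f1: "proper_htpy_equiv X X f1" "k = mapping_class X f1" using rep kM by blast
      then have "proper_homotopic X X f1 f0" using f0(1) by (simp add: mapping_class_def)
      then have "winding_class X (f1 \<circ> r) = winding_class X (f0 \<circ> r)"
        by (rule winding_class_homotopic[OF r(1)])
      also have "\<dots> = winding_class X r"
      proof (rule winding_class_cong)
        fix t :: real assume "t \<in> {0..1}"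
        then have "r t \<in> graph_points H" using H(2) by blast
        then show "(f0 \<circ> r) t = r t" using f0(2) by (simp add: fixes_and_preserves_def)
      qed
      finally have "mcg_push X k a = a"
        using f1 r by (simp add: mcg_push_winding_class)
      then show "mcg_push X (g \<otimes>\<^bsub>M\<^esub> k) a = b"
        using push_mult[OF _ kM a] g by simp
      show "g \<otimes>\<^bsub>M\<^esub> k \<in> carrier M" using g kM by simp
    qed
    then show "\<exists>H. finite_subgraph H G \<and>
        g <#\<^bsub>M\<^esub> mcg_nbhd X (graph_points H) \<subseteq> {g \<in> carrier M. mcg_push X g a = b}"
      using H(1) by (auto simp: l_coset_def intro!: exI[of _ H])
  qed simp
  show ?thesis
  proof (rule shear_pair_not_amenable[where A = A and \<alpha> = "mcg_push X" and C = C
        and a = "winding_class X p" and b = "winding_class X q"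
        and f = "mapping_class X f" and h = "mapping_class X h"])
    show "group (M\<lparr>carrier := U\<rparr>)" using U(1) M.is_group by (rule subgroup.subgroup_is_group)
    show "topspace (subtopology (mcg_topology G) U) = carrier (M\<lparr>carrier := U\<rparr>)"
      using UM by (auto simp: topspace_mcg_topology[OF wf] M_def X_def)
    show "- x \<in> A" if xA: "x \<in> A" for x
    proof -
      obtain r where r: "loop_in X r" "x = winding_class X r" using xA by (auto simp: A_def)
      then have "- x = winding_class X (\<lambda>t. r (1 - t))"
        by (simp add: winding_class_reverse loop_in_def)
      then show ?thesis using loop_in_reverse[OF r(1)] by (auto simp: A_def)
    qed
    show "mcg_push X g x \<in> A" if gx: "g \<in> carrier (M\<lparr>carrier := U\<rparr>)" "x \<in> A" for g x
    proof -
      obtain k where k: "proper_htpy_equiv X X k" "g = mapping_class X k" using gx UM rep[of g] by auto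
      obtain r where r: "loop_in X r" "x = winding_class X r" using gx by (auto simp: A_def)
      show ?thesis
        using k r loop_in_compose[OF r(1) cont[OF k(1)]] by (auto simp: A_def mcg_push_winding_class)
    qed
    show "mcg_push X (g \<otimes>\<^bsub>M\<lparr>carrier := U\<rparr>\<^esub> k) x = mcg_push X g (mcg_push X k x)"
      if "g \<in> carrier (M\<lparr>carrier := U\<rparr>)" "k \<in> carrier (M\<lparr>carrier := U\<rparr>)" "x \<in> A" for g k x
      using that subsetD[OF UM] push_mult[of g k x] by simp
    show "mcg_push X \<one>\<^bsub>M\<lparr>carrier := U\<rparr>\<^esub> x = x" if "x \<in> A" for x
      using that by (auto simp: A_def M_def one_mapping_class_group mcg_push_winding_class proper_htpy_equiv_id)
    show "mcg_push X g (x + y) = mcg_push X g x + mcg_push X g y" for g x y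
      by (auto simp: mcg_push_def)
    show "mcg_push X g (- x) = - mcg_push X g x" for g x
      by (auto simp: mcg_push_def)
    show "openin (subtopology (mcg_topology G) U) {g \<in> carrier (M\<lparr>carrier := U\<rparr>). mcg_push X g x = y}"
      if "x \<in> A" for x y
      unfolding openin_subtopology using stab[OF that, of y] UM by auto
  qed (use C p q f h in \<open>auto simp: A_def mcg_push_winding_class\<close>)
qed

section \<open>Edge slides\<close>

definition open_edge :: "'e \<Rightarrow> ('v, 'e) gpoint set" where
  "open_edge e = {Inr (e, t) | t. 0 < t \<and> t < 1}"

definition replace_edge :: "'e \<Rightarrow> (real \<Rightarrow> ('v, 'e) gpoint) \<Rightarrow> ('v, 'e) gpoint \<Rightarrow> ('v, 'e) gpoint" where
  "replace_edge e \<gamma> x = (case x of Inl v \<Rightarrow> Inl v | Inr (e', t) \<Rightarrow> if e' = e \<and> 0 < t \<and> t < 1 then \<gamma> t else Inr (e', t))"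

lemma replace_edge_outside: "x \<notin> open_edge e \<Longrightarrow> replace_edge e \<gamma> x = x"
  by (auto simp: replace_edge_def open_edge_def split: sum.splits)

lemma replace_edge_edge_map:
  assumes "\<gamma> 0 = Inl (tail G e)" "\<gamma> 1 = Inl (head G e)" "t \<in> {0..1}"
  shows "replace_edge e \<gamma> (edge_map G e t) = \<gamma> t"
proof -
  consider "t = 0" | "t = 1" | "0 < t" "t < 1" using assms(3) by fastforce
  then show ?thesis using assms by cases (auto simp: replace_edge_def)
qed

lemma open_edge_edge_map: "x \<in> open_edge e \<Longrightarrow> \<exists>t. 0 < t \<and> t < 1 \<and> x = edge_map G e t"
  by (auto simp: open_edge_def)

lemma edge_map_notin_open_edge: "e \<noteq> e' \<Longrightarrow> edge_map G e' t \<notin> open_edge e"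
  by (auto simp: edge_map_def open_edge_def)

lemma vertex_notin_open_edge [simp]: "Inl v \<notin> open_edge e"
  by (auto simp: open_edge_def)

lemma edge_map_range: "edge_map G e ` {0..1} \<subseteq> {Inl (tail G e), Inl (head G e)} \<union> open_edge e"
  by (auto simp: edge_map_def open_edge_def)

text \<open>
  A map supported on a connected set \<open>Q\<close> that it preserves cannot move points between complementary
  components of \<open>K\<close>, since \<open>Q\<close> lies in one of them.
\<close>

lemma fixes_and_preserves_supported:
  assumes out: "\<And>x. x \<notin> Q \<Longrightarrow> f x = x" and inn: "f ` Q \<subseteq> Q"
    and Q: "connectedin X Q" "Q \<inter> K = {}"
  shows "fixes_and_preserves X K f"
  unfolding fixes_and_preserves_def
proof (intro conjI ballI)
  show "f x = x" if "x \<in> K" for x using that out Q(2) by blast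
  fix C assume C: "C \<in> connected_components_of (subtopology X (topspace X - K))"
  show "f ` C \<subseteq> C"
  proof (cases "C \<inter> Q = {}")
    case True
    then have "f ` C = C" using out by force
    then show ?thesis by simp
  next
    case False
    have "connectedin (subtopology X (topspace X - K)) Q"
      using Q connectedin_subset_topspace[OF Q(1)] by (auto simp: connectedin_subtopology)
    then have "Q \<subseteq> C"
      using connected_components_of_maximal[OF C] False by (auto simp: disjnt_def Int_commute)
    then show ?thesis using out inn by (metis image_subset_iff subsetD)
  qed
qed

text \<open>
  The edge \<open>e\<close> is mapped to itself followed by the loop \<open>c\<close>, a handle slide of the head of \<open>e\<close>
  along \<open>c\<close>.
\<close>

definition slide :: "('v, 'e) pre_digraph \<Rightarrow> 'e \<Rightarrow> (real \<Rightarrow> ('v, 'e) gpoint) \<Rightarrow> ('v, 'e) gpoint \<Rightarrow> ('v, 'e) gpoint" where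
  "slide G e c = replace_edge e (loop_concat (edge_map G e) c)"

text \<open>
  The set \<open>D\<close> contains the ends of both edges and supplies the paths that close each edge up to a
  loop and that join these two loops to each other, all of this away from \<open>K\<close>.
\<close>

definition linked_edges :: "('v, 'e) pre_digraph \<Rightarrow> ('v, 'e) gpoint set \<Rightarrow> 'e \<Rightarrow> 'e \<Rightarrow> ('v, 'e) gpoint set \<Rightarrow> bool" where
  "linked_edges G K e e' D \<longleftrightarrow> e \<in> arcs G \<and> e' \<in> arcs G \<and> e \<noteq> e' \<and> path_connectedin (graph_space G) D \<and>
     {Inl (tail G e), Inl (head G e), Inl (tail G e'), Inl (head G e')} \<subseteq> D \<and>
     D \<inter> (open_edge e \<union> open_edge e') = {} \<and> (D \<union> open_edge e \<union> open_edge e') \<inter> K = {}"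

lemma linked_edges_sym: "linked_edges G K e e' D \<Longrightarrow> linked_edges G K e' e D"
  by (auto simp: linked_edges_def)

context
  fixes G :: "('v, 'e) pre_digraph"
  assumes wf: "wf_digraph G"
begin

lemmas [simp] = topspace_graph[OF wf]

lemma openin_open_edge:
  assumes "e \<in> arcs G"
  shows "openin (graph_space G) (open_edge e)"
  unfolding openin_graph_space
proof (intro conjI ballI)
  show "open_edge e \<subseteq> graph_points G" using assms by (auto simp: open_edge_def graph_points_def)
  fix e'
  have "{0..1} \<inter> edge_map G e' -` open_edge e = (if e' = e then {0..1} \<inter> {0<..<1} else {})"
    by (auto simp: edge_map_def open_edge_def)
  then show "openin I01 ({0..1} \<inter> edge_map G e' -` open_edge e)"
    using openin_open_Int[of "{0<..<1::real}" "{0..1}"] by auto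
qed

text \<open>
  A homotopy that moves only points of one edge is proper: outside the edge it is the projection
  along the compact interval, and the closed edge is compact.
\<close>

lemma proper_cmap_replace_edge:
  assumes e: "e \<in> arcs G"
    and h: "continuous_map (prod_topology I01 I01) (graph_space G) h"
    and ends: "\<And>s. s \<in> {0..1} \<Longrightarrow> h (s, 0) = Inl (tail G e)" "\<And>s. s \<in> {0..1} \<Longrightarrow> h (s, 1) = Inl (head G e)"
  shows "proper_cmap (prod_topology I01 (graph_space G)) (graph_space G)
           (\<lambda>p. replace_edge e (\<lambda>t. h (fst p, t)) (snd p))" (is "proper_cmap ?P ?X ?H")
proof -
  have on_edge: "?H (s, edge_map G e t) = h (s, t)" if "s \<in> {0..1}" "t \<in> {0..1}" for s t
    using replace_edge_edge_map[of "\<lambda>t. h (s, t)" G e t] ends that by simp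
  have cont: "continuous_map ?P ?X ?H"
  proof (rule continuous_map_prod_graph_space[OF wf])
    fix v assume "v \<in> verts G"
    then show "continuous_map I01 ?X (\<lambda>s. ?H (s, Inl v))"
      by (simp add: replace_edge_def graph_points_def)
  next
    fix e' assume e': "e' \<in> arcs G"
    show "continuous_map (prod_topology I01 I01) ?X (\<lambda>p. ?H (fst p, edge_map G e' (snd p)))"
    proof (cases "e' = e")
      case True
      show ?thesis
        by (rule continuous_map_eq[OF h]) (use on_edge True in auto)
    next
      case False
      have "continuous_map (prod_topology I01 I01) ?X (edge_map G e' \<circ> snd)"
        by (rule continuous_map_compose[OF continuous_map_snd continuous_map_edge_map[OF wf e']])
      then show ?thesis
        by (rule continuous_map_eq)
          (use False edge_map_notin_open_edge[of e e' G] in \<open>auto simp: replace_edge_outside\<close>)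
    qed
  qed
  define A where "A = graph_points G - open_edge e"
  define B where "B = edge_map G e ` {0..1}"
  have A: "closedin ?X A"
    using closedin_diff[OF closedin_topspace openin_open_edge[OF e]] by (simp add: A_def)
  have Bc: "compactin ?X B"
    unfolding B_def
    by (rule image_compactin[OF _ continuous_map_edge_map[OF wf e]]) (simp add: compactin_subtopology)
  then have B: "closedin ?X B" by (rule compactin_imp_closedin[OF Hausdorff_graph_space[OF wf]])
  have AB: "A \<union> B = graph_points G"
    using closedin_subset[OF B] open_edge_edge_map[of _ e G] by (fastforce simp: A_def B_def)
  show ?thesis
  proof (rule proper_cmap_closed_cover)
    show "closedin ?P ({0..1} \<times> A)" "closedin ?P ({0..1} \<times> B)"
      using A B by (simp_all add: closedin_prod_Times_iff)
    show "{0..1} \<times> A \<union> {0..1} \<times> B = topspace ?P" using AB by auto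
    have I: "compact_space I01" by (simp add: compact_space_subtopology)
    show "proper_cmap (subtopology ?P ({0..1} \<times> A)) ?X ?H"
    proof (rule proper_cmap_cong[OF proper_cmap_from_closed[OF proper_cmap_snd[OF I]]])
      show "closedin ?P ({0..1} \<times> A)" using A by (simp add: closedin_prod_Times_iff)
      show "snd p = ?H p" if "p \<in> topspace (subtopology ?P ({0..1} \<times> A))" for p
        using that by (auto simp: A_def replace_edge_outside)
    qed
    show "proper_cmap (subtopology ?P ({0..1} \<times> B)) ?X ?H"
    proof (rule proper_cmap_from_compact[OF _ Hausdorff_graph_space[OF wf]])
      have "compactin ?P ({0..1} \<times> B)"
        using I Bc by (simp add: compactin_Times compact_space_def)
      then show "compact_space (subtopology ?P ({0..1} \<times> B))" by (rule compact_space_subtopology)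
      show "continuous_map (subtopology ?P ({0..1} \<times> B)) ?X ?H"
        using cont by (rule continuous_map_from_subtopology)
    qed
  qed
qed

text \<open>
  Sliding along \<open>c\<close> and then back maps \<open>e\<close> to \<open>e\<close> followed by the reverse of \<open>c\<close> and by \<open>c\<close>. This
  path is a reparametrisation of a single path \<open>\<gamma>\<close>, namely \<open>e\<close> followed by the reverse of \<open>c\<close>, which is
  run through to its end and then back to its midpoint. The edge itself is the first half of \<open>\<gamma>\<close>,
  so that the straight line homotopy between the two parameter functions does the job; it stays in
  the image of \<open>\<gamma>\<close>.
\<close>

lemma slide_reverse_slide:
  assumes e: "e \<in> arcs G" and c: "pathin (graph_space G) c" "c 0 = Inl (head G e)" "c 1 = Inl (head G e)"
    and avoid: "\<And>t. t \<in> {0..1} \<Longrightarrow> c t \<notin> open_edge e"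
    and Q: "edge_map G e ` {0..1} \<subseteq> Q" "c ` {0..1} \<subseteq> Q" "connectedin (graph_space G) Q" "Q \<inter> K = {}"
  shows "proper_homotopic_with (fixes_and_preserves (graph_space G) K) (graph_space G) (graph_space G)
           (slide G e (\<lambda>t. c (1 - t)) \<circ> slide G e c) id"
proof -
  let ?X = "graph_space G"
  define rc where "rc = (\<lambda>t. c (1 - t))"
  define \<gamma> where "\<gamma> = loop_concat (edge_map G e) rc"
  \<comment> \<open>on the first half of \<open>e\<close>, which the first slide stretches over all of \<open>e\<close>, the composite runs through
    \<open>\<gamma>\<close> at double speed; on the second half it runs through \<open>c\<close>, which is the second half of \<open>\<gamma>\<close>
    reversed, at the same speed\<close>
  define \<rho> where "\<rho> = (\<lambda>t::real. min (2 * t) (3/2 - t))"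
  define w where "w = (\<lambda>p. (1 - fst p) * \<rho> (snd p) + fst p * (snd p / 2))"
  define h where "h = \<gamma> \<circ> w"
  have \<gamma>: "pathin ?X \<gamma>"
    unfolding \<gamma>_def rc_def using c by (intro pathin_loop_concat pathin_edge_map[OF wf] e pathin_reverse) auto
  have \<rho>01: "\<rho> t \<in> {0..1}" if "t \<in> {0..1}" for t
    using that by (auto simp: \<rho>_def min_def)
  have w01: "w p \<in> {0..1}" if p: "p \<in> {0..1} \<times> {0..1}" for p
  proof -
    obtain s t where st: "p = (s, t)" "s \<in> {0..1}" "t \<in> {0..1}" using p by auto
    have "(1 - s) * \<rho> t + s * (t / 2) \<in> {0..1}"
    proof -
      have "(1 - s) * \<rho> t + s * (t / 2) \<le> (1 - s) * 1 + s * 1"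
        using \<rho>01[OF st(3)] st by (intro add_mono mult_left_mono) auto
      moreover have "0 \<le> (1 - s) * \<rho> t + s * (t / 2)"
        using \<rho>01[OF st(3)] st by simp
      ultimately show ?thesis by simp
    qed
    then show ?thesis by (simp add: w_def st)
  qed
  have h: "continuous_map (prod_topology I01 I01) ?X h"
    unfolding h_def
  proof (rule continuous_map_compose[OF _ \<gamma>[unfolded pathin_def]])
    have "continuous_on ({0..1} \<times> {0..1}) w"
      unfolding w_def \<rho>_def by (intro continuous_intros) auto
    then show "continuous_map (prod_topology I01 I01) I01 w" using w01 by auto
  qed
  have h0: "h (s, 0) = Inl (tail G e)" and h1: "h (s, 1) = Inl (head G e)" for s
    by (auto simp: h_def w_def \<rho>_def \<gamma>_def loop_concat_def min_def algebra_simps)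
  have hQ: "h (s, t) \<in> Q" if "s \<in> {0..1}" "t \<in> {0..1}" for s t
  proof -
    have r: "w (s, t) \<in> {0..1}" using w01 that by simp
    show ?thesis
    proof (cases "w (s, t) \<le> 1/2")
      case True
      then have "h (s, t) = edge_map G e (2 * w (s, t))" "2 * w (s, t) \<in> {0..1}"
        using r by (auto simp: h_def \<gamma>_def loop_concat_def)
      then show ?thesis using Q(1) by auto
    next
      case False
      then have "h (s, t) = c (1 - (2 * w (s, t) - 1))" "1 - (2 * w (s, t) - 1) \<in> {0..1}"
        using r by (auto simp: h_def \<gamma>_def rc_def loop_concat_def)
      then show ?thesis using Q(2) by (metis image_subset_iff)
    qed
  qed
  define H where "H = (\<lambda>p. replace_edge e (\<lambda>t. h (fst p, t)) (snd p))"
  have H: "proper_cmap (prod_topology I01 ?X) ?X H"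
    unfolding H_def by (rule proper_cmap_replace_edge[OF e h]) (simp_all add: h0 h1)
  have H_edge: "H (s, edge_map G e t) = h (s, t)" if "t \<in> {0..1}" for s t
    unfolding H_def using replace_edge_edge_map[of "\<lambda>t. h (s, t)" G e t] h0 h1 that by simp
  have H_out: "H (s, x) = x" if "x \<notin> open_edge e" for s x
    using that by (simp add: H_def replace_edge_outside)
  have H0: "H (0, x) = (slide G e rc \<circ> slide G e c) x" for x
  proof (cases "x \<in> open_edge e")
    case False
    then show ?thesis by (simp add: H_out slide_def replace_edge_outside)
  next
    case True
    obtain t where t: "0 < t" "t < 1" "x = edge_map G e t" using open_edge_edge_map[of x e G] True by blast
    have Hx: "H (s, x) = h (s, t)" for s unfolding t(3) by (rule H_edge) (use t in simp)
    have sl: "slide G e c x = loop_concat (edge_map G e) c t"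
      unfolding slide_def t(3) using t c by (intro replace_edge_edge_map) auto
    show ?thesis
    proof (cases "t \<le> 1/2")
      case True
      have "slide G e rc (edge_map G e (2 * t)) = \<gamma> (2 * t)"
        unfolding slide_def \<gamma>_def using t True c by (intro replace_edge_edge_map) (auto simp: rc_def)
      moreover have "H (0, x) = \<gamma> (2 * t)"
        unfolding Hx using t(1,2) True by (simp add: h_def w_def \<rho>_def min_def)
      ultimately show ?thesis using True by (simp add: sl loop_concat_def)
    next
      case False
      then have "slide G e rc (c (2 * t - 1)) = c (2 * t - 1)"
        using avoid[of "2 * t - 1"] t by (simp add: slide_def replace_edge_outside)
      moreover have "H (0, x) = \<gamma> (3/2 - t)"
        unfolding Hx using t(1,2) False by (simp add: h_def w_def \<rho>_def min_def)
      moreover have "\<gamma> (3/2 - t) = c (2 * t - 1)"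
        using t False by (simp add: \<gamma>_def loop_concat_def rc_def algebra_simps)
      ultimately show ?thesis using False by (simp add: sl loop_concat_def)
    qed
  qed
  have H1: "H (1, x) = x" for x
  proof (cases "x \<in> open_edge e")
    case True
    obtain t where t: "0 < t" "t < 1" "x = edge_map G e t" using open_edge_edge_map[of x e G] True by blast
    have Hx: "H (s, x) = h (s, t)" for s unfolding t(3) by (rule H_edge) (use t in simp)
    show ?thesis unfolding Hx unfolding t(3) using t(1,2) by (simp add: h_def w_def \<gamma>_def loop_concat_def)
  qed (simp add: H_out)
  have "fixes_and_preserves ?X K (\<lambda>x. H (s, x))" if s: "s \<in> {0..1}" for s
  proof (rule fixes_and_preserves_supported[OF _ _ Q(3,4)])
    have oQ: "open_edge e \<subseteq> Q" using open_edge_edge_map[of _ e G] Q(1) by fastforce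
    then show "H (s, x) = x" if "x \<notin> Q" for x using that by (intro H_out) blast
    show "(\<lambda>x. H (s, x)) ` Q \<subseteq> Q"
    proof clarify
      fix x assume x: "x \<in> Q"
      show "H (s, x) \<in> Q"
      proof (cases "x \<in> open_edge e")
        case True
        obtain t where t: "0 < t" "t < 1" "x = edge_map G e t" using open_edge_edge_map[of x e G] True by blast
    have Hx: "H (s, x) = h (s, t)" for s unfolding t(3) by (rule H_edge) (use t in simp)
        show ?thesis unfolding Hx using t(1,2) by (intro hQ[OF s]) simp
      qed (simp add: H_out x)
    qed
  qed
  then show ?thesis
    unfolding proper_homotopic_with_def rc_def[symmetric]
    using H H0 H1 by (intro exI[of _ H]) auto
qed

lemma slide_mapping_class:
  assumes e: "e \<in> arcs G" and c: "pathin (graph_space G) c" "c 0 = Inl (head G e)" "c 1 = Inl (head G e)"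
    and avoid: "\<And>t. t \<in> {0..1} \<Longrightarrow> c t \<notin> open_edge e"
    and Q: "edge_map G e ` {0..1} \<subseteq> Q" "c ` {0..1} \<subseteq> Q" "connectedin (graph_space G) Q" "Q \<inter> K = {}"
  shows "proper_htpy_equiv (graph_space G) (graph_space G) (slide G e c)"
    and "mapping_class (graph_space G) (slide G e c) \<in> mcg_nbhd (graph_space G) K"
proof -
  let ?X = "graph_space G"
  let ?rc = "\<lambda>t. c (1 - t)"
  have rc: "pathin ?X ?rc" "?rc 0 = Inl (head G e)" "?rc 1 = Inl (head G e)"
    "\<And>t. t \<in> {0..1} \<Longrightarrow> ?rc t \<notin> open_edge e" "?rc ` {0..1} \<subseteq> Q"
    using c avoid Q(2) pathin_reverse[OF c(1)] by auto
  have 1: "proper_homotopic_with (fixes_and_preserves ?X K) ?X ?X (slide G e ?rc \<circ> slide G e c) id"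
    by (rule slide_reverse_slide[OF e c avoid Q])
  have 2: "proper_homotopic_with (fixes_and_preserves ?X K) ?X ?X (slide G e c \<circ> slide G e ?rc) id"
    using slide_reverse_slide[OF e rc(1-4) Q(1) rc(5) Q(3,4)] by simp
  have pc: "proper_cmap ?X ?X (slide G e d)"
    if d: "pathin ?X d" "d 0 = Inl (head G e)" "d 1 = Inl (head G e)" for d
  proof -
    let ?\<gamma> = "loop_concat (edge_map G e) d"
    have "pathin ?X ?\<gamma>" using d by (intro pathin_loop_concat pathin_edge_map[OF wf] e) auto
    then have "continuous_map (prod_topology I01 I01) ?X (?\<gamma> \<circ> snd)"
      unfolding pathin_def by (rule continuous_map_compose[OF continuous_map_snd])
    from proper_cmap_replace_edge[OF e this]
    have "proper_cmap (prod_topology I01 ?X) ?X (\<lambda>p. replace_edge e ?\<gamma> (snd p))"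
      using d by (simp add: o_def)
    from proper_cmap_slice[OF this, of 0] show ?thesis
      by (simp add: slide_def[abs_def] Hausdorff_space_subtopology)
  qed
  have fp: "fixes_and_preserves ?X K (slide G e d)"
    if d: "d ` {0..1} \<subseteq> Q" "d 0 = Inl (head G e)" "d 1 = Inl (head G e)" for d
  proof (rule fixes_and_preserves_supported[OF _ _ Q(3,4)])
    have oQ: "open_edge e \<subseteq> Q" using open_edge_edge_map[of _ e G] Q(1) by fastforce
    then show "slide G e d x = x" if "x \<notin> Q" for x
      unfolding slide_def using that by (intro replace_edge_outside) blast
    show "slide G e d ` Q \<subseteq> Q"
    proof clarify
      fix x assume x: "x \<in> Q"
      show "slide G e d x \<in> Q"
      proof (cases "x \<in> open_edge e")
        case True
        obtain t where t: "0 < t" "t < 1" "x = edge_map G e t" using open_edge_edge_map[of x e G] True by blast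
        then have "slide G e d x = loop_concat (edge_map G e) d t"
          unfolding slide_def t(3) using d by (intro replace_edge_edge_map) auto
        then show ?thesis using Q(1) d(1) t by (auto simp: loop_concat_def image_subset_iff)
      qed (simp add: x slide_def replace_edge_outside)
    qed
  qed
  have hi1: "proper_homotopic ?X ?X (slide G e ?rc \<circ> slide G e c) id"
    and hi2: "proper_homotopic ?X ?X (slide G e c \<circ> slide G e ?rc) id"
    using 1 2 by (blast intro: proper_homotopic_with_mono)+
  have pcc: "proper_cmap ?X ?X (slide G e c)" "proper_cmap ?X ?X (slide G e ?rc)"
    using pc c rc by blast+
  show phe: "proper_htpy_equiv ?X ?X (slide G e c)"
    unfolding proper_htpy_equiv_def using pcc hi1 hi2 by blast
  have phe': "proper_htpy_equiv ?X ?X (slide G e ?rc)"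
    unfolding proper_htpy_equiv_def using pcc hi1 hi2 by blast
  have "slide G e ?rc \<in> inv\<^bsub>mapping_class_group ?X\<^esub> mapping_class ?X (slide G e c)"
    using inv_mapping_class_group[OF phe phe' hi1] self_in_mapping_class[OF phe'] by simp
  then show "mapping_class ?X (slide G e c) \<in> mcg_nbhd ?X K"
    unfolding mcg_nbhd_def mem_Collect_eq
    using 1 2 phe self_in_mapping_class[OF phe] fp[OF Q(2) c(2,3)] fp[OF rc(5,2,3)]
    by (intro conjI bexI[of _ "slide G e c"] bexI[of _ "slide G e ?rc"])
      (auto simp: carrier_mapping_class_group)
qed

text \<open>
  The slide fixes the part \<open>s\<close> of the loop, so that \<open>c\<close> is picked up exactly once, at the head of \<open>e\<close>.
\<close>

lemma slide_winding_class:
  assumes e: "e \<in> arcs G" and c: "pathin (graph_space G) c" "c 0 = Inl (head G e)" "c 1 = Inl (head G e)"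
    and s: "pathin (graph_space G) s" "s 0 = Inl (head G e)" "s 1 = Inl (tail G e)"
      "\<And>t. t \<in> {0..1} \<Longrightarrow> s t \<notin> open_edge e"
  shows "winding_class (graph_space G) (slide G e c \<circ> loop_concat (edge_map G e) s) =
           winding_class (graph_space G) (loop_concat (edge_map G e) s) + winding_class (graph_space G) c"
proof -
  let ?X = "graph_space G" and ?\<epsilon> = "edge_map G e"
  have "winding_class ?X (slide G e c \<circ> loop_concat ?\<epsilon> s) = winding_class ?X (loop_concat (loop_concat ?\<epsilon> c) s)"
  proof (rule winding_class_cong)
    fix t :: real assume t: "t \<in> {0..1}"
    show "(slide G e c \<circ> loop_concat ?\<epsilon> s) t = loop_concat (loop_concat ?\<epsilon> c) s t"
    proof (cases "t \<le> 1/2")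
      case True
      then have "slide G e c (?\<epsilon> (2 * t)) = loop_concat ?\<epsilon> c (2 * t)"
        unfolding slide_def using t c by (intro replace_edge_edge_map) auto
      then show ?thesis using True by (simp add: loop_concat_def)
    next
      case False
      then have "s (2 * t - 1) \<notin> open_edge e" using t by (intro s(4)) auto
      then show ?thesis using False by (simp add: loop_concat_def slide_def replace_edge_outside)
    qed
  qed
  moreover have "pathin ?X ?\<epsilon>" "pathin ?X (loop_concat ?\<epsilon> c)"
    using c by (auto intro!: pathin_edge_map[OF wf e] pathin_loop_concat)
  ultimately show ?thesis
    using c s winding_concat[of ?X ?\<epsilon> c] winding_concat[of ?X ?\<epsilon> s] winding_concat[of ?X "loop_concat ?\<epsilon> c" s]
    by (auto simp: winding_class_def fun_eq_iff)
qed

lemma slide_winding_class_outside: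
  assumes "\<And>t. t \<in> {0..1} \<Longrightarrow> q t \<notin> open_edge e"
  shows "winding_class (graph_space G) (slide G e c \<circ> q) = winding_class (graph_space G) q"
  using assms by (intro winding_class_cong) (simp add: slide_def replace_edge_outside)

text \<open>
  Wrapping the edge \<open>e\<close> once around the circle and collapsing everything else gives a map to the
  punctured plane with respect to which the loop has winding number one.
\<close>

lemma edge_loop_winding_class_nonzero:
  assumes e: "e \<in> arcs G" and s: "pathin (graph_space G) s" "s 0 = Inl (head G e)"
    and avoid: "\<And>t. t \<in> {0..1} \<Longrightarrow> s t \<notin> open_edge e"
  shows "winding_class (graph_space G) (loop_concat (edge_map G e) s) \<noteq> 0"
proof -
  let ?X = "graph_space G"
  define \<phi> where "\<phi> = (\<lambda>x::('v, 'e) gpoint. case x of Inl v \<Rightarrow> 1 | Inr (e', t) \<Rightarrow>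
      if e' = e \<and> 0 < t \<and> t < 1 then exp (2 * of_real pi * \<i> * of_real t) else 1)"
  have \<phi>_out: "\<phi> x = 1" if "x \<notin> open_edge e" for x
    using that by (auto simp: \<phi>_def open_edge_def split: sum.splits)
  have \<phi>_e: "\<phi> (edge_map G e t) = exp (2 * of_real pi * \<i> * of_real t)" if t01: "t \<in> {0..1}" for t
  proof -
    consider "t = 0" | "t = 1" | "0 < t" "t < 1" using t01 by fastforce
    then show ?thesis by cases (auto simp: \<phi>_def)
  qed
  have "continuous_map ?X (top_of_set (- {0})) \<phi>"
  proof (rule continuous_map_graph_space[OF wf])
    show "\<phi> x \<in> topspace (top_of_set (- {0}))" for x
      by (auto simp: \<phi>_def split: sum.splits)
    fix e' assume "e' \<in> arcs G"
    have "continuous_on {0..1} (\<lambda>t. if e' = e then exp (2 * of_real pi * \<i> * of_real t) else 1 :: complex)"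
      by (cases "e' = e") (auto intro!: continuous_intros)
    then have "continuous_on {0..1} (\<lambda>t. \<phi> (edge_map G e' t))"
      by (rule continuous_on_eq) (auto simp: \<phi>_e \<phi>_out edge_map_notin_open_edge)
    moreover have "\<phi> x \<noteq> 0" for x by (auto simp: \<phi>_def split: sum.splits)
    ultimately show "continuous_map I01 (top_of_set (- {0})) (\<lambda>t. \<phi> (edge_map G e' t))" by auto
  qed
  then have \<phi>: "nonzero_map ?X \<phi>" .
  have "winding \<phi> (edge_map G e) = 1"
  proof -
    have "winding_number (\<phi> \<circ> edge_map G e) 0 = winding_number (circlepath 0 1) 0"
      by (rule winding_number_cong) (auto simp: \<phi>_e circlepath_def part_circlepath_def linepath_def algebra_simps)
    also have "\<dots> = 1" by (rule winding_number_circlepath_centre) simp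
    finally show ?thesis by (simp add: winding_def)
  qed
  moreover have "winding \<phi> s = 0"
  proof -
    have "winding_number (\<phi> \<circ> s) 0 = winding_number (linepath 1 1) 0"
      by (rule winding_number_cong) (use avoid in \<open>auto simp: \<phi>_out linepath_def\<close>)
    then show ?thesis by (simp add: winding_def)
  qed
  ultimately have "winding_class ?X (loop_concat (edge_map G e) s) \<phi> = 1"
    using winding_concat[OF pathin_edge_map[OF wf e] s(1) _ \<phi>] s(2) \<phi> by (simp add: winding_class_def)
  then show ?thesis by (metis zero_fun_apply zero_neq_one)
qed

text \<open>
  The slide of \<open>e\<close> along a loop that is freely homotopic to \<open>p'\<close>: it follows a path in \<open>D\<close> from
  the head of \<open>e\<close> to the tail of \<open>e'\<close>, then \<open>p'\<close>, and the same path back. The two runs along the path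
  cancel in homology.
\<close>

lemma linked_edges_shear:
  assumes link: "linked_edges G K e e' D"
    and s: "pathin (graph_space G) s" "s ` {0..1} \<subseteq> D" "s 0 = Inl (head G e)" "s 1 = Inl (tail G e)"
    and s': "pathin (graph_space G) s'" "s' ` {0..1} \<subseteq> D" "s' 0 = Inl (head G e')" "s' 1 = Inl (tail G e')"
  defines "p \<equiv> loop_concat (edge_map G e) s" and "p' \<equiv> loop_concat (edge_map G e') s'"
  obtains f where "proper_htpy_equiv (graph_space G) (graph_space G) f"
    "mapping_class (graph_space G) f \<in> mcg_nbhd (graph_space G) K"
    "winding_class (graph_space G) (f \<circ> p) = winding_class (graph_space G) p + winding_class (graph_space G) p'"
    "winding_class (graph_space G) (f \<circ> p') = winding_class (graph_space G) p'"
proof -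
  let ?X = "graph_space G"
  have e: "e \<in> arcs G" "e' \<in> arcs G" "e \<noteq> e'" using link by (auto simp: linked_edges_def)
  have D: "path_connectedin ?X D" "Inl (tail G e) \<in> D" "Inl (head G e) \<in> D" "Inl (tail G e') \<in> D" "Inl (head G e') \<in> D"
    "D \<inter> (open_edge e \<union> open_edge e') = {}" "(D \<union> open_edge e \<union> open_edge e') \<inter> K = {}"
    using link by (auto simp: linked_edges_def)
  obtain u where u: "pathin ?X u" "u ` {0..1} \<subseteq> D" "u 0 = Inl (head G e)" "u 1 = Inl (tail G e')"
    using D(1,3,4) unfolding path_connectedin image_subset_iff_funcset by blast
  define c where "c = loop_concat u (loop_concat p' (\<lambda>t. u (1 - t)))"
  have p': "pathin ?X p'"
    unfolding p'_def using s' by (intro pathin_loop_concat pathin_edge_map[OF wf] e) auto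
  have ru: "pathin ?X (\<lambda>t. u (1 - t))" by (rule pathin_reverse[OF u(1)])
  have c: "pathin ?X c" "c 0 = Inl (head G e)" "c 1 = Inl (head G e)"
    unfolding c_def using u p' ru s' by (auto intro!: pathin_loop_concat simp: p'_def)
  let ?R = "D \<union> open_edge e'"
  have p'R: "p' ` {0..1} \<subseteq> ?R"
    unfolding p'_def using s'(2) edge_map_range[of G e'] D(4,5) by (intro range_loop_concat) auto
  have cR: "c ` {0..1} \<subseteq> ?R"
    unfolding c_def using u(2) p'R by (intro range_loop_concat) (auto simp: image_subset_iff)
  have disj: "?R \<inter> open_edge e = {}"
    using D(6) e(3) by (auto simp: open_edge_def)
  define Q where "Q = D \<union> open_edge e \<union> open_edge e'"
  have edge_sub: "open_edge a \<subseteq> edge_map G a ` {0..1}" for a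
  proof
    fix x :: "('v, 'e) gpoint" assume "x \<in> open_edge a"
    then obtain t where t: "0 < t" "t < 1" "x = edge_map G a t" using open_edge_edge_map[of x a G] by blast
    then show "x \<in> edge_map G a ` {0..1}" by (intro image_eqI[where f = "edge_map G a", OF t(3)]) simp
  qed
  have edge_conn: "connectedin ?X (edge_map G a ` {0..1})" if "a \<in> arcs G" for a
    by (rule connectedin_continuous_map_image[OF continuous_map_edge_map[OF wf that]])
      (simp add: connectedin_subtopology)
  have end_in: "Inl (tail G a) \<in> edge_map G a ` {0..1}" for a
    by (rule image_eqI[of _ _ 0]) auto
  have "connectedin ?X (D \<union> edge_map G e ` {0..1} \<union> edge_map G e' ` {0..1})"
    using end_in[of e] end_in[of e'] D(2,4)
    by (intro connectedin_Un path_connectedin_imp_connectedin[OF D(1)] edge_conn e(1,2)) auto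
  moreover have "D \<union> edge_map G e ` {0..1} \<union> edge_map G e' ` {0..1} = Q"
  proof -
    have "edge_map G a ` {0..1} = {Inl (tail G a), Inl (head G a)} \<union> open_edge a" for a
    proof (rule equalityI[OF edge_map_range])
      have "Inl (head G a) \<in> edge_map G a ` {0..1}" by (rule image_eqI[of _ _ 1]) auto
      then show "{Inl (tail G a), Inl (head G a)} \<union> open_edge a \<subseteq> edge_map G a ` {0..1}"
        using end_in[of a] edge_sub[of a] by simp
    qed
    then show ?thesis unfolding Q_def using D(2-5) by auto
  qed
  ultimately have Q: "connectedin ?X Q" by simp
  have eQ: "edge_map G e ` {0..1} \<subseteq> Q" using edge_map_range[of G e] D unfolding Q_def by auto
  have cQ: "c ` {0..1} \<subseteq> Q" using cR unfolding Q_def by auto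
  have c_avoid: "c t \<notin> open_edge e" if "t \<in> {0..1}" for t using cR disj that by blast
  have p'_avoid: "p' t \<notin> open_edge e" if "t \<in> {0..1}" for t using p'R disj that by blast
  have s_avoid: "s t \<notin> open_edge e" if "t \<in> {0..1}" for t using s(2) D(6) that by blast
  have "winding \<phi> c = winding \<phi> p'" if "nonzero_map ?X \<phi>" for \<phi>
  proof -
    have "winding \<phi> c = winding \<phi> u + (winding \<phi> p' + winding \<phi> (\<lambda>t. u (1 - t)))"
    proof -
      have ends: "p' 0 = Inl (tail G e')" "p' 1 = Inl (tail G e')" using s' by (simp_all add: p'_def)
      have "winding \<phi> c = winding \<phi> u + winding \<phi> (loop_concat p' (\<lambda>t. u (1 - t)))"
        unfolding c_def using u(4) ends by (intro winding_concat[OF u(1) _ _ that] pathin_loop_concat p' ru) auto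
      also have "winding \<phi> (loop_concat p' (\<lambda>t. u (1 - t))) = winding \<phi> p' + winding \<phi> (\<lambda>t. u (1 - t))"
        using u(4) ends by (intro winding_concat[OF p' ru _ that]) auto
      finally show ?thesis .
    qed
    then show ?thesis using winding_reverse[OF u(1) that] by simp
  qed
  then have cp': "winding_class ?X c = winding_class ?X p'" by (auto simp: winding_class_def)
  show thesis
  proof (rule that[of "slide G e c"])
    show "proper_htpy_equiv ?X ?X (slide G e c)" "mapping_class ?X (slide G e c) \<in> mcg_nbhd ?X K"
      using slide_mapping_class[OF e(1) c c_avoid eQ cQ Q] D(7) unfolding Q_def by auto
    show "winding_class ?X (slide G e c \<circ> p) = winding_class ?X p + winding_class ?X p'"
      unfolding p_def using slide_winding_class[OF e(1) c s(1,3,4) s_avoid] by (simp add: cp')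
    show "winding_class ?X (slide G e c \<circ> p') = winding_class ?X p'"
      by (rule slide_winding_class_outside[OF p'_avoid])
  qed
qed

text \<open>
  The slides of the two edges along the loops of each other form a pair of opposite shears.
\<close>

lemma not_amenable_if_linked_edges:
  assumes link: "linked_edges G K e e' D"
    and U: "subgroup U (mapping_class_group (graph_space G))" "openin (mcg_topology G) U"
      "mcg_nbhd (graph_space G) K \<subseteq> U"
  shows "\<not> amenable (mapping_class_group (graph_space G)\<lparr>carrier := U\<rparr>) (subtopology (mcg_topology G) U)"
proof -
  let ?X = "graph_space G"
  have e: "e \<in> arcs G" "e' \<in> arcs G"
    and D: "path_connectedin ?X D" "Inl (tail G e) \<in> D" "Inl (head G e) \<in> D" "Inl (tail G e') \<in> D" "Inl (head G e') \<in> D"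
    "D \<inter> (open_edge e \<union> open_edge e') = {}"
    using link by (auto simp: linked_edges_def)
  obtain s where s: "pathin ?X s" "s ` {0..1} \<subseteq> D" "s 0 = Inl (head G e)" "s 1 = Inl (tail G e)"
    using D(1,2,3) unfolding path_connectedin image_subset_iff_funcset by blast
  obtain s' where s': "pathin ?X s'" "s' ` {0..1} \<subseteq> D" "s' 0 = Inl (head G e')" "s' 1 = Inl (tail G e')"
    using D(1,4,5) unfolding path_connectedin image_subset_iff_funcset by blast
  let ?p = "loop_concat (edge_map G e) s" and ?p' = "loop_concat (edge_map G e') s'"
  obtain f where f: "proper_htpy_equiv ?X ?X f" "mapping_class ?X f \<in> mcg_nbhd ?X K"
    "winding_class ?X (f \<circ> ?p) = winding_class ?X ?p + winding_class ?X ?p'"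
    "winding_class ?X (f \<circ> ?p') = winding_class ?X ?p'"
    by (rule linked_edges_shear[OF link s s'])
  obtain h where h: "proper_htpy_equiv ?X ?X h" "mapping_class ?X h \<in> mcg_nbhd ?X K"
    "winding_class ?X (h \<circ> ?p') = winding_class ?X ?p' + winding_class ?X ?p"
    "winding_class ?X (h \<circ> ?p) = winding_class ?X ?p"
    by (rule linked_edges_shear[OF linked_edges_sym[OF link] s' s])
  have "s t \<notin> open_edge e" "s' t \<notin> open_edge e'" if "t \<in> {0..1}" for t
    using s(2) s'(2) D(6) that by blast+
  then have nz: "winding_class ?X ?p \<noteq> 0" "winding_class ?X ?p' \<noteq> 0"
    using edge_loop_winding_class_nonzero[OF e(1) s(1,3)] edge_loop_winding_class_nonzero[OF e(2) s'(1,3)] by blast+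
  have loops: "loop_in ?X ?p" "loop_in ?X ?p'"
    using s s' by (auto simp: loop_in_def intro!: pathin_loop_concat pathin_edge_map[OF wf] e)
  show ?thesis
    using f(2) h(2) U(3)
    by (intro not_amenable_if_shearing[OF wf U(1,2) loops(1) nz(1) loops(2) nz(2) f(1) _ f(3,4) h(1) _ h(3,4)]) auto
qed

end

section \<open>Path homotopies and the fundamental group\<close>

definition path_htpy :: "'a topology \<Rightarrow> 'a \<Rightarrow> 'a \<Rightarrow> (real \<Rightarrow> 'a) \<Rightarrow> (real \<Rightarrow> 'a) \<Rightarrow> bool" where
  "path_htpy X a b = homotopic_with (\<lambda>h. h 0 = a \<and> h 1 = b) I01 X"

lemma loop_htpy_eq: "loop_htpy X x0 = path_htpy X x0 x0"
  by (simp add: loop_htpy_def path_htpy_def)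

lemma path_htpy_alt:
  "path_htpy X a b p q \<longleftrightarrow> (\<exists>h. continuous_map (prod_topology I01 I01) X h \<and>
     (\<forall>t\<in>{0..1}. h (0, t) = p t) \<and> (\<forall>t\<in>{0..1}. h (1, t) = q t) \<and>
     (\<forall>s\<in>{0..1}. h (s, 0) = a \<and> h (s, 1) = b))"
  unfolding path_htpy_def by (subst homotopic_with) auto

lemma path_htpy_refl: "pathin X p \<Longrightarrow> p 0 = a \<Longrightarrow> p 1 = b \<Longrightarrow> path_htpy X a b p p"
  by (simp add: path_htpy_def pathin_def)

lemma path_htpy_sym: "path_htpy X a b p q \<Longrightarrow> path_htpy X a b q p"
  unfolding path_htpy_def by (rule homotopic_with_symD)

lemma path_htpy_trans [trans]:
  "path_htpy X a b p q \<Longrightarrow> path_htpy X a b q r \<Longrightarrow> path_htpy X a b p r"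
  unfolding path_htpy_def by (rule homotopic_with_trans)

lemma path_htpy_imp:
  assumes "path_htpy X a b p q"
  shows "pathin X p" "pathin X q" "p 0 = a" "p 1 = b" "q 0 = a" "q 1 = b"
  using homotopic_with_imp_continuous_maps[OF assms[unfolded path_htpy_def]]
    homotopic_with_imp_property[OF assms[unfolded path_htpy_def]]
  by (auto simp: pathin_def)

text \<open>
  The source of most homotopies below: two paths that factor through a convex set with common ends
  are homotopic by straight lines.
\<close>

lemma path_htpy_in_convex:
  fixes S :: "'b::real_normed_vector set"
  assumes F: "continuous_map (top_of_set S) X F" and S: "convex S"
    and u: "continuous_on {0..1} u" "u \<in> {0..1} \<rightarrow> S" and v: "continuous_on {0..1} v" "v \<in> {0..1} \<rightarrow> S"
    and ends: "v 0 = u 0" "v 1 = u 1"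
    and p: "\<And>t. t \<in> {0..1} \<Longrightarrow> p t = F (u t)" and q: "\<And>t. t \<in> {0..1} \<Longrightarrow> q t = F (v t)"
  shows "path_htpy X (p 0) (p 1) p q"
  unfolding path_htpy_alt
proof (intro exI[of _ "F \<circ> (\<lambda>z. (1 - fst z) *\<^sub>R u (snd z) + fst z *\<^sub>R v (snd z))"] conjI ballI)
  have "continuous_on ({0..1} \<times> {0..1}) (\<lambda>z. (1 - fst z) *\<^sub>R u (snd z) + fst z *\<^sub>R v (snd z))"
    by (intro continuous_intros continuous_on_compose2[OF u(1)] continuous_on_compose2[OF v(1)]) auto
  moreover have "(1 - s) *\<^sub>R u t + s *\<^sub>R v t \<in> S" if "s \<in> {0..1}" "t \<in> {0..1}" for s t
    using that u(2) v(2) by (intro convexD[OF S]) auto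
  ultimately have "continuous_map (prod_topology I01 I01) (top_of_set S)
      (\<lambda>z. (1 - fst z) *\<^sub>R u (snd z) + fst z *\<^sub>R v (snd z))" by auto
  then show "continuous_map (prod_topology I01 I01) X
      (F \<circ> (\<lambda>z. (1 - fst z) *\<^sub>R u (snd z) + fst z *\<^sub>R v (snd z)))"
    using F by (rule continuous_map_compose)
qed (use ends p q in \<open>auto simp: algebra_simps simp flip: scaleR_left.add\<close>)

lemma path_htpy_reparam:
  assumes "pathin X p" "continuous_on {0..1} u" "u \<in> {0..1} \<rightarrow> {0..1::real}"
    "continuous_on {0..1} v" "v \<in> {0..1} \<rightarrow> {0..1}" "v 0 = u 0" "v 1 = u 1"
    and "\<And>t. t \<in> {0..1} \<Longrightarrow> q t = p (u t)" "\<And>t. t \<in> {0..1} \<Longrightarrow> r t = p (v t)"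
  shows "path_htpy X (q 0) (q 1) q r"
  using assms by (intro path_htpy_in_convex[of "{0..1}" X p u v]) (auto simp: pathin_def)

lemma path_htpy_concat:
  assumes p: "path_htpy X a b p p'" and q: "path_htpy X b c q q'"
  shows "path_htpy X a c (loop_concat p q) (loop_concat p' q')"
proof -
  obtain h where h: "continuous_map (prod_topology I01 I01) X h"
    "\<forall>t\<in>{0..1}. h (0, t) = p t" "\<forall>t\<in>{0..1}. h (1, t) = p' t" "\<forall>s\<in>{0..1}. h (s, 0) = a \<and> h (s, 1) = b"
    using p unfolding path_htpy_alt by blast
  obtain k where k: "continuous_map (prod_topology I01 I01) X k"
    "\<forall>t\<in>{0..1}. k (0, t) = q t" "\<forall>t\<in>{0..1}. k (1, t) = q' t" "\<forall>s\<in>{0..1}. k (s, 0) = b \<and> k (s, 1) = c"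
    using q unfolding path_htpy_alt by blast
  define F where "F = (\<lambda>z. h (fst z, 2 * snd z))"
  define K where "K = (\<lambda>z. k (fst z, 2 * snd z - 1))"
  define m where "m = (\<lambda>z::real \<times> real. if snd z \<le> 1/2 then F z else K z)"
  have half: "continuous_map (top_of_set ({0..1} \<times> S)) X (\<lambda>z. f (fst z, w (snd z)))"
    if f: "continuous_map (prod_topology I01 I01) X f" and w: "continuous_on S w" "w ` S \<subseteq> {0..1}"
    for f S and w :: "real \<Rightarrow> real"
  proof -
    have "continuous_on ({0..1} \<times> S) (\<lambda>z. (fst z :: real, w (snd z)))"
      by (intro continuous_intros continuous_on_compose2[OF w(1)]) auto
    then have "continuous_map (top_of_set ({0..1} \<times> S)) (prod_topology I01 I01) (\<lambda>z. (fst z, w (snd z)))"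
      using w(2) by auto
    from continuous_map_compose[OF this f] show ?thesis by (simp add: o_def)
  qed
  have "continuous_map (top_of_set ({0..1} \<times> {0..1})) X m"
  proof (rule pasting_lemma_closed[where I = "UNIV::bool set" and f = "\<lambda>b. if b then F else K"
        and T = "\<lambda>b. if b then {0..1} \<times> {0..1/2} else {0..1} \<times> {1/2..1}"])
    show "closedin (top_of_set ({0..1} \<times> {0..1})) (if b then {0..1} \<times> {0..1/2} else {0..1::real} \<times> {1/2..1::real})" for b
      by (auto intro!: closed_subset closed_Times)
    have sub: "({0..1} \<times> {0..1}) \<inter> ({0..1} \<times> {0..1/2}) = {0..1::real} \<times> {0..1/2::real}"
      "({0..1} \<times> {0..1}) \<inter> ({0..1} \<times> {1/2..1}) = {0..1::real} \<times> {1/2..1::real}" by auto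
    show "continuous_map (subtopology (top_of_set ({0..1} \<times> {0..1}))
        (if b then {0..1} \<times> {0..1/2} else {0..1} \<times> {1/2..1})) X (if b then F else K)" for b
    proof -
      have "continuous_map (top_of_set ({0..1} \<times> {0..1/2})) X F"
        unfolding F_def by (rule half[OF h(1)]) (auto intro!: continuous_intros)
      moreover have "continuous_map (top_of_set ({0..1} \<times> {1/2..1})) X K"
        unfolding K_def by (rule half[OF k(1)]) (auto intro!: continuous_intros)
      ultimately show ?thesis by (cases b) (simp_all add: subtopology_subtopology sub)
    qed
    show "(if i then F else K) z = (if j then F else K) z"
      if z: "z \<in> topspace (top_of_set ({0..1} \<times> {0..1})) \<inter>
        (if i then {0..1} \<times> {0..1/2} else {0..1} \<times> {1/2..1}) \<inter>
        (if j then {0..1} \<times> {0..1/2} else {0..1} \<times> {1/2..1})" for i j z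
    proof (cases "i = j")
      case False
      then have "snd z = 1/2" "fst z \<in> {0..1}" using z by (cases i; cases j; auto)+
      then have "F z = K z" unfolding F_def K_def \<open>snd z = 1/2\<close> using h(4) k(4) by simp
      then show ?thesis by simp
    qed simp
    show "\<exists>j. j \<in> UNIV \<and> z \<in> (if j then {0..1} \<times> {0..1/2} else {0..1} \<times> {1/2..1}) \<and> m z = (if j then F else K) z"
      if "z \<in> topspace (top_of_set ({0..1} \<times> {0..1}))" for z
      using that by (intro exI[of _ "snd z \<le> 1/2"]) (auto simp: m_def)
  qed simp
  then show ?thesis
    unfolding path_htpy_alt
    by (intro exI[of _ m]) (use h k in \<open>auto simp: m_def F_def K_def loop_concat_def\<close>)
qed

abbreviation (input) rev_path :: "(real \<Rightarrow> 'a) \<Rightarrow> real \<Rightarrow> 'a" where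
  "rev_path p \<equiv> \<lambda>t. p (1 - t)"

lemma path_htpy_assoc:
  assumes "pathin X p" "pathin X q" "pathin X r" "p 1 = q 0" "q 1 = r 0"
  shows "path_htpy X (p 0) (r 1) (loop_concat (loop_concat p q) r) (loop_concat p (loop_concat q r))"
proof -
  have "path_htpy X (loop_concat (loop_concat p q) r 0) (loop_concat (loop_concat p q) r 1)
      (loop_concat (loop_concat p q) r) (loop_concat p (loop_concat q r))"
  proof (rule path_htpy_reparam[where u = "\<lambda>t. t" and v = "\<lambda>t. max (t / 2) (max (t - 1/4) (2 * t - 1))"])
    show "pathin X (loop_concat (loop_concat p q) r)"
      using assms by (intro pathin_loop_concat) auto
    show "loop_concat p (loop_concat q r) t = loop_concat (loop_concat p q) r (max (t / 2) (max (t - 1/4) (2 * t - 1)))"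
      if "t \<in> {0..1}" for t
    proof -
      consider "t \<le> 1/2" | "1/2 < t" "t \<le> 3/4" | "3/4 < t" by linarith
      then show ?thesis
      proof cases
        case 1
        then have "max (t / 2) (max (t - 1/4) (2 * t - 1)) = t / 2" by (auto simp: max_def)
        then show ?thesis using 1 by (simp add: loop_concat_def)
      next
        case 2
        then have m: "max (t / 2) (max (t - 1/4) (2 * t - 1)) = t - 1/4" by (auto simp: max_def)
        show ?thesis unfolding m using 2 by (simp add: loop_concat_def algebra_simps)
      next
        case 3
        then have m: "max (t / 2) (max (t - 1/4) (2 * t - 1)) = 2 * t - 1" by (auto simp: max_def)
        show ?thesis unfolding m using 3 by (simp add: loop_concat_def algebra_simps)
      qed
    qed
    show "continuous_on {0..1} (\<lambda>t::real. max (t / 2) (max (t - 1/4) (2 * t - 1)))"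
      by (intro continuous_intros) auto
    show "continuous_on {0..1} (\<lambda>t::real. t)" by (intro continuous_intros)
    show "(\<lambda>t::real. max (t / 2) (max (t - 1/4) (2 * t - 1))) \<in> {0..1} \<rightarrow> {0..1}"
    proof
      fix t :: real assume t: "t \<in> {0..1}"
      have "0 \<le> t / 2" using t by simp
      also have "t / 2 \<le> max (t / 2) (max (t - 1/4) (2 * t - 1))" by (rule max.cobounded1)
      finally have "0 \<le> max (t / 2) (max (t - 1/4) (2 * t - 1))" .
      moreover have "max (t / 2) (max (t - 1/4) (2 * t - 1)) \<le> 1"
        using t by (intro max.boundedI) auto
      ultimately show "max (t / 2) (max (t - 1/4) (2 * t - 1)) \<in> {0..1}" by simp
    qed
  qed simp_all
  then show ?thesis by simp
qed

lemma path_htpy_unit_left: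
  assumes "pathin X p"
  shows "path_htpy X (p 0) (p 1) (loop_concat (\<lambda>_. p 0) p) p"
proof -
  have "path_htpy X (loop_concat (\<lambda>_. p 0) p 0) (loop_concat (\<lambda>_. p 0) p 1) (loop_concat (\<lambda>_. p 0) p) p"
  proof (rule path_htpy_reparam[OF assms, of "\<lambda>t. max 0 (2 * t - 1)" "\<lambda>t. t"])
    show "loop_concat (\<lambda>_. p 0) p t = p (max 0 (2 * t - 1))" for t
      by (cases "t \<le> 1/2") (auto simp: loop_concat_def)
    show "continuous_on {0..1} (\<lambda>t::real. max 0 (2 * t - 1))" by (intro continuous_intros)
    show "continuous_on {0..1} (\<lambda>t::real. t)" by (intro continuous_intros)
  qed auto
  then show ?thesis by simp
qed

lemma path_htpy_inverse:
  assumes "pathin X p"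
  shows "path_htpy X (p 0) (p 0) (loop_concat p (rev_path p)) (\<lambda>_. p 0)"
proof -
  have "path_htpy X (loop_concat p (rev_path p) 0) (loop_concat p (rev_path p) 1)
      (loop_concat p (rev_path p)) (\<lambda>_. p 0)"
  proof (rule path_htpy_reparam[OF assms, of "\<lambda>t. min (2 * t) (2 - 2 * t)" "\<lambda>t. 0"])
    show "loop_concat p (rev_path p) t = p (min (2 * t) (2 - 2 * t))" for t
      by (cases "t \<le> 1/2") (auto simp: loop_concat_def algebra_simps)
    show "continuous_on {0..1} (\<lambda>t::real. min (2 * t) (2 - 2 * t))" by (intro continuous_intros)
    show "continuous_on {0..1} (\<lambda>t::real. 0 :: real)" by (intro continuous_intros)
    show "p 0 = p ((\<lambda>t. 0) t)" for t :: real by simp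
  qed auto
  then show ?thesis by simp
qed

lemma path_htpy_cancel_left:
  assumes p: "pathin X p" and q: "pathin X q" and pq: "p 1 = q 0"
  shows "path_htpy X (p 1) (q 1) (loop_concat (rev_path p) (loop_concat p q)) q"
proof -
  have rp: "pathin X (rev_path p)" by (rule pathin_reverse[OF p])
  have "path_htpy X (p 1) (q 1) (loop_concat (rev_path p) (loop_concat p q)) (loop_concat (loop_concat (rev_path p) p) q)"
    using path_htpy_sym[OF path_htpy_assoc[OF rp p q _ pq]] by simp
  also have "path_htpy X (p 1) (q 1) (loop_concat (loop_concat (rev_path p) p) q) (loop_concat (\<lambda>_. q 0) q)"
  proof (rule path_htpy_concat)
    show "path_htpy X (p 1) (p 1) (loop_concat (rev_path p) p) (\<lambda>_. q 0)"
      using path_htpy_inverse[OF rp] pq by simp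
    show "path_htpy X (p 1) (q 1) q q" using pq by (intro path_htpy_refl q) auto
  qed
  also have "path_htpy X (p 1) (q 1) (loop_concat (\<lambda>_. q 0) q) q"
    using path_htpy_unit_left[OF q] pq by simp
  finally show ?thesis .
qed

definition loop_class :: "'a topology \<Rightarrow> 'a \<Rightarrow> (real \<Rightarrow> 'a) \<Rightarrow> (real \<Rightarrow> 'a) set" where
  "loop_class X x p = {q \<in> loops_at X x. path_htpy X x x p q}"

lemma loops_at_iff: "p \<in> loops_at X x \<longleftrightarrow> path_htpy X x x p p"
  using path_htpy_imp[of X x x p p] path_htpy_refl[of X p x x] by (auto simp: loops_at_def)

lemma loop_class_eq_iff:
  assumes "p \<in> loops_at X x" "q \<in> loops_at X x"
  shows "loop_class X x p = loop_class X x q \<longleftrightarrow> path_htpy X x x p q"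
proof
  assume "loop_class X x p = loop_class X x q"
  moreover have "q \<in> loop_class X x q" using assms by (simp add: loop_class_def loops_at_iff)
  ultimately show "path_htpy X x x p q" by (auto simp: loop_class_def)
next
  assume "path_htpy X x x p q"
  then show "loop_class X x p = loop_class X x q"
    unfolding loop_class_def by (blast intro: path_htpy_trans path_htpy_sym)
qed

lemma carrier_fundamental_group:
  "carrier (fundamental_group X x) = loop_class X x ` loops_at X x"
  by (auto simp: fundamental_group_def quotient_def loop_class_def loop_htpy_eq)

lemma one_fundamental_group: "\<one>\<^bsub>fundamental_group X x\<^esub> = loop_class X x (\<lambda>_. x)"
  by (simp add: fundamental_group_def loop_class_def loop_htpy_eq)

lemma loops_at_concat: "p \<in> loops_at X x \<Longrightarrow> q \<in> loops_at X x \<Longrightarrow> loop_concat p q \<in> loops_at X x"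
  by (simp add: loops_at_def pathin_loop_concat)

lemma loops_at_reverse: "p \<in> loops_at X x \<Longrightarrow> rev_path p \<in> loops_at X x"
  by (simp add: loops_at_def pathin_reverse)

lemma mult_fundamental_group:
  assumes p: "p \<in> loops_at X x" and q: "q \<in> loops_at X x"
  shows "loop_class X x p \<otimes>\<^bsub>fundamental_group X x\<^esub> loop_class X x q = loop_class X x (loop_concat p q)"
proof -
  have "(\<exists>p'\<in>loop_class X x p. \<exists>q'\<in>loop_class X x q. path_htpy X x x (loop_concat p' q') r) \<longleftrightarrow>
      path_htpy X x x (loop_concat p q) r" (is "?L \<longleftrightarrow> ?R") for r
  proof
    assume ?L
    then obtain p' q' where "path_htpy X x x p p'" "path_htpy X x x q q'" "path_htpy X x x (loop_concat p' q') r"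
      by (auto simp: loop_class_def)
    then show ?R by (blast intro: path_htpy_trans path_htpy_concat)
  next
    assume ?R
    moreover have "p \<in> loop_class X x p" "q \<in> loop_class X x q"
      using p q by (simp_all add: loop_class_def loops_at_iff)
    ultimately show ?L by blast
  qed
  then show ?thesis
    by (simp add: fundamental_group_def loop_class_def loop_htpy_eq)
qed

lemma group_fundamental_group:
  assumes x: "x \<in> topspace X"
  shows "group (fundamental_group X x)"
proof (rule groupI)
  let ?G = "fundamental_group X x"
  have c: "(\<lambda>_. x) \<in> loops_at X x" using x by (simp add: loops_at_def)
  then show "\<one>\<^bsub>?G\<^esub> \<in> carrier ?G" by (simp add: carrier_fundamental_group one_fundamental_group)
  fix A assume "A \<in> carrier ?G"
  then obtain p where p: "p \<in> loops_at X x" "A = loop_class X x p" by (auto simp: carrier_fundamental_group)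
  then have pp: "pathin X p" "p 0 = x" "p 1 = x" by (auto simp: loops_at_def)
  show "\<one>\<^bsub>?G\<^esub> \<otimes>\<^bsub>?G\<^esub> A = A"
    using path_htpy_unit_left[OF pp(1)] p c pp
    by (simp add: one_fundamental_group mult_fundamental_group loop_class_eq_iff loops_at_concat)
  have "loop_class X x (rev_path p) \<otimes>\<^bsub>?G\<^esub> A = \<one>\<^bsub>?G\<^esub>"
    using path_htpy_inverse[OF pathin_reverse[OF pp(1)]] p c pp
    by (simp add: one_fundamental_group mult_fundamental_group loop_class_eq_iff loops_at_concat loops_at_reverse)
  then show "\<exists>B\<in>carrier ?G. B \<otimes>\<^bsub>?G\<^esub> A = \<one>\<^bsub>?G\<^esub>"
    using loops_at_reverse[OF p(1)] by (auto simp: carrier_fundamental_group)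
  fix B assume "B \<in> carrier ?G"
  then obtain q where q: "q \<in> loops_at X x" "B = loop_class X x q" by (auto simp: carrier_fundamental_group)
  show "A \<otimes>\<^bsub>?G\<^esub> B \<in> carrier ?G"
    using p q by (simp add: mult_fundamental_group carrier_fundamental_group loops_at_concat)
  fix C assume "C \<in> carrier ?G"
  then obtain r where r: "r \<in> loops_at X x" "C = loop_class X x r" by (auto simp: carrier_fundamental_group)
  show "A \<otimes>\<^bsub>?G\<^esub> B \<otimes>\<^bsub>?G\<^esub> C = A \<otimes>\<^bsub>?G\<^esub> (B \<otimes>\<^bsub>?G\<^esub> C)"
    using path_htpy_assoc[of X p q r] p q r
    by (simp add: mult_fundamental_group loops_at_concat loop_class_eq_iff) (simp add: loops_at_def)
qed

section \<open>Holonomy along a frame of paths\<close>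

text \<open>
  A choice of a path \<open>\<delta> x\<close> from the base point to every point \<open>x\<close>. It turns an arbitrary path into
  an element of the fundamental group, its holonomy, in a multiplicative way, and so makes it possible
  to compute in the fundamental groupoid while staying inside one group.
\<close>

locale path_frame =
  fixes X :: "'a topology" and x0 :: 'a and \<delta> :: "'a \<Rightarrow> real \<Rightarrow> 'a"
  assumes base: "x0 \<in> topspace X"
    and frame: "\<And>x. x \<in> topspace X \<Longrightarrow> pathin X (\<delta> x) \<and> \<delta> x 0 = x0 \<and> \<delta> x 1 = x"
begin

abbreviation \<pi>1 where "\<pi>1 \<equiv> fundamental_group X x0"

sublocale group \<pi>1
  by (rule group_fundamental_group[OF base])

definition holonomy_loop :: "(real \<Rightarrow> 'a) \<Rightarrow> real \<Rightarrow> 'a" where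
  "holonomy_loop q = loop_concat (loop_concat (\<delta> (q 0)) q) (rev_path (\<delta> (q 1)))"

definition holonomy :: "(real \<Rightarrow> 'a) \<Rightarrow> (real \<Rightarrow> 'a) set" where
  "holonomy q = loop_class X x0 (holonomy_loop q)"

lemma path_ends:
  assumes "pathin X q"
  shows "q 0 \<in> topspace X" "q 1 \<in> topspace X"
  using path_start_in_topspace[OF assms] path_finish_in_topspace[OF assms] by auto

lemma holonomy_loop_in:
  assumes q: "pathin X q"
  shows "holonomy_loop q \<in> loops_at X x0"
  using frame[OF path_ends(1)[OF q]] frame[OF path_ends(2)[OF q]] q
  by (auto simp: holonomy_loop_def loops_at_def intro!: pathin_loop_concat pathin_reverse)

lemma holonomy_in_carrier: "pathin X q \<Longrightarrow> holonomy q \<in> carrier \<pi>1"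
  using holonomy_loop_in by (auto simp: holonomy_def carrier_fundamental_group)

lemma holonomy_htpy:
  assumes "path_htpy X a b q r"
  shows "holonomy q = holonomy r"
proof -
  note qr = path_htpy_imp[OF assms]
  have a: "a \<in> topspace X" "b \<in> topspace X" using path_ends[OF qr(1)] qr by auto
  have "path_htpy X x0 x0 (holonomy_loop q) (holonomy_loop r)"
    unfolding holonomy_loop_def qr
    using frame[OF a(1)] frame[OF a(2)]
    by (intro path_htpy_concat[where b = b] path_htpy_concat[where b = a] assms path_htpy_refl pathin_reverse) auto
  then show ?thesis
    unfolding holonomy_def using loop_class_eq_iff[OF holonomy_loop_in[OF qr(1)] holonomy_loop_in[OF qr(2)]] by simp
qed

lemma holonomy_concat:
  assumes q: "pathin X q" and r: "pathin X r" and qr: "q 1 = r 0"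
  shows "holonomy (loop_concat q r) = holonomy q \<otimes>\<^bsub>\<pi>1\<^esub> holonomy r"
proof -
  let ?z = "q 1"
  define A where "A = loop_concat (\<delta> (q 0)) q"
  define B where "B = \<delta> ?z"
  define C' where "C' = rev_path (\<delta> (r 1))"
  have fq: "pathin X (\<delta> (q 0))" "\<delta> (q 0) 0 = x0" "\<delta> (q 0) 1 = q 0" using frame path_ends[OF q] by auto
  have B: "pathin X B" "B 0 = x0" "B 1 = ?z" using frame path_ends[OF q] by (auto simp: B_def)
  have C': "pathin X C'" "C' 0 = r 1" "C' 1 = x0"
    using frame path_ends[OF r] pathin_reverse by (auto simp: C'_def)
  have A: "pathin X A" "A 0 = x0" "A 1 = ?z"
    using fq q by (auto simp: A_def intro!: pathin_loop_concat)
  have rB: "pathin X (rev_path B)" by (rule pathin_reverse[OF B(1)])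
  have Br: "pathin X (loop_concat B r)" using B r qr by (intro pathin_loop_concat) auto
  have rC: "pathin X (loop_concat r C')" using r C' by (intro pathin_loop_concat) auto
  have BrC: "pathin X (loop_concat (loop_concat B r) C')" by (rule pathin_loop_concat[OF Br C'(1)]) (use C' in simp)
  have H: "path_htpy X x0 x0 (loop_concat (loop_concat A (rev_path B)) (loop_concat (loop_concat B r) C'))
      (loop_concat A (loop_concat (rev_path B) (loop_concat (loop_concat B r) C')))"
    using path_htpy_assoc[OF A(1) rB BrC] A B C' by simp
  also have "path_htpy X x0 x0 \<dots> (loop_concat A (loop_concat r C'))"
  proof (rule path_htpy_concat[where b = ?z])
    show "path_htpy X x0 ?z A A" using A by (intro path_htpy_refl) auto
    have "path_htpy X ?z x0 (loop_concat (rev_path B) (loop_concat (loop_concat B r) C'))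
        (loop_concat (rev_path B) (loop_concat B (loop_concat r C')))"
    proof (rule path_htpy_concat[where b = x0])
      show "path_htpy X ?z x0 (rev_path B) (rev_path B)" using rB B by (intro path_htpy_refl) auto
      show "path_htpy X x0 x0 (loop_concat (loop_concat B r) C') (loop_concat B (loop_concat r C'))"
        using path_htpy_assoc[OF B(1) r C'(1)] B C' qr by simp
    qed
    also have "path_htpy X ?z x0 \<dots> (loop_concat r C')"
      using path_htpy_cancel_left[OF B(1) rC] B C' qr by simp
    finally show "path_htpy X ?z x0 (loop_concat (rev_path B) (loop_concat (loop_concat B r) C')) (loop_concat r C')" .
  qed
  also have "path_htpy X x0 x0 \<dots> (loop_concat (loop_concat A r) C')"
    using path_htpy_sym[OF path_htpy_assoc[OF A(1) r C'(1)]] A C' qr by simp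
  also have "path_htpy X x0 x0 \<dots> (loop_concat (loop_concat (\<delta> (q 0)) (loop_concat q r)) C')"
  proof (rule path_htpy_concat[where b = "r 1"])
    show "path_htpy X x0 (r 1) (loop_concat A r) (loop_concat (\<delta> (q 0)) (loop_concat q r))"
      unfolding A_def using path_htpy_assoc[OF fq(1) q r] fq qr by simp
    show "path_htpy X (r 1) x0 C' C'" using C' by (intro path_htpy_refl) auto
  qed
  finally have "path_htpy X x0 x0 (loop_concat (holonomy_loop q) (holonomy_loop r)) (holonomy_loop (loop_concat q r))"
    by (simp add: holonomy_loop_def A_def B_def C'_def qr)
  then show ?thesis
    unfolding holonomy_def
    using holonomy_loop_in[OF q] holonomy_loop_in[OF r] holonomy_loop_in[OF pathin_loop_concat[OF q r qr]]
    by (simp add: mult_fundamental_group loops_at_concat loop_class_eq_iff path_htpy_sym)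
qed

lemma holonomy_const:
  assumes "x \<in> topspace X"
  shows "holonomy (\<lambda>_. x) = \<one>\<^bsub>\<pi>1\<^esub>"
proof -
  have "pathin X (\<lambda>_. x)" using assms by simp
  moreover have "loop_concat (\<lambda>_. x) (\<lambda>_. x) = (\<lambda>_. x)" by (auto simp: loop_concat_def)
  ultimately have "holonomy (\<lambda>_. x) \<otimes>\<^bsub>\<pi>1\<^esub> holonomy (\<lambda>_. x) = holonomy (\<lambda>_. x)"
    using holonomy_concat[of "\<lambda>_. x" "\<lambda>_. x"] by simp
  then show ?thesis
    using holonomy_in_carrier[OF \<open>pathin X (\<lambda>_. x)\<close>] by simp
qed

lemma holonomy_reverse:
  assumes q: "pathin X q"
  shows "holonomy (rev_path q) = inv\<^bsub>\<pi>1\<^esub> holonomy q"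
proof -
  have rq: "pathin X (rev_path q)" by (rule pathin_reverse[OF q])
  have "holonomy (rev_path q) \<otimes>\<^bsub>\<pi>1\<^esub> holonomy q = holonomy (loop_concat (rev_path q) q)"
    using holonomy_concat[OF rq q] by simp
  also have "\<dots> = holonomy (\<lambda>_. q 1)"
    using path_htpy_inverse[OF rq] by (intro holonomy_htpy[where a = "q 1" and b = "q 1"]) simp
  also have "\<dots> = \<one>\<^bsub>\<pi>1\<^esub>" by (rule holonomy_const[OF path_ends(2)[OF q]])
  finally show ?thesis
    using holonomy_in_carrier[OF q] holonomy_in_carrier[OF rq] by (metis inv_equality)
qed

lemma const_loop: "(\<lambda>_. x0) \<in> loops_at X x0"
  using base by (simp add: loops_at_def)

text \<open>
  The loop defining the holonomy runs through \<open>\<delta> (q 1)\<close> and straight back.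
\<close>

lemma holonomy_frame_extension:
  assumes q: "pathin X q" and ext: "\<delta> (q 1) = loop_concat (\<delta> (q 0)) q"
  shows "holonomy q = \<one>\<^bsub>\<pi>1\<^esub>"
proof -
  define d where "d = \<delta> (q 1)"
  have d: "pathin X d" "d 0 = x0"
    unfolding d_def using frame[OF path_ends(2)[OF q]] by blast+
  have hl: "holonomy_loop q = loop_concat d (rev_path d)"
    unfolding holonomy_loop_def d_def ext[symmetric] by (rule refl)
  have "path_htpy X x0 x0 (holonomy_loop q) (\<lambda>_. x0)"
    unfolding hl using path_htpy_inverse[OF d(1)] unfolding d(2) .
  then show ?thesis
    unfolding holonomy_def one_fundamental_group
    by (rule loop_class_eq_iff[OF holonomy_loop_in[OF q] const_loop, THEN iffD2])
qed

text \<open>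
  The holonomy of a loop at the base point is its conjugate by the class of the loop \<open>\<delta> x0\<close>, so
  every element of the fundamental group is a holonomy.
\<close>

lemma subgroup_full_if_holonomy:
  assumes S: "S \<subseteq> carrier \<pi>1" and hol: "\<And>q. pathin X q \<Longrightarrow> holonomy q \<in> S"
  shows "S = carrier \<pi>1"
proof
  show "carrier \<pi>1 \<subseteq> S"
  proof
    fix g assume g: "g \<in> carrier \<pi>1"
    have d: "\<delta> x0 \<in> loops_at X x0" using frame[OF base] by (simp add: loops_at_def)
    define D where "D = loop_class X x0 (\<delta> x0)"
    have D: "D \<in> carrier \<pi>1" "inv\<^bsub>\<pi>1\<^esub> D = loop_class X x0 (rev_path (\<delta> x0))"
    proof -
      show D: "D \<in> carrier \<pi>1" using d by (auto simp: D_def carrier_fundamental_group)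
      have "path_htpy X x0 x0 (loop_concat (rev_path (\<delta> x0)) (\<delta> x0)) (\<lambda>_. x0)"
        using path_htpy_inverse[OF pathin_reverse[of X "\<delta> x0"]] frame[OF base] by simp
      then have "loop_class X x0 (rev_path (\<delta> x0)) \<otimes>\<^bsub>\<pi>1\<^esub> D = \<one>\<^bsub>\<pi>1\<^esub>"
        using loops_at_reverse[OF d] d const_loop
        by (simp add: D_def mult_fundamental_group one_fundamental_group loop_class_eq_iff loops_at_concat)
      then show "inv\<^bsub>\<pi>1\<^esub> D = loop_class X x0 (rev_path (\<delta> x0))"
        using D loops_at_reverse[OF d] by (intro inv_equality) (auto simp: carrier_fundamental_group)
    qed
    have "inv\<^bsub>\<pi>1\<^esub> D \<otimes>\<^bsub>\<pi>1\<^esub> g \<otimes>\<^bsub>\<pi>1\<^esub> D \<in> carrier \<pi>1" using D(1) g by simp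
    then obtain p where p: "p \<in> loops_at X x0" "inv\<^bsub>\<pi>1\<^esub> D \<otimes>\<^bsub>\<pi>1\<^esub> g \<otimes>\<^bsub>\<pi>1\<^esub> D = loop_class X x0 p"
      by (auto simp: carrier_fundamental_group)
    have p01: "pathin X p" "p 0 = x0" "p 1 = x0" using p by (auto simp: loops_at_def)
    have "holonomy p = D \<otimes>\<^bsub>\<pi>1\<^esub> loop_class X x0 p \<otimes>\<^bsub>\<pi>1\<^esub> inv\<^bsub>\<pi>1\<^esub> D"
      unfolding holonomy_def holonomy_loop_def D(2) p01 using d p loops_at_reverse[OF d]
      by (simp add: D_def mult_fundamental_group loops_at_concat)
    also have "\<dots> = g"
    proof -
      have "D \<otimes>\<^bsub>\<pi>1\<^esub> loop_class X x0 p = g \<otimes>\<^bsub>\<pi>1\<^esub> D"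
        unfolding p(2)[symmetric] using D(1) g by (simp add: m_assoc[symmetric])
      then show ?thesis using D(1) g by (simp add: m_assoc)
    qed
    finally show "g \<in> S" using hol[OF p01(1)] by simp
  qed
qed (rule S)

end

section \<open>Holonomy in a graph\<close>

lemma path_htpy_subdivide:
  assumes p: "pathin X p" and abc: "a \<in> {0..1}" "b \<in> {0..1}" "c \<in> {0..1}"
  shows "path_htpy X (p a) (p c)
    (loop_concat (\<lambda>r. p (linepath a b r)) (\<lambda>r. p (linepath b c r))) (\<lambda>r. p (linepath a c r))"
proof -
  have line: "pathin I01 (linepath x y)" if "x \<in> {0..1}" "y \<in> {0..1}" for x y :: real
  proof -
    have "linepath x y ` {0..1} \<subseteq> {0..1}"
      using that closed_segment_subset[of x "{0..1}" y] by (simp add: linepath_image_01)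
    then show ?thesis by (auto simp: pathin_def)
  qed
  have u: "pathin I01 (loop_concat (linepath a b) (linepath b c))"
    using abc by (intro pathin_loop_concat line) (auto simp: linepath_def)
  have v: "pathin I01 (linepath a c)" using abc by (intro line)
  let ?L = "loop_concat (\<lambda>r. p (linepath a b r)) (\<lambda>r. p (linepath b c r))" and ?R = "\<lambda>r. p (linepath a c r)"
  have "path_htpy X (?L 0) (?L 1) ?L ?R"
    by (rule path_htpy_reparam[OF p, of "loop_concat (linepath a b) (linepath b c)" "linepath a c"])
      (use u v in \<open>auto simp: pathin_def loop_concat_def linepath_def\<close>)
  then show ?thesis by (simp add: linepath_def)
qed

text \<open>
  A homotopy of the whole graph that keeps the vertices fixed and moves the points of every edge
  linearly from \<open>t\<close> to \<open>\<omega> t\<close>. If \<open>\<omega>\<close> is locally constant near some parameters, the homotopy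
  contracts the corresponding part of the graph; this provides local contractions that are globally
  defined, so that their continuity needs to be shown only once.
\<close>

definition squeeze :: "('v, 'e) pre_digraph \<Rightarrow> (real \<Rightarrow> real) \<Rightarrow> real \<times> ('v, 'e) gpoint \<Rightarrow> ('v, 'e) gpoint" where
  "squeeze G \<omega> z = (case snd z of Inl v \<Rightarrow> Inl v
     | Inr (e, t) \<Rightarrow> edge_map G e ((1 - fst z) * t + fst z * \<omega> t))"

definition squeezing :: "(real \<Rightarrow> real) \<Rightarrow> bool" where
  "squeezing \<omega> \<longleftrightarrow> continuous_on {0..1} \<omega> \<and> \<omega> \<in> {0..1} \<rightarrow> {0..1} \<and> \<omega> 0 = 0 \<and> \<omega> 1 = 1"

lemma squeeze_edge_map:
  assumes "squeezing \<omega>" "t \<in> {0..1}"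
  shows "squeeze G \<omega> (s, edge_map G e t) = edge_map G e ((1 - s) * t + s * \<omega> t)"
proof -
  consider "t = 0" | "t = 1" | "0 < t" "t < 1" using assms(2) by fastforce
  then show ?thesis using assms(1) by cases (auto simp: squeeze_def squeezing_def)
qed

lemma squeeze_param:
  assumes "squeezing \<omega>" "s \<in> {0..1}" "t \<in> {0..1}"
  shows "(1 - s) * t + s * \<omega> t \<in> {0..1}"
proof -
  have w: "\<omega> t \<in> {0..1}" using assms by (auto simp: squeezing_def)
  have "(1 - s) * t + s * \<omega> t \<le> (1 - s) * 1 + s * 1"
    using w assms by (intro add_mono mult_left_mono) auto
  moreover have "0 \<le> (1 - s) * t + s * \<omega> t" using w assms by simp
  ultimately show ?thesis by simp
qed

context
  fixes G :: "('v, 'e) pre_digraph"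
  assumes wf: "wf_digraph G"
begin

lemmas [simp] = topspace_graph[OF wf]

lemma continuous_map_squeeze:
  assumes \<omega>: "squeezing \<omega>"
  shows "continuous_map (prod_topology I01 (graph_space G)) (graph_space G) (squeeze G \<omega>)"
proof (rule continuous_map_prod_graph_space[OF wf])
  show "continuous_map I01 (graph_space G) (\<lambda>s. squeeze G \<omega> (s, Inl v))" if "v \<in> verts G" for v
    using that by (simp add: squeeze_def graph_points_def)
  fix e assume e: "e \<in> arcs G"
  have "continuous_on ({0..1} \<times> {0..1}) (\<lambda>z. (1 - fst z) * snd z + fst z * \<omega> (snd z))"
    using \<omega> unfolding squeezing_def
    by (intro continuous_intros continuous_on_compose2[of "{0..1}" \<omega> _ snd]) auto
  then have "continuous_map (prod_topology I01 I01) I01 (\<lambda>z. (1 - fst z) * snd z + fst z * \<omega> (snd z))"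
    using squeeze_param[OF \<omega>] by auto
  from continuous_map_compose[OF this continuous_map_edge_map[OF wf e]]
  show "continuous_map (prod_topology I01 I01) (graph_space G) (\<lambda>p. squeeze G \<omega> (fst p, edge_map G e (snd p)))"
    by (rule continuous_map_eq) (auto simp: squeeze_edge_map[OF \<omega>])
qed

text \<open>
  A path \<open>q\<close> that starts at \<open>x\<close> and is collapsed to \<open>x\<close> by a squeezing is homotopic to the track
  that its end point follows, run through backwards, and the track is a segment of a single edge. The
  homotopy is the square \<open>(s, t) \<mapsto> squeeze (s, q t)\<close>: the path \<open>q\<close> is one of its sides, and on two
  of the other three sides the square is constant.
\<close>

lemma path_in_star_straight:
  assumes \<omega>: "squeezing \<omega>" and q: "pathin (graph_space G) q" "q 0 = x"
    and collapse: "\<And>t. t \<in> {0..1} \<Longrightarrow> squeeze G \<omega> (1, q t) = x"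
    and fixed: "\<And>s. s \<in> {0..1} \<Longrightarrow> squeeze G \<omega> (s, x) = x"
  shows "path_htpy (graph_space G) x (q 1) q (\<lambda>_. x) \<or>
    (\<exists>e\<in>arcs G. \<exists>a\<in>{0..1}. \<exists>b\<in>{0..1}.
      path_htpy (graph_space G) x (q 1) q (\<lambda>t. edge_map G e (linepath a b t)))"
proof -
  let ?X = "graph_space G"
  define m where "m = (\<lambda>t. squeeze G \<omega> (min 1 (3 - 3 * t), q 1))"
  have "continuous_map (prod_topology I01 I01) (prod_topology I01 ?X) (\<lambda>z. (fst z, (q \<circ> snd) z))"
    using q(1) by (intro continuous_map_pairedI continuous_map_fst continuous_map_compose[OF continuous_map_snd])
      (auto simp: pathin_def)
  from continuous_map_compose[OF this continuous_map_squeeze[OF \<omega>]]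
  have F: "continuous_map (top_of_set ({0..1} \<times> {0..1})) ?X (\<lambda>z. squeeze G \<omega> (fst z, q (snd z)))"
    by (simp add: o_def)
  have qx: "q 1 \<in> graph_points G" using path_finish_in_topspace[OF q(1)] by simp
  \<comment> \<open>\<open>q\<close> is the side \<open>s = 0\<close> of the square; \<open>m\<close> runs through the other three sides, each in a third
    of the time\<close>
  have "path_htpy ?X (q 0) (q 1) q m"
  proof (rule path_htpy_in_convex[OF F, of "\<lambda>t. (0, t)" "\<lambda>t. (min (min 1 (3 * t)) (3 - 3 * t), max 0 (min 1 (3 * t - 1)))"])
    show "convex ({0..1::real} \<times> {0..1::real})" by (intro convex_Times) auto
    show "continuous_on {0..1} (\<lambda>t::real. (0::real, t))" by (intro continuous_intros)
    show "(\<lambda>t. (0, t)) \<in> {0..1} \<rightarrow> {0..1::real} \<times> {0..1::real}" by auto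
    show "continuous_on {0..1} (\<lambda>t::real. (min (min 1 (3 * t)) (3 - 3 * t), max 0 (min 1 (3 * t - 1))))"
      by (intro continuous_intros)
    show "(\<lambda>t. (min (min 1 (3 * t)) (3 - 3 * t), max 0 (min 1 (3 * t - 1)))) \<in> {0..1} \<rightarrow> {0..1::real} \<times> {0..1::real}"
      by (auto simp: min_def)
    show "q t = squeeze G \<omega> (fst (0::real, t), q (snd (0::real, t)))" if t: "t \<in> {0..1}" for t
    proof -
      have "q t \<in> graph_points G"
        using q(1) t by (auto simp: pathin_def continuous_map_def)
      then show ?thesis by (cases rule: graph_point_cases) (auto simp: squeeze_def)
    qed
    show "m t = squeeze G \<omega> (fst (min (min 1 (3 * t)) (3 - 3 * t), max 0 (min 1 (3 * t - 1))),
        q (snd (min (min 1 (3 * t)) (3 - 3 * t), max 0 (min 1 (3 * t - 1)))))" if t: "t \<in> {0..1}" for t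
    proof -
      consider "t \<le> 1/3" | "1/3 < t" "t \<le> 2/3" | "2/3 < t" by linarith
      then show ?thesis
      proof cases
        case 1
        then have "min (min 1 (3 * t)) (3 - 3 * t) = 3 * t" "max 0 (min 1 (3 * t - 1)) = 0" "min 1 (3 - 3 * t) = 1"
          by (auto simp: min_def)
        then show ?thesis using 1 t q(2) collapse[of 1] fixed[of "3 * t"] by (simp add: m_def)
      next
        case 2
        then have "min (min 1 (3 * t)) (3 - 3 * t) = 1" "max 0 (min 1 (3 * t - 1)) = 3 * t - 1" "min 1 (3 - 3 * t) = 1"
          by (auto simp: min_def)
        then show ?thesis using 2 collapse[of 1] collapse[of "3 * t - 1"] by (simp add: m_def)
      next
        case 3
        then have "min (min 1 (3 * t)) (3 - 3 * t) = 3 - 3 * t" "max 0 (min 1 (3 * t - 1)) = 1" "min 1 (3 - 3 * t) = 3 - 3 * t"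
          by (auto simp: min_def)
        then show ?thesis by (simp add: m_def)
      qed
    qed
  qed auto
  then have qm: "path_htpy ?X x (q 1) q m" using q(2) by simp
  from qx show ?thesis
  proof (cases rule: graph_point_cases)
    case (vertex v)
    then have "x = Inl v" using collapse[of 1] by (simp add: squeeze_def)
    then have "m = (\<lambda>_. x)" using vertex by (auto simp: m_def squeeze_def)
    then show ?thesis using qm by simp
  next
    case (edge e r)
    define w where "w = (\<lambda>t. (1 - min 1 (3 - 3 * t)) * r + min 1 (3 - 3 * t) * \<omega> r)"
    have r: "r \<in> {0..1}" and \<omega>r: "\<omega> r \<in> {0..1}"
      using edge \<omega> by (auto simp: squeezing_def)
    have m: "m t = edge_map G e (w t)" for t
      using edge by (simp add: m_def w_def squeeze_def)
    have w01: "w t \<in> {0..1}" if "t \<in> {0..1}" for t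
      unfolding w_def using that r by (intro squeeze_param[OF \<omega>]) auto
    have "path_htpy ?X (m 0) (m 1) m (\<lambda>t. edge_map G e (linepath (\<omega> r) r t))"
    proof (rule path_htpy_reparam[OF pathin_edge_map[OF wf edge(1)], of w "linepath (\<omega> r) r"])
      show "continuous_on {0..1} w" unfolding w_def by (intro continuous_intros)
      show "w \<in> {0..1} \<rightarrow> {0..1}" using w01 by auto
      have "linepath (\<omega> r) r ` {0..1} \<subseteq> {0..1}"
        using closed_segment_subset[OF \<omega>r r] by (simp add: linepath_image_01)
      then show "linepath (\<omega> r) r \<in> {0..1} \<rightarrow> {0..1}" by auto
      show "continuous_on {0..1} (linepath (\<omega> r) r)" by (rule continuous_on_linepath)
    qed (auto simp: m w_def linepath_def)
    moreover have "m 0 = x" "m 1 = q 1"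
      using path_htpy_imp[OF qm] by auto
    ultimately have "path_htpy ?X x (q 1) q (\<lambda>t. edge_map G e (linepath (\<omega> r) r t))"
      using path_htpy_trans[OF qm] by simp
    then show ?thesis using edge(1) r \<omega>r by blast
  qed
qed

text \<open>
  Around a vertex the outer thirds of all edges are collapsed to their ends; around a point with
  parameter \<open>t\<close> inside an edge, the parameters between \<open>t / 2\<close> and \<open>(1 + t) / 2\<close> are collapsed to \<open>t\<close>.
\<close>

lemma star_neighbourhood:
  assumes "x \<in> graph_points G"
  obtains W \<omega> where "openin (graph_space G) W" "x \<in> W" "squeezing \<omega>"
    "\<And>y. y \<in> W \<Longrightarrow> squeeze G \<omega> (1, y) = x" "\<And>s. s \<in> {0..1} \<Longrightarrow> squeeze G \<omega> (s, x) = x"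
  using assms
proof (cases rule: graph_point_cases)
  case (vertex v)
  define \<omega> where "\<omega> = (\<lambda>t::real. max 0 (min 1 (3 * t - 1)))"
  define W :: "('v, 'e) gpoint set" where "W = {Inl v} \<union> {Inr (e, t) | e t. e \<in> arcs G \<and> 0 < t \<and> t < 1 \<and>
      (tail G e = v \<and> t < 1/3 \<or> head G e = v \<and> 2/3 < t)}"
  have "openin (graph_space G) W"
    unfolding openin_graph_space
  proof (intro conjI ballI)
    show "W \<subseteq> graph_points G" using vertex by (auto simp: W_def graph_points_def)
    fix e assume e: "e \<in> arcs G"
    have "{0..1} \<inter> edge_map G e -` W = {0..1} \<inter> ((if tail G e = v then {..<1/3} else {}) \<union> (if head G e = v then {2/3<..} else {}))"
    proof -
      have "edge_map G e t \<in> W \<longleftrightarrow> tail G e = v \<and> t < 1/3 \<or> head G e = v \<and> 2/3 < t" if t: "t \<in> {0..1}" for t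
      proof -
        consider "t = 0" | "t = 1" | "0 < t" "t < 1" using t by fastforce
        then show ?thesis using e by cases (auto simp: W_def)
      qed
      then show ?thesis by auto
    qed
    moreover have "open ((if tail G e = v then {..<1/3::real} else {}) \<union> (if head G e = v then {2/3<..} else {}))"
      by auto
    ultimately show "openin I01 ({0..1} \<inter> edge_map G e -` W)" by (simp add: openin_open_Int)
  qed
  moreover have "x \<in> W" using vertex by (simp add: W_def)
  moreover have "squeezing \<omega>"
    by (auto simp: squeezing_def \<omega>_def intro!: continuous_intros)
  moreover have "squeeze G \<omega> (1, y) = x" if "y \<in> W" for y
    using that vertex by (auto simp: W_def squeeze_def \<omega>_def)
  moreover have "squeeze G \<omega> (s, x) = x" for s using vertex by (simp add: squeeze_def)
  ultimately show thesis by (intro that)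
next
  case (edge e t)
  define \<omega> where "\<omega> = (\<lambda>s::real. max (min (2 * s) t) (2 * s - 1))"
  define W :: "('v, 'e) gpoint set" where "W = {Inr (e, s) | s. t / 2 < s \<and> s < (1 + t) / 2}"
  have "openin (graph_space G) W"
    unfolding openin_graph_space
  proof (intro conjI ballI)
    show "W \<subseteq> graph_points G" using edge by (auto simp: W_def graph_points_def)
    fix e' assume "e' \<in> arcs G"
    have "{0..1} \<inter> edge_map G e' -` W = {0..1} \<inter> (if e' = e then {t / 2<..<(1 + t) / 2} else {})"
      using edge by (auto simp: W_def edge_map_def)
    moreover have "open (if e' = e then {t / 2<..<(1 + t) / 2} else {})" by auto
    ultimately show "openin I01 ({0..1} \<inter> edge_map G e' -` W)" by (simp add: openin_open_Int)
  qed
  moreover have "x \<in> W" using edge by (auto simp: W_def)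
  moreover have "squeezing \<omega>"
  proof -
    have "continuous_on {0..1} \<omega>" unfolding \<omega>_def by (intro continuous_intros)
    moreover have "\<omega> 0 = 0" "\<omega> 1 = 1" using edge by (auto simp: \<omega>_def)
    moreover have "\<omega> s \<in> {0..1}" if "s \<in> {0..1}" for s
      using that edge by (auto simp: \<omega>_def le_max_iff_disj)
    ultimately show ?thesis by (auto simp: squeezing_def)
  qed
  moreover have \<omega>t: "\<omega> s = t" if "t / 2 < s" "s < (1 + t) / 2" for s
    using that edge by (auto simp: \<omega>_def min_def max_def)
  then have "squeeze G \<omega> (1, y) = x" if "y \<in> W" for y
    using that edge by (auto simp: W_def squeeze_def)
  moreover have "squeeze G \<omega> (s, x) = x" for s
  proof -
    have "\<omega> t = t" using edge by (intro \<omega>t) auto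
    then have "(1 - s) * t + s * \<omega> t = t" by (simp add: algebra_simps)
    then show ?thesis using edge by (simp add: squeeze_def)
  qed
  ultimately show thesis by (intro that)
qed

text \<open>
  Locally a path is homotopic to a segment of an edge, so being related by a segment of \<open>p\<close> with
  holonomy in \<open>S\<close> is an equivalence relation with open classes on the parameter interval, which is
  connected. Segments of edges have holonomy in \<open>S\<close>, because the frame at an interior point is
  obtained by extending the frame at the tail of the edge.
\<close>

lemma holonomy_generated_by_edges:
  assumes frame: "path_frame (graph_space G) x0 \<delta>"
    and interior: "\<And>e t. e \<in> arcs G \<Longrightarrow> 0 < t \<Longrightarrow> t < 1 \<Longrightarrow>
      \<delta> (Inr (e, t)) = loop_concat (\<delta> (Inl (tail G e))) (\<lambda>s. edge_map G e (linepath 0 t s))"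
    and S: "subgroup S (fundamental_group (graph_space G) x0)"
    and edges: "\<And>e. e \<in> arcs G \<Longrightarrow> path_frame.holonomy (graph_space G) x0 \<delta> (edge_map G e) \<in> S"
    and p: "pathin (graph_space G) p"
  shows "path_frame.holonomy (graph_space G) x0 \<delta> p \<in> S"
proof -
  let ?X = "graph_space G"
  interpret F: path_frame ?X x0 \<delta> by (rule frame)
  have line01: "linepath a b t \<in> {0..1}" if "a \<in> {0..1}" "b \<in> {0..1}" "t \<in> {0..1}" for a b t :: real
  proof -
    have "linepath a b t \<in> closed_segment a b" using that(3) unfolding linepath_image_01[symmetric] by (rule imageI)
    then show ?thesis using closed_segment_subset[OF that(1,2)] by auto
  qed
  have sub: "pathin ?X (\<lambda>t. q (linepath a b t))" if "pathin ?X q" "a \<in> {0..1}" "b \<in> {0..1}" for q and a b :: real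
  proof -
    have "continuous_map I01 I01 (linepath a b)" using line01[OF that(2,3)] by auto
    from continuous_map_compose[OF this that(1)[unfolded pathin_def]] show ?thesis by (simp add: pathin_def o_def)
  qed
  have split: "F.holonomy (\<lambda>t. q (linepath a c t)) =
      F.holonomy (\<lambda>t. q (linepath a b t)) \<otimes>\<^bsub>F.\<pi>1\<^esub> F.holonomy (\<lambda>t. q (linepath b c t))"
    if q: "pathin ?X q" and abc: "a \<in> {0..1}" "b \<in> {0..1}" "c \<in> {0..1}" for q and a b c :: real
    using F.holonomy_htpy[OF path_htpy_subdivide[OF q abc]]
      F.holonomy_concat[OF sub[OF q abc(1,2)] sub[OF q abc(2,3)]] by (simp add: linepath_def)
  have start: "F.holonomy (\<lambda>t. edge_map G e (linepath 0 b t)) \<in> S" if e: "e \<in> arcs G" and b: "b \<in> {0..1}" for e b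
  proof -
    consider "b = 0" | "b = 1" | "0 < b" "b < 1" using b by fastforce
    then show ?thesis
    proof cases
      case 1
      then have "(\<lambda>t. edge_map G e (linepath 0 b t)) = (\<lambda>_. Inl (tail G e))" by (auto simp: linepath_def)
      moreover have "Inl (tail G e) \<in> topspace ?X"
        using edge_map_in_graph_points[OF wf e, of 0] by simp
      ultimately show ?thesis using F.holonomy_const subgroup.one_closed[OF S] by simp
    next
      case 2
      then have "(\<lambda>t. edge_map G e (linepath 0 b t)) = edge_map G e" by (auto simp: linepath_def)
      then show ?thesis using edges[OF e] by simp
    next
      case 3
      have "F.holonomy (\<lambda>t. edge_map G e (linepath 0 b t)) = \<one>\<^bsub>F.\<pi>1\<^esub>"
        using interior[OF e 3] 3
        by (intro F.holonomy_frame_extension sub pathin_edge_map[OF wf e] b) (simp_all add: linepath_def)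
      then show ?thesis using subgroup.one_closed[OF S] by simp
    qed
  qed
  have seg: "F.holonomy (\<lambda>t. edge_map G e (linepath a b t)) \<in> S"
    if e: "e \<in> arcs G" and ab: "a \<in> {0..1}" "b \<in> {0..1}" for e a b
  proof -
    let ?h = "\<lambda>a b. F.holonomy (\<lambda>t. edge_map G e (linepath a b t))"
    have eq: "?h 0 b = ?h 0 a \<otimes>\<^bsub>F.\<pi>1\<^esub> ?h a b"
      by (rule split[OF pathin_edge_map[OF wf e]]) (use ab in auto)
    have "?h a b = inv\<^bsub>F.\<pi>1\<^esub> ?h 0 a \<otimes>\<^bsub>F.\<pi>1\<^esub> ?h 0 b"
    proof (rule iffD2[OF F.inv_solve_left])
      show "?h 0 b = ?h 0 a \<otimes>\<^bsub>F.\<pi>1\<^esub> ?h a b" by (rule eq)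
      show "?h a b \<in> carrier F.\<pi>1" "?h 0 a \<in> carrier F.\<pi>1" "?h 0 b \<in> carrier F.\<pi>1"
        using ab by (intro F.holonomy_in_carrier sub[OF pathin_edge_map[OF wf e]]; simp)+
    qed
    then show ?thesis
      using start[OF e] ab S by (simp add: subgroup.m_closed subgroup.m_inv_closed)
  qed
  have "F.holonomy (\<lambda>r. p (linepath 0 1 r)) \<in> S"
  proof (rule connected_equivalence_relation[where S = "{0..1::real}"
        and R = "\<lambda>a b. F.holonomy (\<lambda>r. p (linepath a b r)) \<in> S"])
    show "F.holonomy (\<lambda>r. p (linepath b a r)) \<in> S"
      if "F.holonomy (\<lambda>r. p (linepath a b r)) \<in> S" "a \<in> {0..1}" "b \<in> {0..1}" for a b
    proof -
      have "linepath a b (1 - r) = linepath b a r" for r by (simp add: linepath_def algebra_simps)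
      then show ?thesis
        using F.holonomy_reverse[OF sub[OF p that(2,3)]] that(1) subgroup.m_inv_closed[OF S] by simp
    qed
    show "F.holonomy (\<lambda>r. p (linepath a c r)) \<in> S"
      if "F.holonomy (\<lambda>r. p (linepath a b r)) \<in> S" "F.holonomy (\<lambda>r. p (linepath b c r)) \<in> S"
        "a \<in> {0..1}" "b \<in> {0..1}" "c \<in> {0..1}" for a b c
      using split[OF p that(3-5)] that(1,2) subgroup.m_closed[OF S] by simp
    show "\<exists>T. openin (top_of_set {0..1}) T \<and> a \<in> T \<and> (\<forall>b\<in>T. F.holonomy (\<lambda>r. p (linepath a b r)) \<in> S)"
      if a: "a \<in> {0..1}" for a
    proof -
      have "p a \<in> graph_points G" using p a by (auto simp: pathin_def continuous_map_def)
      then obtain W \<omega> where W: "openin ?X W" "p a \<in> W" "squeezing \<omega>"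
        "\<And>y. y \<in> W \<Longrightarrow> squeeze G \<omega> (1, y) = p a" "\<And>s. s \<in> {0..1} \<Longrightarrow> squeeze G \<omega> (s, p a) = p a"
        by (rule star_neighbourhood) blast
      have "openin I01 {t \<in> topspace I01. p t \<in> W}"
        using p W(1) unfolding pathin_def by (rule openin_continuous_map_preimage)
      then obtain V where V: "open V" "{t \<in> {0..1}. p t \<in> W} = {0..1} \<inter> V"
        by (auto simp: openin_open)
      then have "a \<in> V" using a W(2) by blast
      then obtain \<epsilon> where \<epsilon>: "\<epsilon> > 0" "ball a \<epsilon> \<subseteq> V" using V(1) open_contains_ball by blast
      have "F.holonomy (\<lambda>r. p (linepath a b r)) \<in> S" if b: "b \<in> {0..1} \<inter> ball a \<epsilon>" for b
      proof -
        let ?q = "\<lambda>r. p (linepath a b r)"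
        have "closed_segment a b \<subseteq> {0..1} \<inter> ball a \<epsilon>"
          using a b \<epsilon>(1) by (intro closed_segment_subset) (auto intro: convex_Int)
        then have "linepath a b ` {0..1} \<subseteq> {t \<in> {0..1}. p t \<in> W}"
          unfolding linepath_image_01 V(2) using \<epsilon>(2) by blast
        then have inW: "?q t \<in> W" if "t \<in> {0..1}" for t using that by blast
        have q: "pathin ?X ?q" using a b by (intro sub p) auto
        have "path_htpy ?X (p a) (?q 1) ?q (\<lambda>_. p a) \<or>
          (\<exists>e\<in>arcs G. \<exists>c\<in>{0..1}. \<exists>d\<in>{0..1}. path_htpy ?X (p a) (?q 1) ?q (\<lambda>t. edge_map G e (linepath c d t)))"
          by (rule path_in_star_straight[OF W(3) q]) (use W(4,5) inW in \<open>auto simp: linepath_def\<close>)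
        then show ?thesis
        proof (elim disjE bexE)
          assume "path_htpy ?X (p a) (?q 1) ?q (\<lambda>_. p a)"
          then have "F.holonomy ?q = F.holonomy (\<lambda>_. p a)" by (rule F.holonomy_htpy)
          also have "\<dots> = \<one>\<^bsub>F.\<pi>1\<^esub>"
            using \<open>p a \<in> graph_points G\<close> by (intro F.holonomy_const) simp
          finally show ?thesis using subgroup.one_closed[OF S] by simp
        next
          fix e c d assume "e \<in> arcs G" "c \<in> {0..1}" "d \<in> {0..1}"
            and h: "path_htpy ?X (p a) (?q 1) ?q (\<lambda>t. edge_map G e (linepath c d t))"
          then show ?thesis using seg F.holonomy_htpy[OF h] by simp
        qed
      qed
      then show ?thesis
        using a \<epsilon>(1) openin_open_Int[OF open_ball[of a \<epsilon>], of "{0..1}"]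
        by (intro exI[of _ "{0..1} \<inter> ball a \<epsilon>"]) auto
    qed
  qed auto
  then show ?thesis by (simp add: linepath_def)
qed

end

section \<open>Rooted spanning trees\<close>

lemma path_connectedin_from_base:
  assumes D: "D \<subseteq> topspace X" and "\<And>x. x \<in> D \<Longrightarrow> \<exists>g. pathin X g \<and> g ` {0..1} \<subseteq> D \<and> g 0 = b \<and> g 1 = x"
  shows "path_connectedin X D"
  unfolding path_connectedin
proof (intro conjI ballI D)
  fix x y assume x: "x \<in> D" and y: "y \<in> D"
  obtain g where g: "pathin X g" "g ` {0..1} \<subseteq> D" "g 0 = b" "g 1 = x" using assms(2)[OF x] by blast
  obtain h where h: "pathin X h" "h ` {0..1} \<subseteq> D" "h 0 = b" "h 1 = y" using assms(2)[OF y] by blast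
  have "pathin X (loop_concat (\<lambda>t. g (1 - t)) h)"
    using g h by (intro pathin_loop_concat pathin_reverse) auto
  moreover have "loop_concat (\<lambda>t. g (1 - t)) h \<in> {0..1} \<rightarrow> D"
    using g(2) h(2) by (auto simp: loop_concat_def image_subset_iff)
  ultimately show "\<exists>k. pathin X k \<and> k \<in> {0..1} \<rightarrow> D \<and> k 0 = x \<and> k 1 = y"
    using g h by (intro exI[of _ "loop_concat (\<lambda>t. g (1 - t)) h"]) simp
qed

lemma image_reverse_unit_interval: "(\<lambda>t::real. f (1 - t)) ` {0..1} = f ` {0..1}"
proof -
  have "f ` {0..1} = f ` ((\<lambda>t. 1 - t) ` {0..1})" by simp
  also have "\<dots> = (\<lambda>t. f (1 - t)) ` {0..1}" by (rule image_image)
  finally show ?thesis by simp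
qed

text \<open>
  A spanning tree in terms of its parent function; \<open>up v\<close> is the tree edge that joins \<open>v\<close> to its
  parent, in either orientation. The values of \<open>parent\<close> and \<open>up\<close> at the root are arbitrary.
\<close>

locale rooted_tree = wf_digraph G for G :: "('v, 'e) pre_digraph" +
  fixes r :: 'v and depth :: "'v \<Rightarrow> nat" and parent :: "'v \<Rightarrow> 'v" and up :: "'v \<Rightarrow> 'e"
  assumes root: "r \<in> verts G" "depth r = 0"
    and up_arc: "\<And>v. v \<in> verts G \<Longrightarrow> v \<noteq> r \<Longrightarrow> up v \<in> arcs G"
    and parent_vert: "\<And>v. v \<in> verts G \<Longrightarrow> v \<noteq> r \<Longrightarrow> parent v \<in> verts G"
    and depth_parent: "\<And>v. v \<in> verts G \<Longrightarrow> v \<noteq> r \<Longrightarrow> depth v = Suc (depth (parent v))"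
    and up_ends: "\<And>v. v \<in> verts G \<Longrightarrow> v \<noteq> r \<Longrightarrow>
      tail G (up v) = parent v \<and> head G (up v) = v \<or> tail G (up v) = v \<and> head G (up v) = parent v"
begin

lemmas wf = wf_digraph_axioms

definition up_path :: "'v \<Rightarrow> real \<Rightarrow> ('v, 'e) gpoint" where
  "up_path v = (if tail G (up v) = parent v \<and> head G (up v) = v then edge_map G (up v) else (\<lambda>t. edge_map G (up v) (1 - t)))"

lemma up_path:
  assumes "v \<in> verts G" "v \<noteq> r"
  shows "pathin (graph_space G) (up_path v)" "up_path v 0 = Inl (parent v)" "up_path v 1 = Inl v"
    "up_path v ` {0..1} = edge_map G (up v) ` {0..1}"
proof -
  have pe: "pathin (graph_space G) (edge_map G (up v))" by (rule pathin_edge_map[OF wf up_arc[OF assms]])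
  show "pathin (graph_space G) (up_path v)"
    using pe pathin_reverse[OF pe] by (simp add: up_path_def)
  show "up_path v 0 = Inl (parent v)" "up_path v 1 = Inl v"
    using up_ends[OF assms] by (auto simp: up_path_def)
  show "up_path v ` {0..1} = edge_map G (up v) ` {0..1}"
    by (simp add: up_path_def image_reverse_unit_interval)
qed

text \<open>
  The part of the tree spanned by the vertices \<open>B\<close>, where \<open>w\<close> is the top of \<open>B\<close>, whose upward edge
  is left out.
\<close>

definition subtree :: "'v set \<Rightarrow> 'v \<Rightarrow> ('v, 'e) gpoint set" where
  "subtree B w = Inl ` B \<union> (\<Union>v\<in>B - {w}. open_edge (up v))"

lemma path_connectedin_subtree:
  assumes B: "B \<subseteq> verts G" and closed: "\<And>v. v \<in> B \<Longrightarrow> v \<noteq> w \<Longrightarrow> v \<noteq> r \<and> parent v \<in> B"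
    and w: "\<And>v. v \<in> B \<Longrightarrow> depth v = depth w \<Longrightarrow> v = w" "\<And>v. v \<in> B \<Longrightarrow> depth w \<le> depth v"
  shows "path_connectedin (graph_space G) (subtree B w)"
proof (rule path_connectedin_from_base[where b = "Inl w"])
  let ?X = "graph_space G" and ?D = "subtree B w"
  have e_arc: "up v \<in> arcs G" if "v \<in> B - {w}" for v
    using that up_arc[of v] closed[of v] subsetD[OF B, of v] by simp
  show D: "?D \<subseteq> topspace ?X"
    using B e_arc unfolding topspace_graph[OF wf]
    by (auto simp: subtree_def graph_points_def open_edge_def)
  have edge_in: "edge_map G (up v) ` {0..1} \<subseteq> ?D" if v: "v \<in> B" "v \<noteq> w" for v
  proof -
    have "v \<in> verts G" using v(1) B by blast
    then have "{Inl (tail G (up v)), Inl (head G (up v))} \<subseteq> Inl ` B"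
      using up_ends[of v] v closed[OF v] by auto
    moreover have "open_edge (up v) \<subseteq> (\<Union>v\<in>B - {w}. open_edge (up v))"
      by (rule UN_upper) (use v in simp)
    ultimately have "{Inl (tail G (up v)), Inl (head G (up v))} \<union> open_edge (up v) \<subseteq> ?D"
      unfolding subtree_def by (rule Un_mono)
    with edge_map_range[of G "up v"] show ?thesis by (rule subset_trans)
  qed
  have vert: "\<exists>g. pathin ?X g \<and> g ` {0..1} \<subseteq> ?D \<and> g 0 = Inl w \<and> g 1 = Inl v" if "v \<in> B" for v
    using that
  proof (induction "depth v" arbitrary: v rule: less_induct)
    case less
    show ?case
    proof (cases "v = w")
      case True
      have "Inl w \<in> ?D" using less.prems True by (simp add: subtree_def)
      moreover from this have "pathin ?X (\<lambda>_. Inl w)" using subsetD[OF D] by simp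
      ultimately show ?thesis unfolding True by (intro exI[of _ "\<lambda>_. Inl w"]) (simp add: image_constant_conv)
    next
      case False
      have v: "v \<in> verts G" "v \<noteq> r" "parent v \<in> B"
        using subsetD[OF B less.prems] closed[OF less.prems False] by simp_all
      have "depth (parent v) < depth v" by (simp add: depth_parent[OF v(1,2)])
      from less.hyps[OF this v(3)]
      obtain g where g: "pathin ?X g" "g ` {0..1} \<subseteq> ?D" "g 0 = Inl w" "g 1 = Inl (parent v)" by blast
      have "pathin ?X (loop_concat g (up_path v))"
        using g(4) up_path(2)[OF v(1,2)] by (intro pathin_loop_concat g(1) up_path(1)[OF v(1,2)]) simp
      moreover have "loop_concat g (up_path v) ` {0..1} \<subseteq> ?D"
        using edge_in[OF less.prems False] unfolding up_path(4)[OF v(1,2), symmetric]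
        by (intro range_loop_concat g(2))
      ultimately show ?thesis
        using g(3) up_path(3)[OF v(1,2)] by (intro exI[of _ "loop_concat g (up_path v)"]) simp
    qed
  qed
  show "\<exists>g. pathin ?X g \<and> g ` {0..1} \<subseteq> ?D \<and> g 0 = Inl w \<and> g 1 = x" if x: "x \<in> ?D" for x
  proof (cases "x \<in> Inl ` B")
    case True
    then show ?thesis using vert by blast
  next
    case False
    then obtain v where v: "v \<in> B" "v \<noteq> w" "x \<in> open_edge (up v)" using x by (auto simp: subtree_def)
    obtain t where t: "0 < t" "t < 1" "x = edge_map G (up v) t"
      using open_edge_edge_map[OF v(3), of G] by blast
    have "v \<in> verts G" using v(1) B by blast
    then have "tail G (up v) \<in> B" using up_ends[of v] v(1) closed[OF v(1,2)] by auto
    then obtain g where g: "pathin ?X g" "g ` {0..1} \<subseteq> ?D" "g 0 = Inl w" "g 1 = Inl (tail G (up v))"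
      using vert by blast
    let ?h = "\<lambda>s. edge_map G (up v) (t * s)"
    have ts: "t * s \<in> {0..1}" if "s \<in> {0..1}" for s
      using t(1,2) that by (simp add: mult_le_one)
    have "continuous_on {0..1} (\<lambda>s. t * s)" by (intro continuous_intros)
    then have "continuous_map I01 I01 (\<lambda>s. t * s)" using ts by auto
    from continuous_map_compose[OF this continuous_map_edge_map[OF wf e_arc]]
    have h: "pathin ?X ?h" using v(1,2) by (simp add: pathin_def o_def)
    have "?h ` {0..1} \<subseteq> ?D" using edge_in[OF v(1,2)] ts by blast
    then have "loop_concat g ?h ` {0..1} \<subseteq> ?D" by (intro range_loop_concat g(2))
    moreover have "pathin ?X (loop_concat g ?h)"
      using g(4) by (intro pathin_loop_concat g(1) h) simp
    ultimately show ?thesis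
      unfolding t(3) using g(3) by (intro exI[of _ "loop_concat g ?h"]) simp
  qed
qed

definition cotree :: "'e set" where
  "cotree = arcs G - up ` (verts G - {r})"

lemma subtree_avoids_cotree:
  assumes "B \<subseteq> verts G" "\<And>v. v \<in> B \<Longrightarrow> v \<noteq> w \<Longrightarrow> v \<noteq> r" "e \<in> cotree"
  shows "subtree B w \<inter> open_edge e = {}"
proof -
  have "e \<noteq> up v" if "v \<in> B - {w}" for v
    using that assms(2)[of v] assms(3) subsetD[OF assms(1), of v] by (auto simp: cotree_def)
  then have "open_edge (up v) \<inter> open_edge e = {}" if "v \<in> B - {w}" for v
    using that by (auto simp: open_edge_def)
  then show ?thesis by (auto simp: subtree_def)
qed

text \<open>
  For the frame given by the paths in the tree, the holonomy of a tree edge is trivial.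
\<close>

lemma fundamental_group_generated_by_cotree:
  assumes base: "pathin (graph_space G) \<beta>" "\<beta> 0 = x0" "\<beta> 1 = Inl r"
  obtains g where "g ` cotree \<subseteq> carrier (fundamental_group (graph_space G) x0)"
    "generate (fundamental_group (graph_space G) x0) (g ` cotree) = carrier (fundamental_group (graph_space G) x0)"
proof -
  let ?X = "graph_space G"
  define D where "D = rec_nat (\<lambda>v. \<beta>) (\<lambda>n f v. loop_concat (f (parent v)) (up_path v))"
  have D: "pathin ?X (D (depth v) v) \<and> D (depth v) v 0 = x0 \<and> D (depth v) v 1 = Inl v" if "v \<in> verts G" for v
    using that
  proof (induction "depth v" arbitrary: v rule: less_induct)
    case less
    show ?case
    proof (cases "v = r")
      case True
      then show ?thesis using base root by (simp add: D_def)
    next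
      case False
      note v = less.prems False
      have eq: "D (depth v) v = loop_concat (D (depth (parent v)) (parent v)) (up_path v)"
        using depth_parent[OF v] by (simp add: D_def)
      have "pathin ?X (D (depth (parent v)) (parent v)) \<and> D (depth (parent v)) (parent v) 0 = x0 \<and>
          D (depth (parent v)) (parent v) 1 = Inl (parent v)"
        using less.hyps[of "parent v"] depth_parent[OF v] parent_vert[OF v] by simp
      then show ?thesis
        unfolding eq using up_path[OF v] by (auto intro!: pathin_loop_concat)
    qed
  qed
  define \<delta> where "\<delta> = (\<lambda>x::('v, 'e) gpoint. case x of Inl v \<Rightarrow> D (depth v) v
      | Inr (e, t) \<Rightarrow> loop_concat (D (depth (tail G e)) (tail G e)) (\<lambda>s. edge_map G e (linepath 0 t s)))"
  have frame: "path_frame ?X x0 \<delta>"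
  proof
    show "x0 \<in> topspace ?X" using path_start_in_topspace[OF base(1)] base(2) by simp
    show "pathin ?X (\<delta> x) \<and> \<delta> x 0 = x0 \<and> \<delta> x 1 = x" if "x \<in> topspace ?X" for x
      using that[unfolded topspace_graph[OF wf]]
    proof (cases rule: graph_point_cases)
      case (vertex v)
      then show ?thesis using D by (simp add: \<delta>_def)
    next
      case (edge e t)
      have "linepath 0 t s \<in> {0..1}" if "s \<in> {0..1}" for s
        using edge that by (simp add: linepath_def mult_le_one)
      then have "continuous_map I01 I01 (linepath 0 t)"
        using continuous_on_linepath[of "{0..1}" 0 t] by auto
      from continuous_map_compose[OF this continuous_map_edge_map[OF wf edge(1)]]
      have "pathin ?X (\<lambda>s. edge_map G e (linepath 0 t s))" by (simp add: pathin_def o_def)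
      then show ?thesis
        using edge D[OF tail_in_verts[OF edge(1)]]
        by (auto simp: \<delta>_def linepath_def intro!: pathin_loop_concat)
    qed
  qed
  interpret F: path_frame ?X x0 \<delta> by (rule frame)
  define g where "g = (\<lambda>e. F.holonomy (edge_map G e))"
  let ?S = "generate F.\<pi>1 (g ` cotree)"
  have gc: "g ` cotree \<subseteq> carrier F.\<pi>1"
    using F.holonomy_in_carrier pathin_edge_map[OF wf] by (auto simp: g_def cotree_def)
  have S: "subgroup ?S F.\<pi>1" by (rule F.generate_is_subgroup[OF gc])
  have "F.holonomy (edge_map G e) \<in> ?S" if e: "e \<in> arcs G" for e
  proof (cases "e \<in> cotree")
    case True
    then show ?thesis by (intro generate.incl) (auto simp: g_def)
  next
    case False
    then obtain v where v: "v \<in> verts G" "v \<noteq> r" "e = up v" using e by (auto simp: cotree_def)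
    have "\<delta> (up_path v 1) = loop_concat (\<delta> (up_path v 0)) (up_path v)"
      using up_path[OF v(1,2)] depth_parent[OF v(1,2)] by (simp add: \<delta>_def D_def)
    then have one: "F.holonomy (up_path v) = \<one>\<^bsub>F.\<pi>1\<^esub>"
      by (rule F.holonomy_frame_extension[OF up_path(1)[OF v(1,2)]])
    have "F.holonomy (edge_map G e) = \<one>\<^bsub>F.\<pi>1\<^esub>"
    proof (cases "tail G (up v) = parent v \<and> head G (up v) = v")
      case True
      then show ?thesis using one v by (simp add: up_path_def)
    next
      case False
      have pe: "pathin ?X (edge_map G e)" by (rule pathin_edge_map[OF wf e])
      have "inv\<^bsub>F.\<pi>1\<^esub> F.holonomy (edge_map G e) = \<one>\<^bsub>F.\<pi>1\<^esub>"
        using F.holonomy_reverse[OF pe] one False v by (simp add: up_path_def)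
      then show ?thesis using F.holonomy_in_carrier[OF pe] F.inv_eq_1_iff by simp
    qed
    then show ?thesis using subgroup.one_closed[OF S] by simp
  qed
  then have "F.holonomy q \<in> ?S" if "pathin ?X q" for q
    by (intro holonomy_generated_by_edges[OF wf frame _ S _ that]) (auto simp: \<delta>_def)
  then have "?S = carrier F.\<pi>1"
    by (rule F.subgroup_full_if_holonomy[OF F.generate_incl[OF gc]])
  then show thesis using that gc by blast
qed

lemma linked_edges_if_two_cotree_edges:
  assumes "e \<in> cotree" "e' \<in> cotree" "e \<noteq> e'"
  shows "linked_edges G {} e e' (subtree (verts G) r)"
proof -
  have "path_connectedin (graph_space G) (subtree (verts G) r)"
  proof (rule path_connectedin_subtree)
    show "v = r" if "v \<in> verts G" "depth v = depth r" for v
      using depth_parent[of v] that root(2) by (cases "v = r") auto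
  qed (use parent_vert root(2) in auto)
  moreover have "subtree (verts G) r \<inter> open_edge d = {}" if "d \<in> cotree" for d
    using that by (intro subtree_avoids_cotree) auto
  ultimately show ?thesis
    using assms unfolding linked_edges_def by (auto simp: cotree_def subtree_def)
qed

definition ancestor :: "nat \<Rightarrow> 'v \<Rightarrow> 'v" where
  "ancestor n v = (parent ^^ (depth v - n)) v"

lemma ancestor:
  assumes "v \<in> verts G" "n \<le> depth v"
  shows "ancestor n v \<in> verts G \<and> depth (ancestor n v) = n"
  using assms
proof (induction "depth v - n" arbitrary: v)
  case 0
  then show ?case by (simp add: ancestor_def)
next
  case (Suc k)
  have v: "v \<in> verts G" "v \<noteq> r" using Suc.prems(1) Suc.hyps(2) root(2) by auto
  have d: "depth v = Suc (depth (parent v))" by (rule depth_parent[OF v])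
  have "ancestor n v = ancestor n (parent v)"
  proof -
    have "depth v - n = Suc (depth (parent v) - n)" using Suc.hyps(2) d by linarith
    then show ?thesis by (simp add: ancestor_def funpow_swap1)
  qed
  moreover have "k = depth (parent v) - n" "n \<le> depth (parent v)" using Suc.hyps(2) d by linarith+
  ultimately show ?case using Suc.hyps(1)[of "parent v"] parent_vert[OF v] by simp
qed

lemma ancestor_parent:
  assumes "v \<in> verts G" "n < depth v"
  shows "v \<noteq> r" "parent v \<in> verts G" "n \<le> depth (parent v)" "ancestor n (parent v) = ancestor n v"
proof -
  show vr: "v \<noteq> r" using assms(2) root(2) by auto
  show "parent v \<in> verts G" by (rule parent_vert[OF assms(1) vr])
  have d: "depth v = Suc (depth (parent v))" by (rule depth_parent[OF assms(1) vr])
  then show "n \<le> depth (parent v)" using assms(2) by simp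
  have "depth v - n = Suc (depth (parent v) - n)" using assms(2) d by linarith
  then show "ancestor n (parent v) = ancestor n v" by (simp add: ancestor_def funpow_swap1)
qed

definition branch :: "nat \<Rightarrow> 'v \<Rightarrow> 'v set" where
  "branch n w = {v \<in> verts G. n \<le> depth v \<and> ancestor n v = w}"

lemma branch_step:
  assumes "v \<in> branch n w" "v \<noteq> w"
  shows "n < depth v" "v \<noteq> r \<and> parent v \<in> branch n w"
proof -
  show "n < depth v"
    using assms by (cases "depth v = n") (auto simp: branch_def ancestor_def)
  then show "v \<noteq> r \<and> parent v \<in> branch n w"
    using assms ancestor_parent[of v n] by (auto simp: branch_def)
qed

lemma path_connectedin_branch:
  assumes "w \<in> branch n w"
  shows "path_connectedin (graph_space G) (subtree (branch n w) w)"
proof -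
  have w: "depth w = n" using assms ancestor[of w n] by (auto simp: branch_def)
  show ?thesis
  proof (rule path_connectedin_subtree)
    show "branch n w \<subseteq> verts G" by (auto simp: branch_def)
    show "v \<noteq> r \<and> parent v \<in> branch n w" if "v \<in> branch n w" "v \<noteq> w" for v
      by (rule branch_step(2)[OF that])
    show "v = w" if "v \<in> branch n w" "depth v = depth w" for v
      using that w by (auto simp: branch_def ancestor_def)
    show "depth w \<le> depth v" if "v \<in> branch n w" for v using that w by (simp add: branch_def)
  qed
qed

text \<open>
  A vertex of level \<open>n + 1\<close> is an end of an edge at its parent.
\<close>

lemma finite_depth_level:
  assumes lf: "locally_finite_graph G"
  shows "finite {v \<in> verts G. depth v = n}"
proof (induction n)
  case 0
  have "v = r" if "v \<in> verts G" "depth v = 0" for v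
    using depth_parent[of v] that by (cases "v = r") auto
  then have "{v \<in> verts G. depth v = 0} \<subseteq> {r}" by blast
  then show ?case by (rule finite_subset) simp
next
  case (Suc n)
  let ?L = "{v \<in> verts G. depth v = n}"
  have "{v \<in> verts G. depth v = Suc n} \<subseteq> (\<Union>u\<in>?L. tail G ` in_arcs G u \<union> head G ` out_arcs G u)"
  proof
    fix v assume "v \<in> {v \<in> verts G. depth v = Suc n}"
    then have v: "v \<in> verts G" "v \<noteq> r" "depth v = Suc n" using root(2) by auto
    then have p: "parent v \<in> ?L" using depth_parent[OF v(1,2)] parent_vert[OF v(1,2)] by simp
    have "up v \<in> arcs G" using up_arc v by blast
    then have "v \<in> tail G ` in_arcs G (parent v) \<union> head G ` out_arcs G (parent v)"
      using up_ends[OF v(1,2)] by (auto simp: in_arcs_def out_arcs_def intro!: image_eqI[of v _ "up v"])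
    then show "v \<in> (\<Union>u\<in>?L. tail G ` in_arcs G u \<union> head G ` out_arcs G u)" using p by blast
  qed
  moreover have "finite (\<Union>u\<in>?L. tail G ` in_arcs G u \<union> head G ` out_arcs G u)"
    using Suc lf by (auto simp: locally_finite_graph_def)
  ultimately show ?case by (rule finite_subset)
qed

text \<open>
  Below a level \<open>n\<close> that lies beyond \<open>H\<close>, the tree falls into finitely many branches. Infinitely many
  edges outside the tree join the same two (possibly equal) branches. One of them, \<open>e0\<close>, is used
  to connect the two branches, which leaves two others that are linked.
\<close>

lemma linked_edges_outside_finite_subgraph:
  assumes lf: "locally_finite_graph G" and inf: "infinite cotree" and H: "finite_subgraph H G"
  obtains e e' D where "linked_edges G (graph_points H) e e' D"
proof -
  have Hv: "finite (verts H)" and wfH: "wf_digraph H" and HG: "subgraph H G"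
    using H by (auto simp: finite_subgraph_def subgraph_def)
  obtain n where n: "\<And>v. v \<in> verts H \<Longrightarrow> depth v < n"
  proof
    show "depth v < Suc (Max (insert 0 (depth ` verts H)))" if "v \<in> verts H" for v
      using that Hv by (auto simp: less_Suc_eq_le intro!: Max_ge)
  qed
  have low_fin: "finite {v \<in> verts G. depth v < n}"
  proof -
    have "{v \<in> verts G. depth v < n} = (\<Union>k<n. {v \<in> verts G. depth v = k})" by auto
    then show ?thesis using finite_depth_level[OF lf] by simp
  qed
  define N where "N = {e \<in> cotree. n \<le> depth (tail G e) \<and> n \<le> depth (head G e)}"
  have "cotree - N \<subseteq> (\<Union>v\<in>{v \<in> verts G. depth v < n}. in_arcs G v \<union> out_arcs G v)"
  proof
    fix e assume e: "e \<in> cotree - N"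
    then have ea: "e \<in> arcs G" by (simp add: cotree_def)
    have "depth (tail G e) < n \<or> depth (head G e) < n" using e by (auto simp: N_def)
    then show "e \<in> (\<Union>v\<in>{v \<in> verts G. depth v < n}. in_arcs G v \<union> out_arcs G v)"
    proof
      assume "depth (tail G e) < n"
      then show ?thesis using ea tail_in_verts[OF ea] by (intro UN_I[of "tail G e"]) auto
    next
      assume "depth (head G e) < n"
      then show ?thesis using ea head_in_verts[OF ea] by (intro UN_I[of "head G e"]) auto
    qed
  qed
  moreover have "finite (\<Union>v\<in>{v \<in> verts G. depth v < n}. in_arcs G v \<union> out_arcs G v)"
    using low_fin lf by (auto simp: locally_finite_graph_def)
  ultimately have "finite (cotree - N)" by (rule finite_subset)
  then have N_inf: "infinite N" using inf by (meson finite_Diff2)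
  define \<alpha> where "\<alpha> = (\<lambda>e. (ancestor n (tail G e), ancestor n (head G e)))"
  have N_verts: "tail G e \<in> verts G" "head G e \<in> verts G" "n \<le> depth (tail G e)" "n \<le> depth (head G e)" "e \<in> arcs G"
    if "e \<in> N" for e
    using that by (auto simp: N_def cotree_def)
  have "\<alpha> ` N \<subseteq> {v \<in> verts G. depth v = n} \<times> {v \<in> verts G. depth v = n}"
    using N_verts ancestor by (auto simp: \<alpha>_def)
  then have "finite (\<alpha> ` N)"
    by (rule finite_subset) (simp add: finite_depth_level[OF lf])
  then obtain e0 where e0: "e0 \<in> N" "infinite {e \<in> N. \<alpha> e = \<alpha> e0}"
    using pigeonhole_infinite[OF N_inf] by blast
  define w where "w = ancestor n (tail G e0)"
  define w' where "w' = ancestor n (head G e0)"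
  have "infinite ({e \<in> N. \<alpha> e = \<alpha> e0} - {e0})" using e0(2) by simp
  then obtain e1 where e1: "e1 \<in> N" "\<alpha> e1 = \<alpha> e0" "e1 \<noteq> e0"
    using infinite_imp_nonempty by blast
  have "infinite ({e \<in> N. \<alpha> e = \<alpha> e0} - {e0, e1})" using e0(2) by simp
  then obtain e2 where e2: "e2 \<in> N" "\<alpha> e2 = \<alpha> e0" "e2 \<noteq> e0" "e2 \<noteq> e1"
    using infinite_imp_nonempty by blast
  have in_branch: "tail G e \<in> branch n w" "head G e \<in> branch n w'" if "e \<in> N" "\<alpha> e = \<alpha> e0" for e
    using N_verts[OF that(1)] that(2) by (auto simp: branch_def \<alpha>_def w_def w'_def)
  have ww: "w \<in> branch n w" "w' \<in> branch n w'"
    using ancestor N_verts[OF e0(1)] by (auto simp: branch_def ancestor_def w_def w'_def)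
  define D where "D = subtree (branch n w) w \<union> edge_map G e0 ` {0..1} \<union> subtree (branch n w') w'"
  have conn: "path_connectedin (graph_space G) D"
    unfolding D_def
  proof (intro path_connectedin_Un path_connectedin_branch ww)
    show "path_connectedin (graph_space G) (edge_map G e0 ` {0..1})"
      by (rule path_connectedin_path_image[OF pathin_edge_map[OF wf N_verts(5)[OF e0(1)]]])
    have "Inl (tail G e0) \<in> edge_map G e0 ` {0..1}" "Inl (head G e0) \<in> edge_map G e0 ` {0..1}"
      by (rule image_eqI[of _ _ 0], simp, simp) (rule image_eqI[of _ _ 1], simp, simp)
    moreover have "Inl (tail G e0) \<in> subtree (branch n w) w" "Inl (head G e0) \<in> subtree (branch n w') w'"
      using in_branch[OF e0(1)] by (auto simp: subtree_def)
    ultimately show "subtree (branch n w) w \<inter> edge_map G e0 ` {0..1} \<noteq> {}"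
      "(subtree (branch n w) w \<union> edge_map G e0 ` {0..1}) \<inter> subtree (branch n w') w' \<noteq> {}"
      by blast+
  qed
  have ends: "{Inl (tail G e), Inl (head G e)} \<subseteq> D" if "e \<in> N" "\<alpha> e = \<alpha> e0" for e
    using in_branch[OF that] by (auto simp: D_def subtree_def)
  have avoid: "D \<inter> open_edge e = {}" if "e \<in> N" "e \<noteq> e0" for e
  proof -
    have "subtree (branch n u) u \<inter> open_edge e = {}" for u
      using that branch_step(2) by (intro subtree_avoids_cotree) (auto simp: N_def branch_def)
    moreover have "edge_map G e0 ` {0..1} \<inter> open_edge e = {}"
      using edge_map_notin_open_edge[of e e0 G] that by auto
    ultimately show ?thesis by (auto simp: D_def)
  qed
  have far: "(D \<union> open_edge e \<union> open_edge e') \<inter> graph_points H = {}" if "e \<in> N" "e' \<in> N" for e e'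
  proof -
    have H_edge: "tail G d \<in> verts H \<and> head G d \<in> verts H" if "d \<in> arcs H" for d
      using that HG wf_digraph.tail_in_verts[OF wfH that] wf_digraph.head_in_verts[OF wfH that]
      by (auto simp: subgraph_def compatible_def)
    have far_vertex: "Inl v \<notin> graph_points H" if "n \<le> depth v" for v
      using that n by (fastforce simp: graph_points_def)
    have far_edge: "open_edge d \<inter> graph_points H = {}" if "n \<le> depth (tail G d) \<or> n \<le> depth (head G d)" for d
      using that H_edge[of d] n by (fastforce simp: graph_points_def open_edge_def)
    have "subtree (branch n u) u \<inter> graph_points H = {}" for u
    proof -
      have "open_edge (up v) \<inter> graph_points H = {}" if "v \<in> branch n u" "v \<noteq> u" for v
        using branch_step[OF that] up_ends[of v] that by (intro far_edge) (auto simp: branch_def)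
      moreover have "Inl v \<notin> graph_points H" if "v \<in> branch n u" for v
        using that by (intro far_vertex) (simp add: branch_def)
      ultimately show ?thesis by (auto simp: subtree_def)
    qed
    moreover have "edge_map G e0 ` {0..1} \<inter> graph_points H = {}"
    proof -
      have "{Inl (tail G e0), Inl (head G e0)} \<union> open_edge e0 \<subseteq> - graph_points H"
        using far_edge[of e0] far_vertex[OF N_verts(3)[OF e0(1)]] far_vertex[OF N_verts(4)[OF e0(1)]]
          N_verts(3)[OF e0(1)] by auto
      with edge_map_range[of G e0] have "edge_map G e0 ` {0..1} \<subseteq> - graph_points H" by (rule subset_trans)
      then show ?thesis by auto
    qed
    ultimately show ?thesis
      using far_edge[of e] far_edge[of e'] N_verts(3)[OF that(1)] N_verts(3)[OF that(2)] by (auto simp: D_def)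
  qed
  have "linked_edges G (graph_points H) e1 e2 D"
    unfolding linked_edges_def
    using e2(4) conn ends[OF e1(1,2)] ends[OF e2(1,2)] avoid[OF e1(1,3)] avoid[OF e2(1,3)] far[OF e1(1) e2(1)]
      N_verts(5)[OF e1(1)] N_verts(5)[OF e2(1)]
    by (intro conjI) (simp_all add: Int_Un_distrib)
  then show thesis by (rule that)
qed

end

text \<open>
  Breadth first search: the depth is the distance from the root. All vertices are reached, because
  the part of the graph that is reached is open and closed.
\<close>

lemma exists_rooted_tree:
  assumes wf: "wf_digraph G" and conn: "connected_space (graph_space G)" and r: "r \<in> verts G"
  obtains depth parent up where "rooted_tree G r depth parent up"
proof -
  define adj where "adj = {(u, v). \<exists>e\<in>arcs G. tail G e = u \<and> head G e = v \<or> tail G e = v \<and> head G e = u}"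
  define B where "B = {v. (r, v) \<in> adj\<^sup>*}"
  have adj_B: "tail G e \<in> B \<longleftrightarrow> head G e \<in> B" if "e \<in> arcs G" for e
    using that unfolding B_def by (auto simp: adj_def intro: rtrancl_into_rtrancl)
  define P where "P = {x \<in> graph_points G. case x of Inl v \<Rightarrow> v \<in> B | Inr (e, t) \<Rightarrow> tail G e \<in> B}"
  have pre: "{0..1} \<inter> edge_map G e -` P = (if tail G e \<in> B then {0..1} else {})"
    "{0..1} \<inter> edge_map G e -` (graph_points G - P) = (if tail G e \<in> B then {} else {0..1})" if e: "e \<in> arcs G" for e
    using edge_map_in_graph_points[OF wf e] adj_B[OF e] by (auto simp: P_def edge_map_def split: if_splits)
  have "openin (graph_space G) P" "openin (graph_space G) (graph_points G - P)"
    unfolding openin_graph_space using pre by (auto simp: P_def)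
  then have "P = {} \<or> P = graph_points G"
    using conn unfolding connected_space_clopen_in closedin_def
    by (metis openin_subset topspace_graph_space[OF wf])
  moreover have "Inl r \<in> P" using r by (auto simp: P_def B_def graph_points_def)
  ultimately have P: "P = graph_points G" by blast
  have reach: "\<exists>n. (r, v) \<in> adj ^^ n" if "v \<in> verts G" for v
  proof -
    have "Inl v \<in> P" using that P by (auto simp: graph_points_def)
    then show ?thesis by (simp add: P_def B_def rtrancl_power)
  qed
  define depth where "depth = (\<lambda>v. LEAST n. (r, v) \<in> adj ^^ n)"
  have depth: "(r, v) \<in> adj ^^ depth v" if "v \<in> verts G" for v
    unfolding depth_def using reach[OF that] by (rule LeastI_ex)
  have depth_le: "depth v \<le> n" if "(r, v) \<in> adj ^^ n" for v n
    unfolding depth_def using that by (rule Least_le)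
  have step: "\<exists>u e. e \<in> arcs G \<and> u \<in> verts G \<and> depth v = Suc (depth u) \<and>
      (tail G e = u \<and> head G e = v \<or> tail G e = v \<and> head G e = u)" if v: "v \<in> verts G" "v \<noteq> r" for v
  proof -
    have "depth v \<noteq> 0"
    proof
      assume "depth v = 0"
      then have "(r, v) \<in> adj ^^ 0" using depth[OF v(1)] by simp
      then show False using v(2) by simp
    qed
    then obtain m where m: "depth v = Suc m" using not0_implies_Suc by blast
    then obtain u where u: "(r, u) \<in> adj ^^ m" "(u, v) \<in> adj" using depth[OF v(1)] by auto
    then obtain e where e: "e \<in> arcs G" "tail G e = u \<and> head G e = v \<or> tail G e = v \<and> head G e = u"
      by (auto simp: adj_def)
    then have uv: "u \<in> verts G" using wf_digraph.tail_in_verts[OF wf] wf_digraph.head_in_verts[OF wf] by blast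
    have "(r, v) \<in> adj ^^ Suc (depth u)" using depth[OF uv] u(2) by auto
    then have "depth v \<le> Suc (depth u)" by (rule depth_le)
    moreover have "depth u \<le> m" by (rule depth_le[OF u(1)])
    ultimately show ?thesis using e uv m by (intro exI[of _ u] exI[of _ e]) auto
  qed
  obtain parent up where pu: "\<And>v. v \<in> verts G \<Longrightarrow> v \<noteq> r \<Longrightarrow> up v \<in> arcs G \<and> parent v \<in> verts G \<and>
      depth v = Suc (depth (parent v)) \<and>
      (tail G (up v) = parent v \<and> head G (up v) = v \<or> tail G (up v) = v \<and> head G (up v) = parent v)"
    using step by metis
  interpret wf_digraph G by (rule wf)
  have "rooted_tree G r depth parent up"
    by unfold_locales (use r pu depth_le[of r 0] in auto)
  then show thesis by (rule that)
qed

lemma vertex_connected_to_point: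
  assumes wf: "wf_digraph G" and x: "x \<in> graph_points G"
  obtains r \<beta> where "r \<in> verts G" "pathin (graph_space G) \<beta>" "\<beta> 0 = x" "\<beta> 1 = Inl r"
  using x
proof (cases rule: graph_point_cases)
  case (vertex v)
  then show thesis
    using x by (intro that[of v "\<lambda>_. x"]) (simp_all add: topspace_graph_space[OF wf])
next
  case (edge e t)
  have ts: "t * (1 - s) \<in> {0..1}" if "s \<in> {0..1}" for s
    using that edge by (auto simp: mult_le_one)
  have "continuous_map I01 I01 (\<lambda>s. t * (1 - s))"
    using ts by (auto intro!: continuous_intros)
  from continuous_map_compose[OF this continuous_map_edge_map[OF wf edge(1)]]
  have "pathin (graph_space G) (\<lambda>s. edge_map G e (t * (1 - s)))" by (simp add: pathin_def o_def)
  then show thesis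
    using edge wf_digraph.tail_in_verts[OF wf edge(1)]
    by (intro that[of "tail G e" "\<lambda>s. edge_map G e (t * (1 - s))"]) simp_all
qed

section \<open>Non-amenability of the mapping class group\<close>

text \<open>
  The commutator of two basis elements is a reduced word.
\<close>

lemma free_basis_not_commutative:
  assumes G: "group G" and S: "free_basis G S" "infinite S \<or> 2 \<le> card S"
    and comm: "\<And>x y. x \<in> carrier G \<Longrightarrow> y \<in> carrier G \<Longrightarrow> x \<otimes>\<^bsub>G\<^esub> y = y \<otimes>\<^bsub>G\<^esub> x"
  shows False
proof -
  interpret group G by (rule G)
  obtain a b where ab: "a \<in> S" "b \<in> S" "a \<noteq> b"
  proof -
    have "\<not> S \<subseteq> {a}" for a
      using S(2) finite_subset[of S "{a}"] card_mono[of "{a}" S] by auto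
    then show thesis using that by blast
  qed
  let ?w = "[(a, True), (b, True), (a, False), (b, False)]"
  have c: "a \<in> carrier G" "b \<in> carrier G" using S(1) ab by (auto simp: free_basis_def)
  have "reduced_word ?w" using ab by (simp add: reduced_word_def)
  then have ne: "eval_word G ?w \<noteq> \<one>\<^bsub>G\<^esub>"
    using S(1) ab unfolding free_basis_def by auto
  have "eval_word G ?w = (a \<otimes>\<^bsub>G\<^esub> b) \<otimes>\<^bsub>G\<^esub> (inv\<^bsub>G\<^esub> a \<otimes>\<^bsub>G\<^esub> inv\<^bsub>G\<^esub> b)"
    using c by (simp add: eval_word_def m_assoc)
  also have "inv\<^bsub>G\<^esub> a \<otimes>\<^bsub>G\<^esub> inv\<^bsub>G\<^esub> b = inv\<^bsub>G\<^esub> (a \<otimes>\<^bsub>G\<^esub> b)"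
    using c comm[of "inv\<^bsub>G\<^esub> a" "inv\<^bsub>G\<^esub> b"] by (simp add: inv_mult_group)
  finally show False using ne c by simp
qed

lemma generated_by_one_commutative:
  assumes "group G" "c \<in> carrier G" "generate G {c} = carrier G" "x \<in> carrier G" "y \<in> carrier G"
  shows "x \<otimes>\<^bsub>G\<^esub> y = y \<otimes>\<^bsub>G\<^esub> x"
proof -
  interpret group G by (rule assms(1))
  have "x \<in> generate G {c}" "y \<in> generate G {c}" using assms(3-5) by simp_all
  then obtain i j :: int where "x = c [^]\<^bsub>G\<^esub> i" "y = c [^]\<^bsub>G\<^esub> j"
    unfolding generate_pow[OF assms(2)] by blast
  then show ?thesis using assms(2) by (simp add: int_pow_mult[symmetric] add.commute)
qed

lemma exists_cotree_generators:
  assumes wf: "wf_digraph G" and conn: "connected_space (graph_space G)" and x0: "x0 \<in> graph_points G"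
  obtains r depth parent up g where "rooted_tree G r depth parent up"
    "g ` rooted_tree.cotree G r up \<subseteq> carrier (fundamental_group (graph_space G) x0)"
    "generate (fundamental_group (graph_space G) x0) (g ` rooted_tree.cotree G r up) =
      carrier (fundamental_group (graph_space G) x0)"
proof -
  obtain r \<beta> where r: "r \<in> verts G" and \<beta>: "pathin (graph_space G) \<beta>" "\<beta> 0 = x0" "\<beta> 1 = Inl r"
    by (rule vertex_connected_to_point[OF wf x0])
  obtain depth parent up where T: "rooted_tree G r depth parent up"
    by (rule exists_rooted_tree[OF wf conn r])
  show thesis
    by (rule rooted_tree.fundamental_group_generated_by_cotree[OF T \<beta>]) (rule that[OF T])
qed

theorem theorem1p5:
  fixes \<Gamma> :: "('v, 'e) pre_digraph"
  assumes "wf_digraph \<Gamma>"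
    and "locally_finite_graph \<Gamma>"
    and "infinite_graph \<Gamma>"
    and "connected_space (graph_space \<Gamma>)"
    and "rank_at_least 2 (graph_space \<Gamma>)"
  shows "\<not> amenable (mapping_class_group (graph_space \<Gamma>)) (mcg_topology \<Gamma>) \<and>
    (infinite_type (graph_space \<Gamma>) \<longrightarrow>
      (\<forall>U. subgroup U (mapping_class_group (graph_space \<Gamma>)) \<and> openin (mcg_topology \<Gamma>) U \<longrightarrow>
        \<not> amenable (mapping_class_group (graph_space \<Gamma>)\<lparr>carrier := U\<rparr>)
            (subtopology (mcg_topology \<Gamma>) U)))"
proof (intro conjI impI allI)
  let ?X = "graph_space \<Gamma>"
  let ?M = "mapping_class_group ?X"
  let ?\<pi> = "fundamental_group ?X"
  note wf = assms(1)
  interpret M: group ?M by (rule group_mapping_class_group)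
  show "\<not> amenable ?M (mcg_topology \<Gamma>)"
  proof -
    obtain x0 S where x0: "x0 \<in> topspace ?X" and S: "free_basis (?\<pi> x0) S" "infinite S \<or> 2 \<le> card S"
      using assms(5) by (auto simp: rank_at_least_def)
    have P: "group (?\<pi> x0)" by (rule group_fundamental_group[OF x0])
    obtain r depth parent up g where T: "rooted_tree \<Gamma> r depth parent up"
      and g: "g ` rooted_tree.cotree \<Gamma> r up \<subseteq> carrier (?\<pi> x0)"
        "generate (?\<pi> x0) (g ` rooted_tree.cotree \<Gamma> r up) = carrier (?\<pi> x0)"
      by (rule exists_cotree_generators[OF wf assms(4) x0[unfolded topspace_graph_space[OF wf]]])
    interpret T: rooted_tree \<Gamma> r depth parent up by (rule T)
    have "\<exists>e\<in>T.cotree. \<exists>e'\<in>T.cotree. e \<noteq> e'"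
    proof (rule ccontr)
      assume "\<not> (\<exists>e\<in>T.cotree. \<exists>e'\<in>T.cotree. e \<noteq> e')"
      then have one: "d = d'" if "d \<in> T.cotree" "d' \<in> T.cotree" for d d' using that by blast
      obtain c where c: "c \<in> carrier (?\<pi> x0)" "g ` T.cotree \<subseteq> {c}"
      proof (cases "T.cotree = {}")
        case True
        then show thesis using that[OF monoid.one_closed[OF group.is_monoid[OF P]]] by simp
      next
        case False
        then obtain d where d: "d \<in> T.cotree" by blast
        have "g ` T.cotree \<subseteq> {g d}" using one[OF _ d] by auto
        then show thesis using that[of "g d"] subsetD[OF g(1) imageI[OF d]] by blast
      qed
      have "carrier (?\<pi> x0) \<subseteq> generate (?\<pi> x0) {c}"
        using group.mono_generate[OF P c(2)] unfolding g(2) .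
      moreover have "generate (?\<pi> x0) {c} \<subseteq> carrier (?\<pi> x0)"
        using c(1) by (intro group.generate_incl[OF P]) simp
      ultimately have gen: "generate (?\<pi> x0) {c} = carrier (?\<pi> x0)" by (rule equalityI[rotated])
      show False
        by (rule free_basis_not_commutative[OF P S]) (rule generated_by_one_commutative[OF P c(1) gen])
    qed
    then obtain e e' where e: "e \<in> T.cotree" "e' \<in> T.cotree" "e \<noteq> e'" by blast
    have "openin (mcg_topology \<Gamma>) (carrier ?M)"
      using openin_topspace[of "mcg_topology \<Gamma>"] by (simp add: topspace_mcg_topology[OF wf])
    moreover have "mcg_nbhd ?X {} \<subseteq> carrier ?M" by (auto simp: mcg_nbhd_def)
    ultimately have "\<not> amenable (?M\<lparr>carrier := carrier ?M\<rparr>) (subtopology (mcg_topology \<Gamma>) (carrier ?M))"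
      by (rule not_amenable_if_linked_edges[OF wf T.linked_edges_if_two_cotree_edges[OF e] M.subgroup_self])
    moreover have "subtopology (mcg_topology \<Gamma>) (carrier ?M) = mcg_topology \<Gamma>"
      by (simp add: topspace_mcg_topology[OF wf, symmetric])
    ultimately show ?thesis by simp
  qed
  fix U assume "infinite_type ?X" and U: "subgroup U ?M \<and> openin (mcg_topology \<Gamma>) U"
  then obtain x0 where x0: "x0 \<in> topspace ?X" and nfg: "\<not> finitely_generated_group (?\<pi> x0)"
    by (auto simp: infinite_type_def)
  obtain r depth parent up g where T: "rooted_tree \<Gamma> r depth parent up"
    and g: "g ` rooted_tree.cotree \<Gamma> r up \<subseteq> carrier (?\<pi> x0)"
      "generate (?\<pi> x0) (g ` rooted_tree.cotree \<Gamma> r up) = carrier (?\<pi> x0)"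
    by (rule exists_cotree_generators[OF wf assms(4) x0[unfolded topspace_graph_space[OF wf]]])
  interpret T: rooted_tree \<Gamma> r depth parent up by (rule T)
  have inf: "infinite T.cotree"
  proof
    assume "finite T.cotree"
    then have "finite (g ` T.cotree)" by (rule finite_imageI)
    then show False using nfg g unfolding finitely_generated_group_def by metis
  qed
  have one: "\<one>\<^bsub>?M\<^esub> \<in> U" using U by (simp add: subgroup.one_closed)
  have "\<forall>A\<in>U. \<exists>H. finite_subgraph H \<Gamma> \<and> A <#\<^bsub>?M\<^esub> mcg_nbhd ?X (graph_points H) \<subseteq> U"
    using U unfolding openin_mcg_topology by (elim conjE)
  then obtain H where H: "finite_subgraph H \<Gamma>" "\<one>\<^bsub>?M\<^esub> <#\<^bsub>?M\<^esub> mcg_nbhd ?X (graph_points H) \<subseteq> U"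
    using one by blast
  have nb: "mcg_nbhd ?X (graph_points H) \<subseteq> U"
  proof
    fix A assume A: "A \<in> mcg_nbhd ?X (graph_points H)"
    then have "\<one>\<^bsub>?M\<^esub> \<otimes>\<^bsub>?M\<^esub> A = A" by (intro M.l_one) (simp add: mcg_nbhd_def)
    then have "A \<in> \<one>\<^bsub>?M\<^esub> <#\<^bsub>?M\<^esub> mcg_nbhd ?X (graph_points H)"
      using A unfolding l_coset_def by force
    then show "A \<in> U" using H(2) by blast
  qed
  obtain e e' D where link: "linked_edges \<Gamma> (graph_points H) e e' D"
    by (rule T.linked_edges_outside_finite_subgraph[OF assms(2) inf H(1)])
  show "\<not> amenable (?M\<lparr>carrier := U\<rparr>) (subtopology (mcg_topology \<Gamma>) U)"
    using U by (intro not_amenable_if_linked_edges[OF wf link _ _ nb]) simp_all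
qed

end
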